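(* Let $\mu\in\mathcal M_+$, $\mu\ne\delta_0$, let $p\in\mathbb N=\{1,2,\dots\}$, $\alpha\in[p,p+1]$ and $L\in\mathcal R_0$. (i) If either (a) $\alpha\in(p,p+1)$, or (b) $\alpha=p$ and $\int_1^{+\infty}L(t)/t\,\mathrm dt<+\infty$, then $$\mu\big((x,+\infty)\big)\sim x^{-\alpha}L(x)$$ is equivalent to the condition ($m_1(\mu)<+\infty$ and) $$S_\mu^{(p)}\left(-\frac1x\right)\sim-\frac{\Gamma(\alpha+1)\Gamma(p+1-\alpha)}{m_1(\mu)^{\alpha+1}}\,x^{p+1-\alpha}L(x).$$ (ii) If $\alpha=p+1$ and $\int_1^{+\infty}L(t)/t\,\mathrm dt=+\infty$, then $\mu\big((x,+\infty)\big)\sim x^{-\alpha}L(x)$ is equivalent to the condition ($m_1(\mu)<+\infty$ and) $$x\mapsto S_\mu^{(p)}\left(-\frac1x\right)\in\Pi_L\left(-\frac{(p+1)!}{m_1(\mu)^{p+2}}\right).$$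
   Context: $\mathcal M_+$ is the set of Borel probability measures on $[0,+\infty)$; $m_1(\mu)=\int_{[0,+\infty)}t\,\mu(\mathrm dt)$. $f(x)\sim g(x)$ means $f(x)/g(x)\to1$ as $x\to+\infty$. $\mathcal R_0$ is the class of slowly varying functions: (positive, measurable) $f$ on a neighborhood of $+\infty$ with $f(\lambda x)/f(x)\to1$ as $x\to+\infty$ for every $\lambda>0$. (The convergence or divergence of $\int_1^{+\infty}L(t)/t\,\mathrm dt$ refers to the behavior at $+\infty$.) For $L\in\mathcal R_0$ and $c\in\mathbb R$, $f\in\Pi_L(c)$ means that $\lim_{x\to+\infty}\frac{f(\lambda x)-f(x)}{L(x)}=c\log\lambda$ for all $\lambda>0$. For $\mu\in\mathcal M_+$, $\mu\ne\delta_0$, put $\delta=\mu(\{0\})<1$ and $\psi_\mu(z)=\int_{[0,+\infty)}\frac{zt}{1-zt}\,\mu(\mathrm dt)$, $z<0$. The map $\psi_\mu:(-\infty,0)\to(\delta-1,0)$ is invertible with inverse $\chi_\mu$, and the $S$-transform is $S_\mu(z)=\frac{z+1}{z}\chi_\mu(z)$, $z\in(\delta-1,0)$. It is analytic on $(\delta-1,0)$, and $S_\mu^{(p)}$ denotes its $p$th derivative. *)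

theory Defs
  imports "HOL-Probability.Probability" "HOL-Library.Landau_Symbols"
begin

definition prob_measures_nonneg :: "real measure set"
  where "prob_measures_nonneg =
    {\<mu>. sets \<mu> = sets (restrict_space borel {0..}) \<and> prob_space \<mu>}"

definition dirac_zero :: "real measure"
  where "dirac_zero = return (restrict_space borel {0..}) 0"

definition first_moment :: "real measure \<Rightarrow> ennreal"
  where "first_moment \<mu> = (\<integral>\<^sup>+ t. ennreal t \<partial>\<mu>)"

(* Slow variation only constrains a neighborhood of +infinity; "measurable" is taken in the
   Lebesgue sense, which includes all Borel functions. *)
definition slowly_varying :: "(real \<Rightarrow> real) \<Rightarrow> bool"
  where "slowly_varying f \<longleftrightarrow>
    (\<exists>X. (\<forall>x\<ge>X. f x > 0) \<and> f \<in> borel_measurable (lebesgue_on {X..})) \<and>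
    (\<forall>k>0. ((\<lambda>x. f (k * x) / f x) \<longlongrightarrow> 1) at_top)"

(* Convergence and divergence of the integral of L(t)/t at +infinity. The lower endpoint has to
   be taken large, since L is only controlled near +infinity. *)
definition log_integral_converges :: "(real \<Rightarrow> real) \<Rightarrow> bool"
  where "log_integral_converges L \<longleftrightarrow>
    (\<forall>\<^sub>F X in at_top. (\<integral>\<^sup>+ t\<in>{X..}. ennreal (L t / t) \<partial>lebesgue) < \<infinity>)"

definition log_integral_diverges :: "(real \<Rightarrow> real) \<Rightarrow> bool"
  where "log_integral_diverges L \<longleftrightarrow>
    (\<forall>\<^sub>F X in at_top. (\<integral>\<^sup>+ t\<in>{X..}. ennreal (L t / t) \<partial>lebesgue) = \<infinity>)"

definition de_Haan_class :: "(real \<Rightarrow> real) \<Rightarrow> real \<Rightarrow> (real \<Rightarrow> real) set"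
  where "de_Haan_class L c =
    {f. \<forall>k>0. ((\<lambda>x. (f (k * x) - f x) / L x) \<longlongrightarrow> c * ln k) at_top}"

definition psi_transform :: "real measure \<Rightarrow> real \<Rightarrow> real"
  where "psi_transform \<mu> z = (\<integral>t. z * t / (1 - z * t) \<partial>\<mu>)"

(* For a probability measure other than dirac_zero this is the inverse of the bijection
   psi_transform \<mu> from {..<0} onto {measure \<mu> {0} - 1<..<0}; the values of chi_transform and
   S_transform outside the latter open interval carry no meaning. *)
definition chi_transform :: "real measure \<Rightarrow> real \<Rightarrow> real"
  where "chi_transform \<mu> = the_inv_into {..<0} (psi_transform \<mu>)"

definition S_transform :: "real measure \<Rightarrow> real \<Rightarrow> real"
  where "S_transform \<mu> z = (z + 1) / z * chi_transform \<mu> z"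

end

theory Submission imports Defs begin

text \<open>
For \<open>w < 0\<close> let \<open>m\<^sub>k w\<close> denote the integral of \<open>(t / (1 - w t))\<^sup>k\<close> against \<open>\<mu>\<close> (the constant
\<open>rmom\<close> below). Everything in the statement is a function of these resolvent moments:
\<open>\<psi> w = w m\<^sub>1 w\<close>, the derivative of \<open>m\<^sub>k\<close> is \<open>k m\<^sub>k\<^sub>+\<^sub>1\<close>, and \<open>S (\<psi> w) = 1 / m\<^sub>1 w + w\<close>. Differentiating
the last identity \<open>p\<close> times along \<open>\<psi>\<close> gives \<open>S_derivs\<close>: the \<open>p\<close>th derivative of \<open>S\<close> at
\<open>\<psi> w\<close> is \<open>r w - a w * m\<^sub>p\<^sub>+\<^sub>1 w\<close>, where \<open>r\<close> and \<open>a\<close> only involve \<open>w\<close>, the reciprocals of \<open>m\<^sub>1\<close> and of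
the derivative of \<open>\<psi>\<close>, and \<open>m\<^sub>1, \<dots>, m\<^sub>p\<close>. If the \<open>p\<close>th moment of \<open>\<mu>\<close> is finite, then \<open>r\<close> converges and
\<open>a\<close> converges to \<open>p!\<close> over the \<open>(p + 2)\<close>nd power of the mean as \<open>w\<close> tends to \<open>0\<close>, so the singular
behaviour of the derivative of \<open>S\<close> is that of \<open>m\<^sub>p\<^sub>+\<^sub>1\<close>.

The resolvent moments are tied to the tail of \<open>\<mu>\<close> by a Tauberian theorem, \<open>tail_iff_rmom\<close>: for
\<open>0 < \<alpha> < n\<close> the tail is equivalent to \<open>x powr - \<alpha> * L x\<close> iff \<open>m\<^sub>n (-1/x)\<close> is equivalent to a constant
times \<open>x powr (n - \<alpha>) * L x\<close>. One direction is Fubini and dominated convergence. For the other, the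
derivative of \<open>m\<^sub>k (-1/x)\<close> is \<open>k m\<^sub>k\<^sub>+\<^sub>1 (-1/x) / x\<^sup>2\<close> and \<open>m\<^sub>k\<^sub>+\<^sub>1 (-1/x)\<close> increases with \<open>x\<close>, so that a monotone
density argument (\<open>monotone_density\<close>) carries the asymptotics from \<open>n\<close> to every \<open>k \<ge> n\<close>. In the
variable \<open>s = t / (x + t)\<close> these are the moments of a measure on the unit interval, and polynomial
approximation recovers its mass on \<open>s > 1/2\<close>, which is the tail at \<open>x\<close>.

For \<open>\<alpha> < p + 1\<close> this is applied with \<open>n = p + 1\<close>. For \<open>\<alpha> = p + 1\<close> the power of \<open>x\<close> would
disappear; there \<open>n = p + 2\<close> is used, and monotone densities translate \<open>m\<^sub>p\<^sub>+\<^sub>2 (-1/x) \<sim> x L x\<close> into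
membership of \<open>m\<^sub>p\<^sub>+\<^sub>1 (-1/x)\<close> in the de Haan class (\<open>tail_iff_rmom_de_Haan\<close>).

Passing from \<open>\<psi> w = -1/x\<close> to \<open>w = -1/y\<close> changes the variable only by an asymptotically constant
factor, the mean of \<open>\<mu>\<close>, to which slowly varying functions are insensitive by the uniform
convergence theorem (\<open>slowly_varying_uniform\<close>). In the de Haan case the same insensitivity comes from
monotonicity of \<open>m\<^sub>p\<^sub>+\<^sub>1 (-1/y)\<close>, and the error terms are powers of \<open>y\<close> with negative exponent, hence
\<open>o(L)\<close>.

Finiteness of the \<open>p\<close>th moment has to be derived from either side of the equivalence. The integral
condition on \<open>L\<close>, or \<open>\<alpha> > p\<close>, makes \<open>m\<^sub>p\<^sub>+\<^sub>1 (-1/x) / x\<^sup>2\<close>, respectively the \<open>p\<close>th derivative of \<open>S\<close> at \<open>-1/x\<close>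
divided by \<open>x\<^sup>2\<close>, integrable at infinity. In the first case the primitive is \<open>m\<^sub>p (-1/x) / p\<close>, whose
boundedness is the finiteness of the moment. In the second case the derivatives of order less than
\<open>p\<close> are bounded, and the expansion above yields the moments one after the other
(\<open>S_der_imp_moment\<close>).
\<close>

section \<open>Slowly varying functions\<close>

text \<open>The sets \<open>E n\<close> increase to the whole interval, because \<open>g (k * x) - g x\<close> tends to \<open>0\<close> for
each single \<open>k\<close>; so their measures eventually come close to \<open>5/4\<close>. Here \<open>g\<close> stands for the
logarithm of a slowly varying function.\<close>

lemma measure_uniform_ratio_set:
  fixes g :: "real \<Rightarrow> real"
  assumes g [measurable]: "g \<in> borel_measurable lebesgue"
    and lim: "\<And>k. k > 0 \<Longrightarrow> ((\<lambda>x. g (k * x) - g x) \<longlongrightarrow> 0) at_top"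
    and y: "filterlim y at_top sequentially" and d: "d > 0"
  defines "E \<equiv> \<lambda>n::nat. {k\<in>{1..9/4}. \<forall>m\<ge>n. \<bar>g (y m * k) - g (y m)\<bar> < d}"
  shows "\<forall>\<^sub>F n in sequentially. E n \<in> lmeasurable \<and> measure lebesgue (E n) > 6/5"
proof -
  have [measurable]: "(\<lambda>k. g (y m * k)) \<in> borel_measurable lebesgue" for m
    using measurable_compose[OF lebesgue_measurable_scaling[of "y m"] g] by simp
  have I: "{1..9/4::real} \<in> lmeasurable"
    using lmeasurable_cbox[of 1 "9/4::real"] by (simp only: box_real)
  have sets: "E n \<in> sets lebesgue" for n
  proof -
    have "E n = {1..9/4} \<inter> (\<Inter>m\<in>{n..}. {k\<in>space lebesgue. \<bar>g (y m * k) - g (y m)\<bar> < d})"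
      by (auto simp: E_def)
    moreover have "{k\<in>space lebesgue. \<bar>g (y m * k) - g (y m)\<bar> < d} \<in> sets lebesgue" for m
      by measurable
    then have "(\<Inter>m\<in>{n..}. {k\<in>space lebesgue. \<bar>g (y m * k) - g (y m)\<bar> < d}) \<in> sets lebesgue"
      by (intro sets.countable_INT) auto
    ultimately show ?thesis using fmeasurableD[OF I] by (simp only: sets.Int)
  qed
  have lm: "E n \<in> lmeasurable" for n
    by (rule fmeasurableI2[OF I _ sets]) (unfold E_def, blast)
  have inc: "incseq E"
    by (rule incseq_SucI) (auto simp: E_def)
  have un: "(\<Union>n. E n) = {1..9/4}"
  proof
    show "{1..9/4} \<subseteq> (\<Union>n. E n)"
    proof
      fix k :: real assume k: "k \<in> {1..9/4}"
      have "\<forall>\<^sub>F x in at_top. \<bar>g (k * x) - g x\<bar> < d"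
        using tendstoD[OF lim[of k] d] k by (simp add: dist_real_def)
      then have "\<forall>\<^sub>F n in sequentially. \<bar>g (k * y n) - g (y n)\<bar> < d"
        using y by (rule eventually_compose_filterlim)
      then show "k \<in> (\<Union>n. E n)"
        using k by (auto simp: E_def eventually_sequentially mult.commute)
    qed
  qed (auto simp: E_def)
  have "(\<lambda>n. measure lebesgue (E n)) \<longlonglongrightarrow> measure lebesgue (\<Union>n. E n)"
    by (rule Lim_measure_incseq) (use sets inc un in auto)
  then have "(\<lambda>n. measure lebesgue (E n)) \<longlonglongrightarrow> 5/4"
    by (simp add: un)
  then have "\<forall>\<^sub>F n in sequentially. measure lebesgue (E n) > 6/5"
    by (rule order_tendstoD) simp
  then show ?thesis using lm by (auto elim: eventually_mono)
qed

text \<open>If uniformity fails along \<open>x n\<close> and \<open>k n\<close>, then the set of \<open>u\<close> for which \<open>g (x n * u)\<close>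
is close to \<open>g (x n)\<close> and the set of \<open>u\<close> for which it is close to \<open>g (k n * x n)\<close> both have
nearly full measure. They intersect, which makes \<open>g (x n)\<close> and \<open>g (k n * x n)\<close> close to each
other.\<close>

lemma uniform_convergence_of_differences:
  fixes g :: "real \<Rightarrow> real"
  assumes g: "g \<in> borel_measurable lebesgue"
    and lim: "\<And>k. k > 0 \<Longrightarrow> ((\<lambda>x. g (k * x) - g x) \<longlongrightarrow> 0) at_top"
    and e: "e > 0"
  shows "\<exists>X. \<forall>x\<ge>X. \<forall>k\<in>{1..3/2}. \<bar>g (k * x) - g x\<bar> < e"
proof (rule ccontr)
  assume neg: "\<not> ?thesis"
  have "\<forall>n::nat. \<exists>x k. x \<ge> real n + 1 \<and> k \<in> {1..3/2} \<and> \<bar>g (k * x) - g x\<bar> \<ge> e"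
    using neg by (meson not_le)
  then obtain x k where x: "\<And>n::nat. x n \<ge> real n + 1" and k: "\<And>n. k n \<in> {1..3/2}"
    and ge: "\<And>n. \<bar>g (k n * x n) - g (x n)\<bar> \<ge> e" by metis
  have xt: "filterlim x at_top sequentially"
    by (rule filterlim_at_top_mono[OF filterlim_real_sequentially])
       (rule always_eventually, rule allI, rule order_trans[OF _ x], simp)
  have kx: "k n * x n \<ge> real n + 1" for n
    using mult_mono[of 1 "k n" "real n + 1" "x n"] k[of n] x[of n] by simp
  have kxt: "filterlim (\<lambda>n. k n * x n) at_top sequentially"
    by (rule filterlim_at_top_mono[OF filterlim_real_sequentially])
       (rule always_eventually, rule allI, rule order_trans[OF _ kx], simp)
  \<comment> \<open>The window \<open>{1..9/4}\<close> is \<open>{1..(3/2)\<^sup>2}\<close>. Multiplied by \<open>k n \<le> 3/2\<close> it stays inside \<open>{1..27/8}\<close>.\<close>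
  define V where "V n = {u\<in>{1..9/4}. \<forall>m\<ge>n. \<bar>g (x m * u) - g (x m)\<bar> < e/2}" for n
  define W where "W n = {u\<in>{1..9/4}. \<forall>m\<ge>n. \<bar>g (k m * x m * u) - g (k m * x m)\<bar> < e/2}" for n
  have e2: "e / 2 > 0" using e by simp
  have "\<forall>\<^sub>F n in sequentially. V n \<in> lmeasurable \<and> measure lebesgue (V n) > 6/5"
    unfolding V_def by (rule measure_uniform_ratio_set[OF g _ xt e2]) (rule lim)
  moreover have "\<forall>\<^sub>F n in sequentially. W n \<in> lmeasurable \<and> measure lebesgue (W n) > 6/5"
    unfolding W_def by (rule measure_uniform_ratio_set[OF g _ kxt e2]) (rule lim)
  ultimately have "\<forall>\<^sub>F n in sequentially. (V n \<in> lmeasurable \<and> measure lebesgue (V n) > 6/5) \<and>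
      (W n \<in> lmeasurable \<and> measure lebesgue (W n) > 6/5)"
    by (rule eventually_conj)
  then have "\<exists>n. (V n \<in> lmeasurable \<and> measure lebesgue (V n) > 6/5) \<and>
      (W n \<in> lmeasurable \<and> measure lebesgue (W n) > 6/5)"
    using eventually_happens'[OF sequentially_bot] by blast
  then obtain n where V: "V n \<in> lmeasurable" "measure lebesgue (V n) > 6/5"
    and W: "W n \<in> lmeasurable" "measure lebesgue (W n) > 6/5"
    by blast
  have kn: "1 \<le> k n" "k n \<le> 3/2" using k[of n] by auto
  define W' where "W' = (\<lambda>u. k n * u) ` W n"
  have W'm: "measure lebesgue W' = k n * measure lebesgue (W n)"
    using measure_lebesgue_affine[of "k n" 0 "W n"] kn by (simp add: W'_def)
  have sub: "V n \<union> W' \<subseteq> {1..27/8}"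
  proof -
    have "k n * u \<ge> 1 \<and> k n * u \<le> 27/8" if "1 \<le> u" "u \<le> 9/4" for u
      using mult_mono[of 1 "k n" 1 u] mult_mono[of "k n" "3/2" u "9/4"] kn that by auto
    then show ?thesis by (auto simp: V_def W'_def W_def)
  qed
  have W'l: "W' \<in> lmeasurable"
  proof (rule fmeasurableI2[of "{1..27/8}"])
    have "W' = (*\<^sub>R) (1 / k n) -` W n \<inter> space lebesgue"
    proof -
      have "u \<in> W'" if "u / k n \<in> W n" for u
        unfolding W'_def by (rule image_eqI[OF _ that]) (use kn in simp)
      then show ?thesis using kn by (auto simp: W'_def)
    qed
    moreover have "\<dots> \<in> sets lebesgue"
      by (rule measurable_sets[OF lebesgue_measurable_scaling fmeasurableD[OF W(1)]])
    ultimately show "W' \<in> sets lebesgue" by simp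
    show "{1..27/8::real} \<in> lmeasurable"
      using lmeasurable_cbox[of 1 "27/8::real"] by (simp only: box_real)
  qed (use sub in blast)
  \<comment> \<open>Two sets of measure greater than \<open>6/5\<close> cannot be disjoint in an interval of length \<open>19/8\<close>.\<close>
  have "V n \<inter> W' \<noteq> {}"
  proof
    assume dis: "V n \<inter> W' = {}"
    have "measure lebesgue (V n \<union> W') = measure lebesgue (V n) + measure lebesgue W'"
      using V W'l dis by (simp add: measure_Un3)
    moreover have "measure lebesgue (V n \<union> W') \<le> measure lebesgue {1..27/8::real}"
      by (rule measure_mono_fmeasurable) (use sub V W'l in auto)
    moreover have "measure lebesgue W' \<ge> 6/5"
      using W'm mult_mono[of 1 "k n" "6/5" "measure lebesgue (W n)"] kn W by simp
    ultimately show False using V by simp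
  qed
  then obtain u where u: "u \<in> V n" "u \<in> W'" by blast
  then obtain v where v: "v \<in> W n" "u = k n * v" by (auto simp: W'_def)
  have "\<bar>g (x n * u) - g (x n)\<bar> < e/2" using u by (auto simp: V_def)
  moreover have "\<bar>g (x n * u) - g (k n * x n)\<bar> < e/2"
    using v by (auto simp: W_def mult_ac)
  ultimately show False using ge[of n] by linarith
qed

text \<open>A globally measurable logarithm, so that the measure-theoretic argument need not carry the
half-line on which \<open>L\<close> is positive.\<close>

lemma slowly_varying_log:
  assumes "slowly_varying L"
  obtains g X where "g \<in> borel_measurable lebesgue" "\<And>x. x \<ge> X \<Longrightarrow> L x > 0"
    "\<And>x. x \<ge> X \<Longrightarrow> g x = ln (L x)" "\<And>k. k > 0 \<Longrightarrow> ((\<lambda>x. g (k * x) - g x) \<longlongrightarrow> 0) at_top"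
proof -
  from assms obtain X where X: "\<And>x. x \<ge> X \<Longrightarrow> L x > 0"
    and meas: "L \<in> borel_measurable (lebesgue_on {X..})"
    and lim: "\<And>k. k > 0 \<Longrightarrow> ((\<lambda>x. L (k * x) / L x) \<longlongrightarrow> 1) at_top"
    unfolding slowly_varying_def by blast
  define g where "g x = (if x \<in> {X..} then ln (L x) else 0)" for x
  have "g \<in> borel_measurable lebesgue"
    unfolding g_def using meas by (subst borel_measurable_if) auto
  moreover have "((\<lambda>x. g (k * x) - g x) \<longlongrightarrow> 0) at_top" if k: "k > 0" for k
  proof -
    have "((\<lambda>x. ln (L (k * x) / L x)) \<longlongrightarrow> ln 1) at_top"
      by (rule tendsto_ln[OF lim[OF k]]) simp
    moreover have "\<forall>\<^sub>F x in at_top. ln (L (k * x) / L x) = g (k * x) - g x"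
      using eventually_ge_at_top[of X] eventually_ge_at_top[of "X / k"]
    proof eventually_elim
      case (elim x)
      then have "k * x \<ge> X" using k by (simp add: field_simps)
      then show ?case using X[of x] X[of "k * x"] elim by (simp add: g_def ln_div)
    qed
    ultimately show ?thesis by (simp add: tendsto_cong)
  qed
  ultimately show ?thesis using that[of g X] X by (auto simp: g_def)
qed

text \<open>The uniform convergence theorem for slowly varying functions. The interval \<open>{1..3/2}\<close> is
extended by chaining ratios.\<close>

lemma slowly_varying_uniform:
  assumes L: "slowly_varying L" and e: "e > 0"
  shows "\<exists>X. \<forall>x\<ge>X. \<forall>k\<in>{1..K}. \<bar>ln (L (k * x)) - ln (L x)\<bar> < e"
proof -
  obtain g X0 where g: "g \<in> borel_measurable lebesgue" and pos: "\<And>x. x \<ge> X0 \<Longrightarrow> L x > 0"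
    and gL: "\<And>x. x \<ge> X0 \<Longrightarrow> g x = ln (L x)"
    and lim: "\<And>k. k > 0 \<Longrightarrow> ((\<lambda>x. g (k * x) - g x) \<longlongrightarrow> 0) at_top"
    using slowly_varying_log[OF L] by blast
  have *: "\<forall>e>0. \<exists>X. \<forall>x\<ge>X. \<forall>k\<in>{1..(3/2)^Suc N}. \<bar>g (k * x) - g x\<bar> < e" for N :: nat
  proof (induction N)
    case 0
    then show ?case using uniform_convergence_of_differences[OF g lim] by simp
  next
    case (Suc N)
    show ?case
    proof (intro allI impI)
      fix e :: real assume e: "e > 0"
      obtain X1 where X1: "\<And>x k. x \<ge> X1 \<Longrightarrow> k \<in> {1..(3/2)^Suc N} \<Longrightarrow> \<bar>g (k * x) - g x\<bar> < e/2"
        using Suc e by (meson half_gt_zero)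
      obtain X2 where X2: "\<And>x k. x \<ge> X2 \<Longrightarrow> k \<in> {1..3/2} \<Longrightarrow> \<bar>g (k * x) - g x\<bar> < e/2"
        using uniform_convergence_of_differences[OF g lim, of "e/2"] e by fastforce
      have "\<bar>g (k * x) - g x\<bar> < e" if x: "x \<ge> max 0 (max X1 X2)" and k: "k \<in> {1..(3/2)^Suc (Suc N)}" for x k
      proof (cases "k \<le> 3/2")
        case True then show ?thesis using X2[of x k] x k e by auto
      next
        case False
        have "3/2 * x \<ge> X1" using x by auto
        moreover have "k / (3/2) \<in> {1..(3/2)^Suc N}" using False k by auto
        ultimately have "\<bar>g (k / (3/2) * (3/2 * x)) - g (3/2 * x)\<bar> < e/2" by (rule X1)
        then have a: "\<bar>g (k * x) - g (3/2 * x)\<bar> < e/2" by simp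
        have "\<bar>g (3/2 * x) - g x\<bar> < e/2" using X2[of x "3/2"] x by auto
        with a show ?thesis unfolding abs_less_iff by argo
      qed
      then show "\<exists>X. \<forall>x\<ge>X. \<forall>k\<in>{1..(3/2)^Suc (Suc N)}. \<bar>g (k * x) - g x\<bar> < e" by blast
    qed
  qed
  obtain N where N: "K < (3/2)^N" using real_arch_pow[of "3/2" K] by auto
  have "(3/2::real)^N \<le> (3/2)^Suc N" by simp
  with N have N: "K \<le> (3/2)^Suc N" by linarith
  obtain X where X: "\<And>x k. x \<ge> X \<Longrightarrow> k \<in> {1..(3/2)^Suc N} \<Longrightarrow> \<bar>g (k * x) - g x\<bar> < e"
    using *[of N] e by blast
  have "\<bar>ln (L (k * x)) - ln (L x)\<bar> < e" if "x \<ge> max 0 (max X X0)" "k \<in> {1..K}" for x k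
  proof -
    have "k * x \<ge> x" using that mult_right_mono[of 1 k x] by auto
    then show ?thesis using X[of x k] gL[of x] gL[of "k * x"] that N by auto
  qed
  then show ?thesis by blast
qed

lemma slowly_varying_pos:
  assumes "slowly_varying L" shows "\<forall>\<^sub>F x in at_top. L x > 0"
  using assms unfolding slowly_varying_def eventually_at_top_linorder by blast

lemma slowly_varying_ratio:
  assumes L: "slowly_varying L" and K: "K > 0" and a: "filterlim a at_top F"
    and b: "\<forall>\<^sub>F x in F. a x / K \<le> b x \<and> b x \<le> K * a x"
  shows "((\<lambda>x. L (b x) / L (a x)) \<longlongrightarrow> 1) F"
proof -
  have "((\<lambda>x. ln (L (b x)) - ln (L (a x))) \<longlongrightarrow> 0) F"
  proof (rule tendstoI)
    fix e :: real assume e: "e > 0"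
    obtain X where X: "\<And>x k. x \<ge> X \<Longrightarrow> k \<in> {1..K} \<Longrightarrow> \<bar>ln (L (k * x)) - ln (L x)\<bar> < e"
      using slowly_varying_uniform[OF L e, of K] by blast
    have "\<forall>\<^sub>F x in F. a x \<ge> max 1 (max X (K * X))"
      using a unfolding filterlim_at_top by blast
    with b show "\<forall>\<^sub>F x in F. dist (ln (L (b x)) - ln (L (a x))) 0 < e"
    proof eventually_elim
      case (elim x)
      then have ax: "a x > 0" "a x \<ge> X" "a x \<ge> K * X" by auto
      have "a x / K \<ge> X" "a x / K > 0" using ax K by (auto simp: field_simps)
      then have bx: "b x \<ge> X" "b x > 0" using elim by auto
      show ?case
      proof (cases "b x \<ge> a x")
        case True
        then show ?thesis using X[of "a x" "b x / a x"] ax elim by (auto simp: dist_real_def field_simps)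
      next
        case False
        then show ?thesis using X[of "b x" "a x / b x"] bx elim K
          by (auto simp: dist_real_def abs_minus_commute field_simps)
      qed
    qed
  qed
  then have "((\<lambda>x. exp (ln (L (b x)) - ln (L (a x)))) \<longlongrightarrow> exp 0) F" by (rule tendsto_exp)
  moreover have "filterlim b at_top F"
    by (rule filterlim_at_top_mono[OF filterlim_tendsto_pos_mult_at_top[OF tendsto_const _ a, of "1 / K"]])
       (use K b in \<open>auto elim: eventually_mono\<close>)
  from eventually_compose_filterlim[OF slowly_varying_pos[OF L] this]
    eventually_compose_filterlim[OF slowly_varying_pos[OF L] a]
  have "\<forall>\<^sub>F x in F. exp (ln (L (b x)) - ln (L (a x))) = L (b x) / L (a x)"
    by eventually_elim (simp add: exp_diff)
  ultimately show ?thesis by (simp add: tendsto_cong)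
qed

lemma slowly_varying_asymp:
  assumes L: "slowly_varying L" and c: "c > 0" and r: "((\<lambda>x. b x / a x) \<longlongrightarrow> c) F"
    and a: "filterlim a at_top F"
  shows "((\<lambda>x. L (b x) / L (a x)) \<longlongrightarrow> 1) F"
proof (rule slowly_varying_ratio[OF L _ a, of "max (2 * c) (2 / c)"])
  have "\<forall>\<^sub>F x in F. b x / a x < 2 * c" "\<forall>\<^sub>F x in F. b x / a x > c / 2"
    using order_tendstoD(2)[OF r, of "2 * c"] order_tendstoD(1)[OF r, of "c / 2"] c by simp_all
  moreover have "\<forall>\<^sub>F x in F. a x \<ge> 1" using a unfolding filterlim_at_top by blast
  ultimately show "\<forall>\<^sub>F x in F. a x / max (2 * c) (2 / c) \<le> b x \<and> b x \<le> max (2 * c) (2 / c) * a x"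
  proof eventually_elim
    case (elim x)
    have "a x / max (2 * c) (2 / c) \<le> a x / (2 / c)" using elim c by (intro divide_left_mono) auto
    also have "\<dots> \<le> b x" using elim c by (simp add: field_simps)
    finally have "a x / max (2 * c) (2 / c) \<le> b x" .
    moreover have "b x \<le> 2 * c * a x" using elim by (simp add: field_simps)
    then have "b x \<le> max (2 * c) (2 / c) * a x"
      by (rule order_trans) (use elim in \<open>auto intro: mult_right_mono\<close>)
    ultimately show ?case by simp
  qed
qed (use c in auto)

lemma regularly_varying_ratio:
  assumes L: "slowly_varying L" and c: "c > 0" and r: "((\<lambda>x. b x / a x) \<longlongrightarrow> c) F"
    and a: "filterlim a at_top F"
  shows "((\<lambda>x. (b x powr \<rho> * L (b x)) / (a x powr \<rho> * L (a x))) \<longlongrightarrow> c powr \<rho>) F"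
proof -
  have "((\<lambda>x. (b x / a x) powr \<rho> * (L (b x) / L (a x))) \<longlongrightarrow> c powr \<rho> * 1) F"
    using c by (intro tendsto_intros r slowly_varying_asymp[OF L c r a]) auto
  moreover have "\<forall>\<^sub>F x in F. a x > 0" using a unfolding filterlim_at_top_dense by blast
  with order_tendstoD(1)[OF r c] have "\<forall>\<^sub>F x in F. (b x / a x) powr \<rho> * (L (b x) / L (a x))
      = (b x powr \<rho> * L (b x)) / (a x powr \<rho> * L (a x))"
    by eventually_elim (simp add: zero_less_divide_iff powr_divide)
  ultimately show ?thesis using Lim_transform_eventually by force
qed

text \<open>Potter's bounds: with the uniform convergence theorem on \<open>{1..2}\<close>, each doubling of the
argument changes \<open>L\<close> at most by the factor \<open>2 powr d\<close>.\<close>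

lemma slowly_varying_potter:
  assumes L: "slowly_varying L" and d: "d > 0"
  obtains X where "X > 0" "\<And>x. x \<ge> X \<Longrightarrow> L x > 0"
    "\<And>x y. X \<le> x \<Longrightarrow> x \<le> y \<Longrightarrow> L y \<le> 2 * (y / x) powr d * L x"
    "\<And>x y. X \<le> x \<Longrightarrow> x \<le> y \<Longrightarrow> L x \<le> 2 * (y / x) powr d * L y"
proof -
  \<comment> \<open>An oscillation below \<open>ln 2\<close> pays for the constant \<open>2\<close>, one below \<open>d * ln 2\<close> for each doubling.\<close>
  define e where "e = min (ln 2) (d * ln 2)"
  have e: "e > 0" using d by (simp add: e_def)
  obtain X1 where X1: "\<And>x k. x \<ge> X1 \<Longrightarrow> k \<in> {1..2} \<Longrightarrow> \<bar>ln (L (k * x)) - ln (L x)\<bar> < e"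
    using slowly_varying_uniform[OF L e, of 2] by blast
  obtain X2 where X2: "\<And>x. x \<ge> X2 \<Longrightarrow> L x > 0"
    using slowly_varying_pos[OF L] by (auto simp: eventually_at_top_linorder)
  define X where "X = max 1 (max X1 X2)"
  have *: "\<bar>ln (L y) - ln (L x)\<bar> \<le> ln 2 + d * ln (y / x)"
    if "X \<le> x" "x \<le> y" "y \<le> 2^Suc n * x" for x y n
    using that
  proof (induction n arbitrary: x)
    case 0
    then have "\<bar>ln (L (y / x * x)) - ln (L x)\<bar> < e"
      by (intro X1) (auto simp: X_def field_simps)
    moreover have "d * ln (y / x) \<ge> 0" using 0 d by (auto simp: X_def)
    ultimately show ?case using 0 by (auto simp: e_def X_def)
  next
    case (Suc n)
    have x: "x > 0" using Suc by (auto simp: X_def)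
    show ?case
    proof (cases "y \<le> 2 * x")
      case True
      then have "\<bar>ln (L (y / x * x)) - ln (L x)\<bar> < e"
        using Suc x by (intro X1) (auto simp: X_def field_simps)
      moreover have "d * ln (y / x) \<ge> 0" using Suc d x by auto
      ultimately show ?thesis using x by (auto simp: e_def X_def)
    next
      case False
      have "\<bar>ln (L y) - ln (L (2 * x))\<bar> \<le> ln 2 + d * ln (y / (2 * x))"
        by (rule Suc.IH) (use Suc.prems False x in auto)
      moreover have "ln (y / (2 * x)) = ln (y / x) - ln 2"
        using x Suc by (simp add: ln_div ln_mult)
      then have "d * ln (y / (2 * x)) = d * ln (y / x) - d * ln 2"
        by (simp add: right_diff_distrib)
      moreover have "\<bar>ln (L (2 * x)) - ln (L x)\<bar> < e"
        by (intro X1) (use Suc in \<open>auto simp: X_def\<close>)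
      moreover have "e \<le> d * ln 2" by (simp add: e_def)
      ultimately show ?thesis unfolding abs_le_iff abs_less_iff by linarith
    qed
  qed
  have **: "\<bar>ln (L y) - ln (L x)\<bar> \<le> ln 2 + d * ln (y / x)" if "X \<le> x" "x \<le> y" for x y
  proof -
    obtain n where n: "y / x < 2^n" using real_arch_pow[of 2 "y/x"] by auto
    have "(2::real)^n \<le> 2^Suc n" by simp
    with n have "y / x \<le> 2^Suc n" by linarith
    then have "y \<le> 2^Suc n * x" using that by (simp add: X_def field_simps)
    then show ?thesis using *[OF that] by blast
  qed
  have pos: "L x > 0" if "x \<ge> X" for x using that X2 by (auto simp: X_def)
  have E: "exp (ln 2 + d * ln (y / x)) = 2 * (y / x) powr d" if "X \<le> x" "x \<le> y" for x y
    using that by (auto simp: exp_add powr_def X_def)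
  show ?thesis
  proof (rule that[of X])
    show "X > 0" by (simp add: X_def)
    show "L x > 0" if "x \<ge> X" for x using pos[OF that] .
    fix x y assume xy: "X \<le> x" "x \<le> y"
    then have p: "L x > 0" "L y > 0" using pos by auto
    have "ln (L y) \<le> (ln 2 + d * ln (y / x)) + ln (L x)" "ln (L x) \<le> (ln 2 + d * ln (y / x)) + ln (L y)"
      using **[OF xy] by (auto simp: abs_le_iff)
    then have "exp (ln (L y)) \<le> exp (ln 2 + d * ln (y / x)) * exp (ln (L x))"
      "exp (ln (L x)) \<le> exp (ln 2 + d * ln (y / x)) * exp (ln (L y))"
      by (simp_all only: exp_add[symmetric] exp_le_cancel_iff)
    then show "L y \<le> 2 * (y / x) powr d * L x" "L x \<le> 2 * (y / x) powr d * L y"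
      using p E[OF xy] by simp_all
  qed
qed

lemma slowly_varying_bigo:
  assumes L: "slowly_varying L" and d: "d > 0"
  shows "L \<in> O(\<lambda>x. x powr d)" "(\<lambda>x. x powr -d) \<in> O(L)"
proof -
  obtain X where X: "X > 0" "\<And>x. x \<ge> X \<Longrightarrow> L x > 0"
    "\<And>x y. X \<le> x \<Longrightarrow> x \<le> y \<Longrightarrow> L y \<le> 2 * (y / x) powr d * L x"
    "\<And>x y. X \<le> x \<Longrightarrow> x \<le> y \<Longrightarrow> L x \<le> 2 * (y / x) powr d * L y"
    using slowly_varying_potter[OF L d] by blast
  have "norm (L y) \<le> (2 * X powr -d * L X) * norm (y powr d)" if "y \<ge> X" for y
    using X(1) X(2)[of y] X(3)[of X y] that by (simp add: powr_divide powr_minus field_simps)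
  then show "L \<in> O(\<lambda>x. x powr d)"
    by (intro bigoI[of _ "2 * X powr -d * L X"] eventually_at_top_linorderI[of X])
  have "norm (y powr -d) \<le> (2 * X powr -d / L X) * norm (L y)" if "y \<ge> X" for y
  proof -
    have "y > 0" using that X by simp
    then show ?thesis using X(1) X(2)[of y] X(2)[of X] X(4)[of X y] that
      by (simp add: powr_divide powr_minus field_simps)
  qed
  then show "(\<lambda>x. x powr -d) \<in> O(L)"
    by (intro bigoI[of _ "2 * X powr -d / L X"] eventually_at_top_linorderI[of X])
qed

text \<open>Potter's bound with exponent \<open>\<rho> / 2\<close> leaves a negative power.\<close>

lemma slowly_varying_power_inverse_tendsto:
  assumes L: "slowly_varying L" and r: "\<rho> > 0"
  shows "((\<lambda>x. 1 / (x powr \<rho> * L x)) \<longlongrightarrow> 0) at_top"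
proof -
  obtain C where C: "C > 0" "\<forall>\<^sub>F x in at_top. norm (x powr - (\<rho> / 2)) \<le> C * norm (L x)"
    using slowly_varying_bigo(2)[OF L, of "\<rho> / 2"] r by (auto elim: landau_o.bigE)
  show ?thesis
  proof (rule Lim_null_comparison)
    have "((\<lambda>x. C * x powr - (\<rho> / 2)) \<longlongrightarrow> C * 0) at_top"
      using r by (intro tendsto_intros tendsto_neg_powr filterlim_ident) auto
    then show "((\<lambda>x. C * x powr - (\<rho> / 2)) \<longlongrightarrow> 0) at_top" by simp
    show "\<forall>\<^sub>F x in at_top. norm (1 / (x powr \<rho> * L x)) \<le> C * x powr - (\<rho> / 2)"
      using C(2) slowly_varying_pos[OF L] eventually_gt_at_top[of 0]
    proof eventually_elim
      case (elim x)
      have "C * x powr - (\<rho> / 2) * (x powr \<rho> * L x) = (x powr - (\<rho> / 2) * x powr \<rho>) * (C * L x)"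
        by (simp only: mult_ac)
      also have "x powr - (\<rho> / 2) * x powr \<rho> = x powr (\<rho> / 2)" by (simp add: powr_add[symmetric])
      finally have "C * x powr - (\<rho> / 2) * (x powr \<rho> * L x) = x powr (\<rho> / 2) * (C * L x)" .
      moreover have "x powr (\<rho> / 2) * (C * L x) \<ge> x powr (\<rho> / 2) * x powr - (\<rho> / 2)"
        using elim by (intro mult_left_mono) auto
      moreover have "x powr (\<rho> / 2) * x powr - (\<rho> / 2) = 1"
        using elim by (simp add: powr_add[symmetric])
      ultimately have "1 \<le> C * x powr - (\<rho> / 2) * (x powr \<rho> * L x)" by metis
      then show ?case using elim by (simp add: pos_divide_le_eq)
    qed
  qed
qed

lemma powr_absolutely_integrable:
  assumes "s < - 1" "X > 0"
  shows "(\<lambda>x::real. x powr s) absolutely_integrable_on {X..}"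
  using has_integral_powr_to_inf[OF assms]
  by (intro nonnegative_absolutely_integrable_1) (auto intro: has_integral_integrable)

text \<open>The exponent \<open>-1\<close>, which corresponds to \<open>\<alpha> = p\<close>, is where the integral condition on \<open>L\<close> is
needed.\<close>

lemma slowly_varying_weighted_integrable:
  assumes L: "slowly_varying L" and s: "s < -1 \<or> (s = -1 \<and> log_integral_converges L)"
  obtains X where "X > 0" "\<And>x. x \<ge> X \<Longrightarrow> L x > 0" "(\<lambda>x. x powr s * L x) absolutely_integrable_on {X..}"
proof -
  obtain X0 where X0: "\<And>x. x \<ge> X0 \<Longrightarrow> L x > 0" and meas: "L \<in> borel_measurable (lebesgue_on {X0..})"
    using L unfolding slowly_varying_def by blast
  have m: "(\<lambda>x. x powr s * L x) \<in> borel_measurable (lebesgue_on {X..})" if "X \<ge> X0" for X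
  proof -
    have "L \<in> borel_measurable (lebesgue_on {X..})"
      by (rule measurable_restrict_mono[OF meas]) (use that in auto)
    moreover have "(\<lambda>x. x powr s) \<in> borel_measurable (lebesgue_on {X..})"
      by (rule measurable_restrict_space1, rule measurable_completion) measurable
    ultimately show ?thesis by (rule borel_measurable_times[rotated])
  qed
  from s show ?thesis
  proof
    assume s: "s < -1"
    define d where "d = (- 1 - s) / 2"
    have d: "d > 0" "s + d < - 1" using s by (auto simp: d_def field_simps)
    obtain C where C: "C > 0" "\<forall>\<^sub>F x in at_top. norm (L x) \<le> C * norm (x powr d)"
      using slowly_varying_bigo(1)[OF L d(1)] by (rule landau_o.bigE)
    then obtain X1 where X1: "\<And>x. x \<ge> X1 \<Longrightarrow> \<bar>L x\<bar> \<le> C * x powr d"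
      by (auto simp: eventually_at_top_linorder)
    define X where "X = max 1 (max X0 X1)"
    have "(\<lambda>x. x powr s * L x) absolutely_integrable_on {X..}"
    proof (rule measurable_bounded_by_integrable_imp_absolutely_integrable)
      show "(\<lambda>x. C * x powr (s + d)) integrable_on {X..}"
        using powr_absolutely_integrable[OF d(2), of X]
        by (intro integrable_on_mult_right set_lebesgue_integral_eq_integral(1)) (auto simp: X_def)
      fix x assume "x \<in> {X..}"
      then have "x powr s * \<bar>L x\<bar> \<le> x powr s * (C * x powr d)"
        using X1[of x] by (intro mult_left_mono) (auto simp: X_def)
      then show "norm (x powr s * L x) \<le> C * x powr (s + d)"
        by (simp add: abs_mult powr_add mult_ac)
    qed (use m in \<open>auto simp: X_def\<close>)
    then show ?thesis using that[of X] X0 by (auto simp: X_def)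
  next
    assume s: "s = -1 \<and> log_integral_converges L"
    then obtain X1 where X1: "\<And>X. X \<ge> X1 \<Longrightarrow> (\<integral>\<^sup>+ t\<in>{X..}. ennreal (L t / t) \<partial>lebesgue) < \<infinity>"
      by (auto simp: log_integral_converges_def eventually_at_top_linorder)
    define X where "X = max 1 (max X0 X1)"
    have "integrable (lebesgue_on {X..}) (\<lambda>x. x powr s * L x)"
    proof (rule integrableI_bounded)
      show "(\<lambda>x. x powr s * L x) \<in> borel_measurable (lebesgue_on {X..})" by (rule m) (simp add: X_def)
      have "(\<integral>\<^sup>+ x. ennreal (norm (x powr s * L x)) \<partial>lebesgue_on {X..})
        = (\<integral>\<^sup>+ x\<in>{X..}. ennreal (norm (x powr s * L x)) \<partial>lebesgue)"
        by (rule nn_integral_restrict_space) simp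
      also have "\<dots> = (\<integral>\<^sup>+ x\<in>{X..}. ennreal (L x / x) \<partial>lebesgue)"
      proof (rule nn_integral_cong)
        fix x :: real
        have "norm (x powr s * L x) = L x / x" if "x \<ge> X"
          using that X0[of x] s by (auto simp: X_def powr_minus_divide abs_mult)
        then show "ennreal (norm (x powr s * L x)) * indicator {X..} x = ennreal (L x / x) * indicator {X..} x"
          by (auto simp: indicator_def)
      qed
      also have "\<dots> < \<infinity>" by (rule X1) (simp add: X_def)
      finally show "(\<integral>\<^sup>+ x. ennreal (norm (x powr s * L x)) \<partial>lebesgue_on {X..}) < \<infinity>" .
    qed
    then have "(\<lambda>x. x powr s * L x) absolutely_integrable_on {X..}"
      by (simp add: integrable_restrict_space set_integrable_def)
    then show ?thesis using that[of X] X0 by (auto simp: X_def)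
  qed
qed

section \<open>Monotone densities and the de Haan class\<close>

text \<open>Since \<open>h\<close> is monotone, a difference of \<open>G\<close> over \<open>[x, k x]\<close> bounds \<open>h\<close> from above at \<open>x\<close>
and from below at \<open>k x\<close>, up to factors that tend to \<open>1\<close> as \<open>k\<close> decreases to \<open>1\<close>. Stating the
hypothesis through differences covers regularly varying \<open>G\<close> (with \<open>q k = C * (k powr \<rho> - 1)\<close>)
and the de Haan class (with \<open>q k = c * ln k\<close>) at once.\<close>

lemma monotone_density:
  fixes G h \<phi> :: "real \<Rightarrow> real"
  assumes pos: "\<forall>\<^sub>F x in at_top. \<phi> x > 0"
    and G: "\<And>x. x > 0 \<Longrightarrow> (G has_real_derivative h x / x\<^sup>2) (at x)"
    and h: "\<And>x y. 0 < x \<Longrightarrow> x \<le> y \<Longrightarrow> h x \<le> h y" "\<And>x. x > 0 \<Longrightarrow> h x \<ge> 0"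
    and q: "\<And>k. k > 1 \<Longrightarrow> ((\<lambda>x. (G (k * x) - G x) / \<phi> x) \<longlongrightarrow> q k) at_top"
    and \<phi>: "\<And>k. k > 1 \<Longrightarrow> ((\<lambda>x. \<phi> (k * x) / \<phi> x) \<longlongrightarrow> k powr \<rho>) at_top"
    and d: "((\<lambda>k. q k / (k - 1)) \<longlongrightarrow> d) (at_right 1)"
  shows "((\<lambda>x. h x / (x * \<phi> x)) \<longlongrightarrow> d) at_top"
proof (rule order_tendstoI)
  have mvt: "(k - 1) * x * (h x / (k * x)\<^sup>2) \<le> G (k * x) - G x \<and>
      G (k * x) - G x \<le> (k - 1) * x * (h (k * x) / x\<^sup>2)" if "k > 1" "x > 0" for k x
  proof -
    have kx: "x < k * x" using that by simp
    have "\<exists>z>x. z < k * x \<and> G (k * x) - G x = (k * x - x) * (h z / z\<^sup>2)"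
      by (rule MVT2[OF kx]) (use G that in auto)
    then obtain z where z: "x < z" "z < k * x" "G (k * x) - G x = (k * x - x) * (h z / z\<^sup>2)"
      by blast
    have a: "h x / (k * x)\<^sup>2 \<le> h z / z\<^sup>2"
      using z that h by (intro frac_le power_mono) auto
    have b: "h z / z\<^sup>2 \<le> h (k * x) / x\<^sup>2"
      using z that h by (intro frac_le power_mono) auto
    have "0 \<le> (k - 1) * x" using that by simp
    moreover have "k * x - x = (k - 1) * x" by (simp add: left_diff_distrib)
    ultimately show ?thesis
      unfolding z(3) using mult_left_mono[OF a] mult_left_mono[OF b] by metis
  qed
  fix a
  {
    assume a: "d < a"
    have "((\<lambda>k. q k / (k - 1) * k\<^sup>2) \<longlongrightarrow> d * 1\<^sup>2) (at_right 1)"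
      by (intro tendsto_intros d)
    then have "\<forall>\<^sub>F k in at_right 1. q k / (k - 1) * k\<^sup>2 < a"
      using a by (intro order_tendstoD) auto
    moreover have "\<forall>\<^sub>F k in at_right (1::real). k > 1"
      by (simp add: eventually_at_filter)
    ultimately have "\<forall>\<^sub>F k in at_right 1. q k / (k - 1) * k\<^sup>2 < a \<and> k > 1"
      by (rule eventually_conj)
    then obtain k where k: "q k / (k - 1) * k\<^sup>2 < a" "k > 1"
      using eventually_happens'[OF trivial_limit_at_right_real] by blast
    have "((\<lambda>x. (G (k * x) - G x) / \<phi> x / (k - 1) * k\<^sup>2) \<longlongrightarrow> q k / (k - 1) * k\<^sup>2) at_top"
      using k by (intro tendsto_intros q) auto
    then have "\<forall>\<^sub>F x in at_top. (G (k * x) - G x) / \<phi> x / (k - 1) * k\<^sup>2 < a"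
      by (rule order_tendstoD) (use k in simp)
    then show "\<forall>\<^sub>F x in at_top. h x / (x * \<phi> x) < a"
      using pos eventually_gt_at_top[of 0]
    proof eventually_elim
      case (elim x)
      have "(k - 1) * (h x / (x * \<phi> x)) = ((k - 1) * x * (h x / (k * x)\<^sup>2)) * (k\<^sup>2 / \<phi> x)"
        using elim k by (simp add: power2_eq_square field_simps)
      also have "\<dots> \<le> (G (k * x) - G x) * (k\<^sup>2 / \<phi> x)"
        using mvt[OF k(2), of x] elim by (intro mult_right_mono) auto
      finally have *: "(k - 1) * (h x / (x * \<phi> x)) \<le> (G (k * x) - G x) * (k\<^sup>2 / \<phi> x)" .
      have "h x / (x * \<phi> x) \<le> (G (k * x) - G x) * (k\<^sup>2 / \<phi> x) / (k - 1)"
        by (rule mult_imp_le_div_pos[rotated], subst mult.commute, rule *) (use k in simp)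
      also have "\<dots> = (G (k * x) - G x) / \<phi> x / (k - 1) * k\<^sup>2" by simp
      finally show ?case using elim by simp
    qed
  }
  {
    assume a: "a < d"
    have "((\<lambda>k. q k / (k - 1) / (k powr \<rho> * k)) \<longlongrightarrow> d / (1 powr \<rho> * 1)) (at_right 1)"
      by (intro tendsto_intros d) auto
    then have "\<forall>\<^sub>F k in at_right 1. q k / (k - 1) / (k powr \<rho> * k) > a"
      using a by (intro order_tendstoD) auto
    moreover have "\<forall>\<^sub>F k in at_right (1::real). k > 1"
      by (simp add: eventually_at_filter)
    ultimately have "\<forall>\<^sub>F k in at_right 1. q k / (k - 1) / (k powr \<rho> * k) > a \<and> k > 1"
      by (rule eventually_conj)
    then obtain k where k: "q k / (k - 1) / (k powr \<rho> * k) > a" "k > 1"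
      using eventually_happens'[OF trivial_limit_at_right_real] by blast
    have "((\<lambda>x. (G (k * x) - G x) / \<phi> x / (k - 1) / (\<phi> (k * x) / \<phi> x * k)) \<longlongrightarrow> q k / (k - 1) / (k powr \<rho> * k)) at_top"
      using k by (intro tendsto_intros q \<phi>) auto
    then have ev: "\<forall>\<^sub>F x in at_top. (G (k * x) - G x) / \<phi> x / (k - 1) / (\<phi> (k * x) / \<phi> x * k) > a"
      by (rule order_tendstoD) (use k in simp)
    have lim: "filterlim (\<lambda>x. x / k) at_top at_top" "filterlim (\<lambda>x. k * x) at_top at_top"
      using k by real_asymp+
    have "\<forall>\<^sub>F x in at_top. a < h (k * x) / (k * x * \<phi> (k * x))"
      using ev pos eventually_compose_filterlim[OF pos lim(2)] eventually_gt_at_top[of 0]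
    proof eventually_elim
      case (elim x)
      have "(G (k * x) - G x) / \<phi> x / (k - 1) / (\<phi> (k * x) / \<phi> x * k) = (G (k * x) - G x) / ((k - 1) * k * \<phi> (k * x))"
        using elim k by (simp add: field_simps)
      also have "\<dots> \<le> ((k - 1) * x * (h (k * x) / x\<^sup>2)) / ((k - 1) * k * \<phi> (k * x))"
        using mvt[OF k(2), of x] elim k by (intro divide_right_mono) auto
      also have "\<dots> = h (k * x) / (k * x * \<phi> (k * x))"
        using elim k by (simp add: power2_eq_square field_simps)
      finally show ?case using elim by simp
    qed
    from eventually_compose_filterlim[OF this lim(1)]
    show "\<forall>\<^sub>F x in at_top. a < h x / (x * \<phi> x)" using k by simp
  }
qed

lemma derivative_imp_de_Haan:
  fixes G h L :: "real \<Rightarrow> real"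
  assumes L: "slowly_varying L"
    and G: "\<And>x. x > 0 \<Longrightarrow> (G has_real_derivative h x / x\<^sup>2) (at x)"
    and h: "((\<lambda>x. h x / (x * L x)) \<longlongrightarrow> c) at_top"
  shows "G \<in> de_Haan_class L c"
proof -
  have gt: "((\<lambda>x. (G (k * x) - G x) / L x) \<longlongrightarrow> c * ln k) at_top" if k: "k > 1" for k
  proof -
    have "\<exists>z. x < z \<and> z < k * x \<and>
        G (k * x) - G x - c * L x * ln k = (k - 1) * x * (h z / z\<^sup>2 - c * L x / z)" if x: "x > 0" for x
    proof -
      have kx: "x < k * x" using k x by simp
      \<comment> \<open>The comparison function \<open>c * L x * ln z\<close> has \<open>L\<close> frozen at the left end point.\<close>
      have "\<exists>z>x. z < k * x \<and> (G (k * x) - c * L x * ln (k * x)) - (G x - c * L x * ln x)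
          = (k * x - x) * (h z / z\<^sup>2 - c * L x / z)"
      proof (rule MVT2[OF kx])
        fix z assume "x \<le> z" "z \<le> k * x"
        then have z: "z > 0" using x by simp
        show "((\<lambda>z. G z - c * L x * ln z) has_real_derivative h z / z\<^sup>2 - c * L x / z) (at z)"
          by (rule derivative_eq_intros G[OF z] z refl)+ simp
      qed
      then show ?thesis using k x by (auto simp: ln_mult algebra_simps)
    qed
    then obtain z where z: "\<And>x. x > 0 \<Longrightarrow> x < z x" "\<And>x. x > 0 \<Longrightarrow> z x < k * x"
      "\<And>x. x > 0 \<Longrightarrow> G (k * x) - G x - c * L x * ln k = (k - 1) * x * (h (z x) / (z x)\<^sup>2 - c * L x / z x)"
      by metis
    have zt: "filterlim z at_top at_top"
      by (rule filterlim_at_top_mono[OF filterlim_ident])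
         (use z in \<open>auto intro!: eventually_mono[OF eventually_gt_at_top[of 0]] less_imp_le\<close>)
    have "\<forall>\<^sub>F x in at_top. x / k \<le> z x \<and> z x \<le> k * x"
      using eventually_gt_at_top[of 0]
    proof eventually_elim
      case (elim x)
      have "x / k \<le> x / 1" using k elim by (intro divide_left_mono) auto
      then show ?case using z(1,2)[OF elim] by simp
    qed
    then have Lz: "((\<lambda>x. L (z x) / L x) \<longlongrightarrow> 1) at_top"
      by (rule slowly_varying_ratio[OF L _ filterlim_ident, rotated]) (use k in simp)
    have "((\<lambda>x. h (z x) / (z x * L (z x)) * (L (z x) / L x) - c) \<longlongrightarrow> c * 1 - c) at_top"
      by (intro tendsto_intros Lz filterlim_compose[OF h zt])
    then have A: "((\<lambda>x. h (z x) / (z x * L (z x)) * (L (z x) / L x) - c) \<longlongrightarrow> 0) at_top" by simp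
    have "((\<lambda>x. (G (k * x) - G x) / L x - c * ln k) \<longlongrightarrow> 0) at_top"
    proof (rule Lim_null_comparison)
      show "((\<lambda>x. (k - 1) * \<bar>h (z x) / (z x * L (z x)) * (L (z x) / L x) - c\<bar>) \<longlongrightarrow> 0) at_top"
        using tendsto_mult_right_zero[OF tendsto_rabs_zero[OF A], of "k - 1"] .
      have "\<forall>\<^sub>F x in at_top. L (z x) > 0"
        using slowly_varying_pos[OF L] zt by (rule eventually_compose_filterlim)
      then show "\<forall>\<^sub>F x in at_top. norm ((G (k * x) - G x) / L x - c * ln k)
          \<le> (k - 1) * \<bar>h (z x) / (z x * L (z x)) * (L (z x) / L x) - c\<bar>"
        using slowly_varying_pos[OF L] eventually_gt_at_top[of 0]
      proof eventually_elim
        case (elim x)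
        define D where "D = h (z x) / (z x * L (z x)) * (L (z x) / L x) - c"
        have zx: "z x > 0" "x < z x" using z(1)[of x] elim by auto
        have "(G (k * x) - G x) / L x - c * ln k = (G (k * x) - G x - c * L x * ln k) / L x"
          using elim by (simp add: field_simps)
        also have "\<dots> = (k - 1) * (x / z x) * D"
          unfolding z(3)[OF elim(3)] using elim zx
          by (simp add: D_def field_simps power2_eq_square)
        also have "\<bar>\<dots>\<bar> = (k - 1) * \<bar>D\<bar> * (x / z x)"
          using k zx elim by (simp add: abs_mult)
        also have "\<dots> \<le> (k - 1) * \<bar>D\<bar> * 1"
          using k zx elim by (intro mult_left_mono) auto
        finally show ?case by (simp add: D_def)
      qed
    qed
    then show ?thesis by (simp add: LIM_zero_iff)
  qed
  have "((\<lambda>x. (G (k * x) - G x) / L x) \<longlongrightarrow> c * ln k) at_top" if k: "k > 0" for k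
  proof (cases k "1::real" rule: linorder_cases)
    case less
    have lim: "filterlim (\<lambda>x. k * x) at_top at_top" using k by real_asymp
    have "((\<lambda>x. (G (1 / k * (k * x)) - G (k * x)) / L (k * x)) \<longlongrightarrow> c * ln (1 / k)) at_top"
      by (rule filterlim_compose[OF gt lim]) (use less k in simp)
    moreover have "((\<lambda>x. L (k * x) / L x) \<longlongrightarrow> 1) at_top"
      using L k unfolding slowly_varying_def by blast
    ultimately have "((\<lambda>x. - ((G (1 / k * (k * x)) - G (k * x)) / L (k * x) * (L (k * x) / L x))) \<longlongrightarrow> - (c * ln (1 / k) * 1)) at_top"
      by (intro tendsto_intros)
    moreover have "\<forall>\<^sub>F x in at_top. - ((G (1 / k * (k * x)) - G (k * x)) / L (k * x) * (L (k * x) / L x)) = (G (k * x) - G x) / L x"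
      using eventually_compose_filterlim[OF slowly_varying_pos[OF L] lim] slowly_varying_pos[OF L]
      by eventually_elim (use k in \<open>simp add: divide_simps\<close>)
    ultimately show ?thesis using k by (simp add: tendsto_cong ln_div)
  qed (use gt in simp_all)
  then show ?thesis by (simp add: de_Haan_class_def)
qed

text \<open>For monotone \<open>G\<close> the defining limit of the de Haan class is locally uniform: the ratio
\<open>b x / a x\<close> may be squeezed between constants on either side of its limit.\<close>

lemma de_Haan_asymp:
  assumes mono: "\<And>x y. x0 \<le> x \<Longrightarrow> x \<le> y \<Longrightarrow> G x \<le> G y"
    and G: "G \<in> de_Haan_class L c" and L: "slowly_varying L"
    and l: "l > 0" and r: "((\<lambda>x. b x / a x) \<longlongrightarrow> l) F" and a: "filterlim a at_top F"
  shows "((\<lambda>x. (G (b x) - G (a x)) / L (a x)) \<longlongrightarrow> c * ln l) F"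
proof -
  have lim: "((\<lambda>x. (G (k * a x) - G (a x)) / L (a x)) \<longlongrightarrow> c * ln k) F" if "k > 0" for k
    by (rule filterlim_compose[OF _ a]) (use G that in \<open>auto simp: de_Haan_class_def\<close>)
  have pos: "\<forall>\<^sub>F x in F. L (a x) > 0"
    using slowly_varying_pos[OF L] a by (rule eventually_compose_filterlim)
  have cont: "((\<lambda>k. c * ln k) \<longlongrightarrow> c * ln l) (at l within S)" for S
    using l by (intro tendsto_intros) auto
  have big: "\<forall>\<^sub>F x in F. a x \<ge> M" for M
    using a unfolding filterlim_at_top by blast
  show ?thesis
  proof (rule order_tendstoI)
    fix y assume "y < c * ln l"
    then have "\<forall>\<^sub>F k in at_left l. y < c * ln k" by (rule order_tendstoD[OF cont])
    moreover have "\<forall>\<^sub>F k in at_left l. k < l \<and> 0 < k"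
    proof (rule eventually_conj)
      show "\<forall>\<^sub>F k in at_left l. k < l" by (simp add: eventually_at_filter)
      show "\<forall>\<^sub>F k in at_left l. 0 < k" by (rule order_tendstoD(1)[OF tendsto_ident_at l])
    qed
    ultimately have "\<forall>\<^sub>F k in at_left l. y < c * ln k \<and> k < l \<and> 0 < k" by (rule eventually_conj)
    then obtain k where k: "y < c * ln k" "k < l" "0 < k"
      using eventually_happens'[OF trivial_limit_at_left_real] by blast
    have "\<forall>\<^sub>F x in F. y < (G (k * a x) - G (a x)) / L (a x)"
      by (rule order_tendstoD(1)[OF lim[OF k(3)] k(1)])
    moreover have "\<forall>\<^sub>F x in F. k < b x / a x" by (rule order_tendstoD(1)[OF r k(2)])
    ultimately show "\<forall>\<^sub>F x in F. y < (G (b x) - G (a x)) / L (a x)"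
      using pos big[of 1] big[of "x0 / k"]
    proof eventually_elim
      case (elim x)
      have "k * a x \<ge> x0" "k * a x \<le> b x" using elim k by (auto simp: field_simps)
      then have "G (k * a x) \<le> G (b x)" by (rule mono)
      then have "(G (k * a x) - G (a x)) / L (a x) \<le> (G (b x) - G (a x)) / L (a x)"
        using elim by (intro divide_right_mono) auto
      then show ?case using elim by linarith
    qed
  next
    fix y assume "c * ln l < y"
    then have "\<forall>\<^sub>F k in at_right l. c * ln k < y" by (rule order_tendstoD[OF cont])
    moreover have "\<forall>\<^sub>F k in at_right l. l < k"
      by (auto simp: eventually_at_filter)
    ultimately have "\<forall>\<^sub>F k in at_right l. c * ln k < y \<and> l < k" by (rule eventually_conj)
    then obtain k where k: "c * ln k < y" "l < k"
      using eventually_happens'[OF trivial_limit_at_right_real] by blast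
    have k0: "k > 0" using k l by simp
    have "\<forall>\<^sub>F x in F. (G (k * a x) - G (a x)) / L (a x) < y"
      by (rule order_tendstoD(2)[OF lim[OF k0] k(1)])
    moreover have "\<forall>\<^sub>F x in F. b x / a x < k" by (rule order_tendstoD(2)[OF r k(2)])
    moreover have "\<forall>\<^sub>F x in F. l / 2 < b x / a x" by (rule order_tendstoD(1)[OF r]) (use l in simp)
    ultimately show "\<forall>\<^sub>F x in F. (G (b x) - G (a x)) / L (a x) < y"
      using pos big[of 1] big[of "x0 / (l / 2)"]
    proof eventually_elim
      case (elim x)
      have "l / 2 * a x \<ge> x0" "l / 2 * a x \<le> b x" "b x \<le> k * a x" using elim l by (auto simp: field_simps)
      then have "G (b x) \<le> G (k * a x)" by (intro mono) auto
      then have "(G (b x) - G (a x)) / L (a x) \<le> (G (k * a x) - G (a x)) / L (a x)"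
        using elim by (intro divide_right_mono) auto
      then show ?case using elim by linarith
    qed
  qed
qed

lemma de_Haan_compose:
  assumes mono: "\<And>x y. x0 \<le> x \<Longrightarrow> x \<le> y \<Longrightarrow> G x \<le> G y"
    and G: "G \<in> de_Haan_class L c" and L: "slowly_varying L"
    and m: "m > 0" and Y: "((\<lambda>x. Y x / x) \<longlongrightarrow> m) at_top"
  shows "(\<lambda>x. G (Y x)) \<in> de_Haan_class L c"
  unfolding de_Haan_class_def
proof (intro CollectI allI impI)
  fix k :: real assume k: "k > 0"
  have kt: "filterlim (\<lambda>x. k * x) at_top at_top" using k by real_asymp
  have Yt: "filterlim Y at_top at_top"
  proof -
    have "filterlim (\<lambda>x. Y x / x * x) at_top at_top"
      by (rule filterlim_tendsto_pos_mult_at_top[OF Y m filterlim_ident])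
    moreover have "\<forall>\<^sub>F x in at_top. Y x / x * x = Y x"
      using eventually_gt_at_top[of 0] by eventually_elim simp
    ultimately show ?thesis by (simp add: filterlim_cong)
  qed
  have "((\<lambda>x. Y (k * x) / (k * x) / (Y x / x) * k) \<longlongrightarrow> m / m * k) at_top"
    using m by (intro tendsto_intros Y filterlim_compose[OF Y kt]) auto
  moreover have "\<forall>\<^sub>F x in at_top. Y (k * x) / (k * x) / (Y x / x) * k = Y (k * x) / Y x"
    using eventually_gt_at_top[of 0] by eventually_elim (use k in simp)
  ultimately have "((\<lambda>x. Y (k * x) / Y x) \<longlongrightarrow> m / m * k) at_top"
    by (rule Lim_transform_eventually)
  then have r: "((\<lambda>x. Y (k * x) / Y x) \<longlongrightarrow> k) at_top" using m by simp
  have LL: "((\<lambda>x. L (Y x) / L x) \<longlongrightarrow> 1) at_top"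
    by (rule slowly_varying_asymp[OF L m Y filterlim_ident])
  have "((\<lambda>x. (G (Y (k * x)) - G (Y x)) / L (Y x) * (L (Y x) / L x)) \<longlongrightarrow> c * ln k * 1) at_top"
    by (intro tendsto_mult LL de_Haan_asymp[OF mono G L k r Yt])
  moreover have "\<forall>\<^sub>F x in at_top. (G (Y (k * x)) - G (Y x)) / L (Y x) * (L (Y x) / L x) = (G (Y (k * x)) - G (Y x)) / L x"
    using eventually_compose_filterlim[OF slowly_varying_pos[OF L] Yt] by eventually_elim simp
  ultimately have "((\<lambda>x. (G (Y (k * x)) - G (Y x)) / L x) \<longlongrightarrow> c * ln k * 1) at_top"
    by (rule Lim_transform_eventually)
  then show "((\<lambda>x. (G (Y (k * x)) - G (Y x)) / L x) \<longlongrightarrow> c * ln k) at_top"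
    by simp
qed

lemma de_Haan_cong:
  assumes "\<forall>\<^sub>F x in at_top. f x = g x" "f \<in> de_Haan_class L c"
  shows "g \<in> de_Haan_class L c"
  unfolding de_Haan_class_def
proof (intro CollectI allI impI)
  fix k :: real assume k: "k > 0"
  have kt: "filterlim (\<lambda>x. k * x) at_top at_top" using k by real_asymp
  have "((\<lambda>x. (f (k * x) - f x) / L x) \<longlongrightarrow> c * ln k) at_top"
    using assms(2) k by (simp add: de_Haan_class_def)
  moreover have "\<forall>\<^sub>F x in at_top. (f (k * x) - f x) / L x = (g (k * x) - g x) / L x"
    using assms(1) eventually_compose_filterlim[OF assms(1) kt] by eventually_elim simp
  ultimately show "((\<lambda>x. (g (k * x) - g x) / L x) \<longlongrightarrow> c * ln k) at_top"
    by (rule Lim_transform_eventually)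
qed

lemma de_Haan_affine:
  assumes f: "f \<in> de_Haan_class L c" and L: "slowly_varying L"
    and D: "((\<lambda>x. D x / L x) \<longlongrightarrow> 0) at_top"
  shows "(\<lambda>x. s * f x + d + D x) \<in> de_Haan_class L (s * c)"
  unfolding de_Haan_class_def
proof (intro CollectI allI impI)
  fix k :: real assume k: "k > 0"
  have kt: "filterlim (\<lambda>x. k * x) at_top at_top" using k by real_asymp
  have f': "((\<lambda>x. (f (k * x) - f x) / L x) \<longlongrightarrow> c * ln k) at_top"
    using f k by (simp add: de_Haan_class_def)
  have L': "((\<lambda>x. L (k * x) / L x) \<longlongrightarrow> 1) at_top"
    using L k unfolding slowly_varying_def by blast
  have "((\<lambda>x. s * ((f (k * x) - f x) / L x) + D (k * x) / L (k * x) * (L (k * x) / L x) - D x / L x)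
      \<longlongrightarrow> s * (c * ln k) + 0 * 1 - 0) at_top"
    by (intro tendsto_intros f' L' D filterlim_compose[OF D kt])
  moreover have "\<forall>\<^sub>F x in at_top. s * ((f (k * x) - f x) / L x) + D (k * x) / L (k * x) * (L (k * x) / L x) - D x / L x
      = ((s * f (k * x) + d + D (k * x)) - (s * f x + d + D x)) / L x"
    using slowly_varying_pos[OF L] eventually_compose_filterlim[OF slowly_varying_pos[OF L] kt]
    by eventually_elim (simp add: divide_simps algebra_simps)
  ultimately show "((\<lambda>x. ((s * f (k * x) + d + D (k * x)) - (s * f x + d + D x)) / L x) \<longlongrightarrow> s * c * ln k) at_top"
    by (simp add: tendsto_cong mult.assoc)
qed

text \<open>Summing the increments of \<open>f\<close> over successive doublings of the argument yields a geometric
series.\<close>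

lemma de_Haan_growth:
  assumes f: "f \<in> de_Haan_class L c" and L: "slowly_varying L"
    and b: "\<And>X. X \<ge> X0 \<Longrightarrow> bounded (f ` {X..2*X})" and e: "e > 0"
  shows "f \<in> O(\<lambda>x. x powr e)"
proof -
  have "((\<lambda>x. (f (2 * x) - f x) / L x) \<longlongrightarrow> c * ln 2) at_top"
    using f unfolding de_Haan_class_def by simp
  then have "(\<lambda>x. f (2 * x) - f x) \<in> O(L)"
    by (rule bigoI_tendsto) (use slowly_varying_pos[OF L] in \<open>auto elim: eventually_mono\<close>)
  also have "L \<in> O(\<lambda>x. x powr e)" by (rule slowly_varying_bigo[OF L e])
  finally obtain K where K: "K > 0" "\<forall>\<^sub>F x in at_top. norm (f (2 * x) - f x) \<le> K * norm (x powr e)"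
    by (rule landau_o.bigE)
  then obtain X1 where X1: "\<And>x. x \<ge> X1 \<Longrightarrow> \<bar>f (2 * x) - f x\<bar> \<le> K * x powr e"
    by (auto simp: eventually_at_top_linorder)
  define X where "X = max 1 (max X0 X1)"
  have "bounded (f ` {X..2*X})" by (rule b) (simp add: X_def)
  then obtain B0 where B0: "\<And>x. x \<in> {X..2*X} \<Longrightarrow> \<bar>f x\<bar> \<le> B0"
    unfolding bounded_iff by (metis imageI real_norm_def)
  have e2: "2 powr e > 1" using e by simp
  \<comment> \<open>The second bound makes \<open>(B + K) * (x / 2) powr e \<le> B * x powr e\<close>, which closes the induction.\<close>
  define B where "B = max (max 0 B0) (K / (2 powr e - 1))"
  have KB: "K \<le> B * (2 powr e - 1)"
  proof -
    have "K / (2 powr e - 1) \<le> B" by (simp add: B_def)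
    then show ?thesis using e2 by (simp add: pos_divide_le_eq)
  qed
  have main: "\<bar>f x\<bar> \<le> B * x powr e" if "X \<le> x" "x \<le> 2 ^ Suc n * X" for x n
    using that
  proof (induction n arbitrary: x)
    case 0
    then have "\<bar>f x\<bar> \<le> B * 1" using B0[of x] by (auto simp: B_def)
    also have "\<dots> \<le> B * x powr e"
      using 0 e by (intro mult_left_mono) (auto simp: B_def X_def ge_one_powr_ge_zero)
    finally show ?case .
  next
    case (Suc n)
    show ?case
    proof (cases "x \<le> 2 * X")
      case True
      then have "\<bar>f x\<bar> \<le> B * 1" using B0[of x] Suc by (auto simp: B_def)
      also have "\<dots> \<le> B * x powr e"
        using Suc e by (intro mult_left_mono) (auto simp: B_def X_def ge_one_powr_ge_zero)
      finally show ?thesis .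
    next
      case False
      then have x2: "X \<le> x / 2" "x / 2 \<le> 2 ^ Suc n * X" "x > 0" using Suc by (auto simp: X_def)
      have "\<bar>f (2 * (x / 2)) - f (x / 2)\<bar> \<le> K * (x / 2) powr e"
        by (rule X1) (use x2 in \<open>auto simp: X_def\<close>)
      moreover have "\<bar>f (x / 2)\<bar> \<le> B * (x / 2) powr e" by (rule Suc.IH) (use x2 in auto)
      moreover have "K * (x / 2) powr e \<le> B * (2 powr e - 1) * (x / 2) powr e"
        by (intro mult_right_mono KB) simp
      moreover have "B * (2 powr e - 1) * (x / 2) powr e + B * (x / 2) powr e = B * x powr e"
        using x2 by (simp add: powr_divide field_simps)
      ultimately show ?thesis by auto
    qed
  qed
  have "norm (f x) \<le> B * norm (x powr e)" if "x \<ge> X" for x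
  proof -
    obtain n where n: "x / X < 2 ^ n" using real_arch_pow[of 2 "x / X"] by auto
    have "(2::real) ^ n \<le> 2 ^ Suc n" by simp
    with n have "x / X \<le> 2 ^ Suc n" by linarith
    then have "x \<le> 2 ^ Suc n * X" by (simp add: X_def field_simps)
    then show ?thesis using main[OF that] by simp
  qed
  then show ?thesis by (intro bigoI[of _ B] eventually_at_top_linorderI[of X])
qed

section \<open>Growth of functions and of their derivatives\<close>

lemma asymp_equiv_iff_ratio:
  assumes "\<forall>\<^sub>F x in F. g x \<noteq> 0"
  shows "f \<sim>[F] g \<longleftrightarrow> ((\<lambda>x. f x / g x) \<longlongrightarrow> (1::real)) F"
  unfolding asymp_equiv_def
  by (rule tendsto_cong) (use assms in \<open>auto elim: eventually_mono\<close>)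

text \<open>Both \<open>F x - 2 C x powr -(1/2)\<close> and \<open>- F x - 2 C x powr -(1/2)\<close> increase near infinity, so they stay
below their limits \<open>l\<close> and \<open>- l\<close>.\<close>

lemma tail_of_derivative:
  fixes F F' :: "real \<Rightarrow> real"
  assumes F: "\<And>x. x > 0 \<Longrightarrow> (F has_real_derivative F' x) (at x)"
    and F': "F' \<in> O(\<lambda>x. x powr - (3/2))" and l: "(F \<longlongrightarrow> l) at_top"
  shows "(\<lambda>x. F x - l) \<in> O(\<lambda>x. x powr - (1/2))"
proof -
  obtain C where C: "C > 0" "\<forall>\<^sub>F x in at_top. norm (F' x) \<le> C * norm (x powr - (3/2))"
    using F' by (rule landau_o.bigE)
  then obtain X0 where X0: "\<And>x. x \<ge> X0 \<Longrightarrow> \<bar>F' x\<bar> \<le> C * x powr - (3/2)"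
    by (auto simp: eventually_at_top_linorder)
  have one: "s * (F x - l) \<le> 2 * C * x powr - (1/2)" if s: "\<bar>s\<bar> = 1" and x: "x \<ge> max 1 X0" for s x
  proof -
    define H where "H x = s * F x - 2 * C * x powr - (1/2)" for x
    have "H x \<le> H y" if y: "y \<ge> x" for y
    proof (rule DERIV_nonneg_imp_nondecreasing[OF y])
      fix z assume z: "x \<le> z" "z \<le> y"
      then have z0: "z > 0" using x by simp
      have "(H has_real_derivative s * F' z + C * z powr - (3/2)) (at z)"
        unfolding H_def
        by (rule derivative_eq_intros F[OF z0] has_real_derivative_powr[OF z0] refl)+ simp
      moreover have "\<bar>s * F' z\<bar> \<le> C * z powr - (3/2)" using X0[of z] z x s by (simp add: abs_mult)
      ultimately show "\<exists>d. (H has_real_derivative d) (at z) \<and> 0 \<le> d"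
        by (intro exI[of _ "s * F' z + C * z powr - (3/2)"]) auto
    qed
    then have "\<forall>\<^sub>F y in at_top. H x \<le> H y" by (auto intro: eventually_at_top_linorderI)
    moreover have "(H \<longlongrightarrow> s * l - 2 * C * 0) at_top"
      unfolding H_def by (intro tendsto_intros l tendsto_neg_powr filterlim_ident) auto
    ultimately have "H x \<le> s * l - 2 * C * 0"
      by (intro tendsto_lowerbound[of H _ at_top]) auto
    then show ?thesis by (simp add: H_def algebra_simps)
  qed
  have "norm (F x - l) \<le> 2 * C * norm (x powr - (1/2))" if "x \<ge> max 1 X0" for x
    using one[of 1 x] one[of "-1" x] that by (auto simp: abs_le_iff)
  then show ?thesis by (intro bigoI[of _ "2 * C"] eventually_at_top_linorderI[of "max 1 X0"])
qed

lemma bigo_powr_mono: "a \<le> b \<Longrightarrow> (\<lambda>x::real. x powr a) \<in> O(\<lambda>x. x powr b)"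
  by (intro bigoI[of _ 1] eventually_mono[OF eventually_ge_at_top[of 1]]) (simp add: powr_mono)

lemma tendsto_imp_bigo_powr:
  fixes f :: "real \<Rightarrow> real"
  assumes "(f \<longlongrightarrow> l) at_top" "e \<ge> 0"
  shows "f \<in> O(\<lambda>x. x powr e)"
proof -
  have "\<forall>\<^sub>F x in at_top. \<bar>f x\<bar> < \<bar>l\<bar> + 1"
    by (rule order_tendstoD(2)[OF tendsto_rabs[OF assms(1)]]) simp
  then have "\<forall>\<^sub>F x in at_top. norm (f x) \<le> (\<bar>l\<bar> + 1) * norm (x powr e)"
    using eventually_ge_at_top[of 1]
  proof eventually_elim
    case (elim x)
    have "(\<bar>l\<bar> + 1) * 1 \<le> (\<bar>l\<bar> + 1) * x powr e"
      using elim assms(2) by (intro mult_left_mono) (auto simp: ge_one_powr_ge_zero)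
    then show ?case using elim by simp
  qed
  then show ?thesis by (rule bigoI)
qed

lemma bigo_powr_mult:
  fixes f g :: "real \<Rightarrow> real"
  assumes "f \<in> O(\<lambda>x. x powr a)" "g \<in> O(\<lambda>x. x powr b)"
  shows "(\<lambda>x. f x * g x) \<in> O(\<lambda>x. x powr (a + b))"
  using landau_o.big.mult[OF assms] by (simp add: powr_add)

text \<open>If \<open>F' x = f x / x\<^sup>2\<close> near infinity, as happens for functions of \<open>-1/x\<close>, this condition makes \<open>F\<close>
bounded. The majorant is what the hypotheses on \<open>L\<close> provide.\<close>

definition inv_square_dominated :: "(real \<Rightarrow> real) \<Rightarrow> bool"
  where "inv_square_dominated f \<longleftrightarrow> (\<exists>\<kappa> X. \<kappa> absolutely_integrable_on {X..} \<and>
    (\<forall>\<^sub>F x in at_top. \<bar>f x\<bar> / x\<^sup>2 \<le> \<kappa> x))"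

lemma inv_square_dominated_primitive:
  assumes F: "\<And>x. x \<ge> x0 \<Longrightarrow> (F has_real_derivative f x / x\<^sup>2) (at x)" and f: "inv_square_dominated f"
  shows "\<exists>B. \<forall>\<^sub>F x in at_top. \<bar>F x\<bar> \<le> B"
proof -
  obtain \<kappa> X X1 where X: "\<kappa> absolutely_integrable_on {X..}" "\<And>x. x \<ge> X1 \<Longrightarrow> \<bar>f x\<bar> / x\<^sup>2 \<le> \<kappa> x"
    using f by (auto simp: inv_square_dominated_def eventually_at_top_linorder)
  define Z where "Z = max x0 (max X X1)"
  have le: "\<bar>f x / x\<^sup>2\<bar> \<le> \<kappa> x" if "x \<ge> Z" for x using X(2)[of x] that by (simp add: Z_def)
  have \<kappa>0: "0 \<le> \<kappa> x" if "x \<ge> Z" for x using le[OF that] by (rule order_trans[rotated]) simp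
  have k: "\<kappa> integrable_on {Z..}"
    by (rule set_lebesgue_integral_eq_integral(1), rule set_integrable_subset[OF X(1)]) (auto simp: Z_def)
  have "\<bar>F x\<bar> \<le> \<bar>F Z\<bar> + integral {Z..} \<kappa>" if x: "x \<ge> Z" for x
  proof -
    have h: "((\<lambda>x. f x / x\<^sup>2) has_integral F x - F Z) {Z..x}"
      by (rule fundamental_theorem_of_calculus[OF x])
         (use F in \<open>auto simp: Z_def has_real_derivative_iff_has_vector_derivative[symmetric] intro: has_field_derivative_at_within\<close>)
    have k': "\<kappa> integrable_on {Z..x}" by (rule integrable_on_subinterval[OF k]) auto
    have "norm (integral {Z..x} (\<lambda>x. f x / x\<^sup>2)) \<le> integral {Z..x} \<kappa>"
      by (rule integral_norm_bound_integral) (use h k' le in auto)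
    also have "\<dots> \<le> integral {Z..} \<kappa>"
      by (rule integral_subset_le[OF _ k' k]) (use \<kappa>0 in auto)
    finally show ?thesis using integral_unique[OF h] by auto
  qed
  then show ?thesis by (auto simp: eventually_at_top_linorder)
qed

lemma inv_square_dominated_bigo:
  assumes "f \<in> O(\<lambda>x. x powr (1/2))" shows "inv_square_dominated f"
proof -
  obtain C where C: "\<forall>\<^sub>F x in at_top. norm (f x) \<le> C * norm (x powr (1/2))"
    using assms by (auto elim: landau_o.bigE)
  have "(\<lambda>x::real. C * x powr - (3/2)) absolutely_integrable_on {1..}"
    using powr_absolutely_integrable[of "- (3/2)" 1] by (rule set_integrable_mult_right[rotated]) auto
  moreover have "\<forall>\<^sub>F x in at_top. \<bar>f x\<bar> / x\<^sup>2 \<le> C * x powr - (3/2)"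
    using C eventually_gt_at_top[of 0]
  proof eventually_elim
    case (elim x)
    have "\<bar>f x\<bar> / x\<^sup>2 \<le> C * x powr (1/2) / x\<^sup>2"
      using elim by (intro divide_right_mono) auto
    also have "\<dots> = C * (x powr (1/2) / x powr 2)" using elim by (simp add: powr_numeral)
    also have "x powr (1/2) / x powr 2 = x powr - (3/2)" by (simp add: powr_diff[symmetric])
    finally show ?case .
  qed
  ultimately show ?thesis unfolding inv_square_dominated_def by blast
qed

lemma inv_square_dominated_regular:
  assumes L: "slowly_varying L" and \<rho>: "\<rho> < 1 \<or> (\<rho> = 1 \<and> log_integral_converges L)"
    and f: "((\<lambda>x. f x / (x powr \<rho> * L x)) \<longlongrightarrow> K) at_top"
  shows "inv_square_dominated f"
proof -
  have "\<rho> - 2 < -1 \<or> (\<rho> - 2 = -1 \<and> log_integral_converges L)" using \<rho> by auto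
  then obtain X where "(\<lambda>x. x powr (\<rho> - 2) * L x) absolutely_integrable_on {X..}"
    using slowly_varying_weighted_integrable[OF L, of "\<rho> - 2"] by metis
  then have "(\<lambda>x. (\<bar>K\<bar> + 1) * (x powr (\<rho> - 2) * L x)) absolutely_integrable_on {X..}"
    by (rule set_integrable_mult_right)
  moreover have "\<forall>\<^sub>F x in at_top. \<bar>f x / (x powr \<rho> * L x)\<bar> < \<bar>K\<bar> + 1"
    by (rule order_tendstoD(2)[OF tendsto_rabs[OF f]]) simp
  then have "\<forall>\<^sub>F x in at_top. \<bar>f x\<bar> / x\<^sup>2 \<le> (\<bar>K\<bar> + 1) * (x powr (\<rho> - 2) * L x)"
    using slowly_varying_pos[OF L] eventually_gt_at_top[of 0]
  proof eventually_elim
    case (elim x)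
    have "\<bar>f x\<bar> \<le> (\<bar>K\<bar> + 1) * (x powr \<rho> * L x)"
      using elim by (simp add: abs_mult pos_divide_less_eq)
    then have "\<bar>f x\<bar> / x\<^sup>2 \<le> (\<bar>K\<bar> + 1) * (x powr \<rho> * L x) / x\<^sup>2"
      by (rule divide_right_mono) simp
    then show ?case using elim by (simp add: powr_diff powr_numeral)
  qed
  ultimately show ?thesis unfolding inv_square_dominated_def by blast
qed

section \<open>Polynomial approximation and Beta integrals\<close>

text \<open>The limit constant of the Tauberian theorem: the integral of \<open>(u / (1 + u))\<^sup>k\<close> against the
measure \<open>\<alpha> u powr (- \<alpha> - 1) du\<close> on the half-line, whose tail at \<open>x\<close> is \<open>x powr - \<alpha>\<close>.\<close>

definition beta_const :: "real \<Rightarrow> nat \<Rightarrow> real"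
  where "beta_const \<alpha> k = \<alpha> * Beta (real k - \<alpha>) \<alpha>"

text \<open>A continuous ramp from \<open>u\<close> to \<open>v\<close> separates the two step functions, and it can be
approximated uniformly. The weight \<open>1 / s ^ n\<close> compensates the factor \<open>s ^ n\<close> that the known
moments carry.\<close>

lemma polynomial_between_steps:
  fixes u v e :: real
  assumes uv: "0 < u" "u < v" and e: "e > 0"
  shows "\<exists>P. real_polynomial_function P \<and> (\<forall>s\<in>{0..1}. (if v < s then 1 / s ^ n else 0) \<le> P s \<and>
    P s \<le> (if u < s then 1 / s ^ n else 0) + e)"
proof -
  define g where "g s = 1 / (max s u) ^ n * min 1 (max 0 ((s - u) / (v - u)))" for s
  have "continuous_on {0..1} g"
    unfolding g_def using uv by (auto intro!: continuous_intros)
  then obtain P where P: "polynomial_function P" "\<And>s. s \<in> {0..1} \<Longrightarrow> norm (g s - P s) < e / 2"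
    using Stone_Weierstrass_polynomial_function[of "{0..1}" g "e / 2"] e by auto
  have poly: "real_polynomial_function (\<lambda>s. P s + e / 2)"
    using P(1) unfolding real_polynomial_function_eq[symmetric]
    by (intro real_polynomial_function.intros(2,3))
  have R: "(if v < s then 1 / s ^ n else 0) \<le> g s \<and> g s \<le> (if u < s then 1 / s ^ n else 0)" if "s \<in> {0..1}" for s
  proof -
    have "(s - u) / (v - u) \<ge> 1" if "s > v" using that uv by (simp add: field_simps)
    moreover have "(s - u) / (v - u) \<le> 0" if "s \<le> u" using that uv by (simp add: divide_nonpos_pos)
    moreover have "1 / s ^ n * min 1 (max 0 ((s - u) / (v - u))) \<le> 1 / s ^ n * 1" "0 \<le> 1 / s ^ n * min 1 (max 0 ((s - u) / (v - u)))"
      if "s > u" using that uv by (intro mult_left_mono mult_nonneg_nonneg; simp)+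
    ultimately show ?thesis using uv by (auto simp: g_def max_def min_def)
  qed
  have "(if v < s then 1 / s ^ n else 0) \<le> P s + e / 2 \<and>
      P s + e / 2 \<le> (if u < s then 1 / s ^ n else 0) + e" if s: "s \<in> {0..1}" for s
  proof -
    have "g s - e / 2 \<le> P s" "P s \<le> g s + e / 2"
      using P(2)[OF s] unfolding real_norm_def abs_less_iff by linarith+
    then show ?thesis using conjunct1[OF R[OF s]] conjunct2[OF R[OF s]] by linarith
  qed
  with poly show ?thesis by blast
qed

text \<open>Up to the compensating factor, the integrand is the density of the image of
\<open>\<alpha> t powr (- \<alpha> - 1) dt\<close> under \<open>s = t / (1 + t)\<close>; its mass beyond \<open>u\<close> is the tail at \<open>u / (1 - u)\<close>.\<close>

lemma tail_density_integral:
  assumes \<alpha>: "\<alpha> > 0" and u: "0 < u" "u < 1"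
  shows "((\<lambda>s. (if u < s then 1 / s ^ n else 0) * (\<alpha> * (s powr (real n - \<alpha> - 1) * (1 - s) powr (\<alpha> - 1))))
    has_integral ((1 - u) / u) powr \<alpha>) {0..1}"
proof -
  have "((\<lambda>s. \<alpha> * (s powr (- \<alpha> - 1) * (1 - s) powr (\<alpha> - 1))) has_integral (- (((1 - 1) / 1) powr \<alpha>) - - (((1 - u) / u) powr \<alpha>))) {u..1}"
  \<comment> \<open>The primitive is \<open>- ((1 - s) / s) powr \<alpha>\<close>; at \<open>s = 1\<close> it is continuous but possibly not differentiable.\<close>
  proof (rule fundamental_theorem_of_calculus_interior)
    show "continuous_on {u..1} (\<lambda>s. - (((1 - s) / s) powr \<alpha>))"
      using u \<alpha> by (intro continuous_intros continuous_on_powr') auto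
    fix s assume s: "s \<in> {u<..<1}"
    then have s0: "s > 0" "1 - s > 0" using u by auto
    have "((\<lambda>s. - (((1 - s) / s) powr \<alpha>)) has_real_derivative \<alpha> * (s powr (- \<alpha> - 1) * (1 - s) powr (\<alpha> - 1))) (at s)"
    proof -
      have q: "(1 - s) / s > 0" using s0 by simp
      have "((\<lambda>s. (1 - s) / s) has_real_derivative - (1 / s\<^sup>2)) (at s)"
        by (rule derivative_eq_intros refl | use s0 in \<open>simp add: power2_eq_square field_simps\<close>)+
      from DERIV_minus[OF DERIV_chain2[OF has_real_derivative_powr[OF q, of \<alpha>] this]]
      have "((\<lambda>s. - (((1 - s) / s) powr \<alpha>)) has_real_derivative \<alpha> * ((1 - s) / s) powr (\<alpha> - 1) * (1 / s\<^sup>2)) (at s)"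
        by simp
      moreover have "((1 - s) / s) powr (\<alpha> - 1) * (1 / s\<^sup>2) = s powr (- \<alpha> - 1) * (1 - s) powr (\<alpha> - 1)"
      proof -
        have "s powr (- \<alpha> - 1) = s powr - (\<alpha> - 1) * s powr - 2"
        proof -
          have "- \<alpha> - 1 = - (\<alpha> - 1) + - 2" by simp
          then show ?thesis by (simp only: powr_add)
        qed
        also have "s powr - 2 = 1 / s\<^sup>2"
          using s0 by (simp add: powr_minus_divide powr_numeral)
        finally have "s powr (- \<alpha> - 1) = s powr - (\<alpha> - 1) * (1 / s\<^sup>2)" .
        moreover have "((1 - s) / s) powr (\<alpha> - 1) = (1 - s) powr (\<alpha> - 1) * s powr - (\<alpha> - 1)"
          using s0 powr_divide[of "1 - s" s "\<alpha> - 1"] unfolding powr_minus_divide by simp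
        ultimately show ?thesis by (simp only: mult_ac)
      qed
      ultimately show ?thesis by (simp only: mult.assoc)
    qed
    then show "((\<lambda>s. - (((1 - s) / s) powr \<alpha>)) has_vector_derivative \<alpha> * (s powr (- \<alpha> - 1) * (1 - s) powr (\<alpha> - 1))) (at s)"
      by (simp add: has_real_derivative_iff_has_vector_derivative)
  qed (use u in simp)
  then have "((\<lambda>s. \<alpha> * (s powr (- \<alpha> - 1) * (1 - s) powr (\<alpha> - 1))) has_integral ((1 - u) / u) powr \<alpha>) {u..1}"
    using \<alpha> by simp
  then have "((\<lambda>s. if s \<in> {u..1} then \<alpha> * (s powr (- \<alpha> - 1) * (1 - s) powr (\<alpha> - 1)) else 0) has_integral ((1 - u) / u) powr \<alpha>) {0..1}"
    by (subst has_integral_restrict) (use u in auto)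
  then show ?thesis
  proof (rule has_integral_spike_finite[of "{u}", rotated 2])
    fix s assume s: "s \<in> {0..1} - {u}"
    show "(if u < s then 1 / s ^ n else 0) * (\<alpha> * (s powr (real n - \<alpha> - 1) * (1 - s) powr (\<alpha> - 1)))
      = (if s \<in> {u..1} then \<alpha> * (s powr (- \<alpha> - 1) * (1 - s) powr (\<alpha> - 1)) else 0)"
    proof (cases "u < s")
      case True
      then have "s > 0" using u by simp
      then have "1 / s ^ n * s powr (real n - \<alpha> - 1) = s powr (- \<alpha> - 1)"
        by (simp add: powr_realpow[symmetric] powr_minus_divide[symmetric] powr_add[symmetric])
      moreover have "(if u < s then 1 / s ^ n else 0) * (\<alpha> * (s powr (real n - \<alpha> - 1) * (1 - s) powr (\<alpha> - 1)))
          = \<alpha> * ((1 / s ^ n * s powr (real n - \<alpha> - 1)) * (1 - s) powr (\<alpha> - 1))"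
        using True by simp
      ultimately show ?thesis using True s by simp
    qed (use s in auto)
  qed simp
qed

lemma polynomial_density_integral:
  assumes \<alpha>: "0 < \<alpha>" "\<alpha> < real n"
  shows "((\<lambda>s. (\<Sum>i\<le>d. a i * s ^ i) * (\<alpha> * (s powr (real n - \<alpha> - 1) * (1 - s) powr (\<alpha> - 1))))
    has_integral (\<Sum>i\<le>d. a i * beta_const \<alpha> (n + i))) {0..1}"
proof -
  have "((\<lambda>s. \<Sum>i\<le>d. a i * (\<alpha> * (s powr (real (n + i) - \<alpha> - 1) * (1 - s) powr (\<alpha> - 1))))
    has_integral (\<Sum>i\<le>d. a i * (\<alpha> * Beta (real (n + i) - \<alpha>) \<alpha>))) {0..1}"
    by (intro has_integral_sum has_integral_mult_right has_integral_Beta_real) (use \<alpha> in auto)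
  moreover have "(\<Sum>i\<le>d. a i * (\<alpha> * (s powr (real (n + i) - \<alpha> - 1) * (1 - s) powr (\<alpha> - 1))))
      = (\<Sum>i\<le>d. a i * s ^ i) * (\<alpha> * (s powr (real n - \<alpha> - 1) * (1 - s) powr (\<alpha> - 1)))" if "s \<in> {0..1}" for s
  proof (cases "s = 0")
    case False
    then have "s > 0" using that by simp
    then have "s powr (real (n + i) - \<alpha> - 1) = s ^ i * s powr (real n - \<alpha> - 1)" for i
      by (simp add: powr_realpow[symmetric] powr_add[symmetric] algebra_simps)
    then show ?thesis by (simp add: sum_distrib_right sum_distrib_left mult_ac)
  qed simp
  ultimately show ?thesis
    unfolding beta_const_def by (rule has_integral_eq[rotated])
qed

section \<open>The resolvent kernel\<close>

lemma kernel_nonneg: "t \<ge> 0 \<Longrightarrow> w < 0 \<Longrightarrow> 0 \<le> t / (1 - w * t :: real)"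
  by (auto intro!: divide_nonneg_nonneg simp: mult_nonpos_nonneg order_trans[OF mult_nonpos_nonneg])

lemma kernel_denominator: "t \<ge> 0 \<Longrightarrow> w < 0 \<Longrightarrow> 1 \<le> 1 - w * t" for t w :: real
  using mult_nonpos_nonneg[of w t] by simp

lemma kernel_le: "t \<ge> 0 \<Longrightarrow> w < 0 \<Longrightarrow> t / (1 - w * t) \<le> - 1 / w" for t w :: real
  using kernel_denominator[of t w] by (simp add: field_simps)

lemma kernel_le_self: "t \<ge> 0 \<Longrightarrow> w < 0 \<Longrightarrow> t / (1 - w * t) \<le> t" for t w :: real
  using kernel_denominator[of t w] by (simp add: pos_divide_le_eq mult_le_cancel_left1)

lemma kernel_tendsto: "((\<lambda>y. (t / (1 - - 1 / y * t)) ^ k) \<longlongrightarrow> t ^ k) at_top" for t :: real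
proof -
  have z: "((\<lambda>y::real. - 1 / y) \<longlongrightarrow> 0) at_top" by real_asymp
  have "((\<lambda>y. (t / (1 - - 1 / y * t)) ^ k) \<longlongrightarrow> (t / (1 - 0 * t)) ^ k) at_top"
    by (intro tendsto_intros z) simp
  then show ?thesis by simp
qed

lemma kernel_deriv:
  fixes t w :: real
  assumes "t \<ge> 0" "w < 0"
  shows "((\<lambda>w. (t / (1 - w * t)) ^ k) has_real_derivative real k * (t / (1 - w * t)) ^ Suc k) (at w within S)"
proof (cases k)
  case 0 then show ?thesis by simp
next
  case (Suc n)
  have nz: "1 - w * t \<noteq> 0" using kernel_denominator[OF assms] by simp
  show ?thesis
    by (rule derivative_eq_intros refl nz)+ (use nz in \<open>simp add: Suc power2_eq_square field_simps\<close>)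
qed

lemma kernel_le_bound:
  fixes t w b :: real
  assumes "t \<ge> 0" "w \<le> b" "b < 0"
  shows "(t / (1 - w * t)) ^ k \<le> (- 1 / b) ^ k"
proof -
  have "1 / (- w) \<le> 1 / (- b)" by (intro frac_le) (use assms in auto)
  then have "- 1 / w \<le> - 1 / b" by simp
  then have "t / (1 - w * t) \<le> - 1 / b" using kernel_le[of t w] assms by linarith
  then show ?thesis using kernel_nonneg[of t w] assms by (intro power_mono) auto
qed

lemma kernel_lipschitz:
  fixes t w w' b :: real
  assumes t: "t \<ge> 0" and b: "w \<le> b" "w' \<le> b" "b < 0"
  shows "\<bar>(t / (1 - w' * t)) ^ k - (t / (1 - w * t)) ^ k\<bar> \<le> real k * (- 1 / b) ^ Suc k * \<bar>w' - w\<bar>"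
proof -
  have "norm ((t / (1 - w' * t)) ^ k - (t / (1 - w * t)) ^ k)
      \<le> (real k * (- 1 / b) ^ Suc k) * norm (w' - w)"
  proof (rule field_differentiable_bound[of "{..b}" _ "\<lambda>w. real k * (t / (1 - w * t)) ^ Suc k"])
    fix z assume z: "z \<in> {..b}"
    then show "((\<lambda>w. (t / (1 - w * t)) ^ k) has_real_derivative real k * (t / (1 - z * t)) ^ Suc k)
        (at z within {..b})"
      using b by (intro kernel_deriv[OF t]) auto
    have "0 \<le> (t / (1 - z * t)) ^ Suc k" by (intro zero_le_power kernel_nonneg) (use t b z in auto)
    then show "norm (real k * (t / (1 - z * t)) ^ Suc k) \<le> real k * (- 1 / b) ^ Suc k"
      using kernel_le_bound[OF t, of z b "Suc k"] b z
      by (simp add: mult_left_mono abs_mult del: power_Suc)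
  qed (use b in auto)
  then show ?thesis by simp
qed

section \<open>Resolvent moments of a measure on the half-line\<close>

locale halfline_prob = prob_space \<mu> for \<mu> :: "real measure" +
  assumes sets_eq: "sets \<mu> = sets (restrict_space borel {0..})"
    and nontrivial: "\<mu> \<noteq> dirac_zero"
begin

text \<open>The kernel \<open>t / (1 - w t)\<close> is bounded for \<open>w < 0\<close>, so that all these moments are finite.\<close>

definition rmom :: "nat \<Rightarrow> real \<Rightarrow> real"
  where "rmom k w = (\<integral>t. (t / (1 - w * t)) ^ k \<partial>\<mu>)"

text \<open>The derivative of \<open>\<psi>\<close>, see \<open>psi_deriv\<close>.\<close>

definition dpsi :: "real \<Rightarrow> real"
  where "dpsi w = rmom 1 w + w * rmom 2 w"

definition mean :: real where "mean = (\<integral>t. t \<partial>\<mu>)"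

lemma space_eq: "space \<mu> = {0..}"
  using sets_eq_imp_space_eq[OF sets_eq] by (simp add: space_restrict_space)

lemma borel_measurable_halfline: "f \<in> borel_measurable borel \<Longrightarrow> f \<in> borel_measurable \<mu>"
  unfolding measurable_cong_sets[OF sets_eq refl] by (rule measurable_restrict_space1)

lemma kernel_measurable [simp]: "(\<lambda>t. (t / (1 - w * t)) ^ k) \<in> borel_measurable \<mu>"
  by (rule borel_measurable_halfline) measurable

lemma id_measurable: "(\<lambda>t. t) \<in> borel_measurable \<mu>"
  by (rule borel_measurable_halfline) measurable

lemma power_measurable [simp]: "(\<lambda>t. t ^ k) \<in> borel_measurable \<mu>"
  by (rule borel_measurable_halfline) measurable

lemma kernel_integrable: "w < 0 \<Longrightarrow> integrable \<mu> (\<lambda>t. (t / (1 - w * t)) ^ k)"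
proof (rule integrable_const_bound[of _ "(- 1 / w) ^ k"])
  assume w: "w < 0"
  show "AE t in \<mu>. norm ((t / (1 - w * t)) ^ k) \<le> (- 1 / w) ^ k"
  proof (rule AE_I2)
    fix t assume "t \<in> space \<mu>"
    then have t: "t \<ge> 0" by (simp add: space_eq)
    show "norm ((t / (1 - w * t)) ^ k) \<le> (- 1 / w) ^ k"
      using power_mono[OF kernel_le[OF t w] kernel_nonneg[OF t w], of k] kernel_nonneg[OF t w]
      by simp
  qed
qed simp

text \<open>This is where \<open>\<mu> \<noteq> \<delta>\<^sub>0\<close> is used: a vanishing integral would concentrate \<open>\<mu>\<close> at \<open>0\<close>.\<close>

lemma integral_pos_halfline:
  assumes "integrable \<mu> f" "\<And>t. t \<ge> 0 \<Longrightarrow> f t \<ge> 0" "\<And>t. t > 0 \<Longrightarrow> f t > 0"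
  shows "(\<integral>t. f t \<partial>\<mu>) > (0::real)"
proof -
  have nn: "AE t in \<mu>. 0 \<le> f t" using assms by (intro AE_I2) (simp add: space_eq)
  then have "(\<integral>t. f t \<partial>\<mu>) \<ge> 0" by (rule integral_nonneg_AE)
  moreover have "(\<integral>t. f t \<partial>\<mu>) \<noteq> 0"
  proof
    assume "(\<integral>t. f t \<partial>\<mu>) = 0"
    then have "AE t in \<mu>. f t = 0"
      using integral_nonneg_eq_0_iff_AE[OF assms(1) nn] by simp
    then have ae: "AE t in \<mu>. t = 0"
      using AE_space
    proof eventually_elim
      case (elim t)
      then show ?case using assms(3)[of t] by (force simp: space_eq)
    qed
    have "\<mu> = dirac_zero"
      unfolding dirac_zero_def
    proof (rule measure_eqI)
      show "sets \<mu> = sets (return (restrict_space borel {0..}) 0)" by (simp add: sets_eq)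
      fix A assume A: "A \<in> sets \<mu>"
      have "emeasure \<mu> A = indicator A 0"
      proof (cases "0 \<in> A")
        case True
        have "AE t in \<mu>. t \<in> A" using ae by eventually_elim (use True in simp)
        then show ?thesis using True emeasure_eq_1_AE[OF A] by simp
      next
        case False
        have "AE t in \<mu>. t \<notin> A" using ae by eventually_elim (use False in auto)
        then show ?thesis using False A AE_iff_measurable[OF A, of "\<lambda>t. t \<notin> A"]
          sets.sets_into_space[OF A] by auto
      qed
      then show "emeasure \<mu> A = emeasure (return (restrict_space borel {0..}) 0) A"
        using A by (simp add: sets_eq)
    qed
    with nontrivial show False by simp
  qed
  ultimately show ?thesis by linarith
qed

lemma rmom_pos: "w < 0 \<Longrightarrow> rmom k w > 0"
  unfolding rmom_def
proof (rule integral_pos_halfline[OF kernel_integrable])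
  assume w: "w < 0"
  show "t > 0 \<Longrightarrow> 0 < (t / (1 - w * t)) ^ k" for t
    using kernel_denominator[of t w] w by simp
qed (use kernel_nonneg in auto)

lemma rmom_deriv:
  assumes w: "w < 0"
  shows "(rmom k has_real_derivative real k * rmom (Suc k) w) (at w)"
proof -
  \<comment> \<open>Within \<open>{..<w/2}\<close> the difference quotients are uniformly bounded along every sequence.\<close>
  have "(rmom k has_real_derivative real k * rmom (Suc k) w) (at w within {..<w/2})"
    unfolding has_field_derivative_iff tendsto_at_iff_sequentially o_def
  proof (intro allI impI)
    fix X assume X: "\<forall>i. X i \<in> {..<w/2} - {w}" "X \<longlonglongrightarrow> w"
    have "(\<lambda>i. \<integral>t. ((t / (1 - X i * t)) ^ k - (t / (1 - w * t)) ^ k) / (X i - w) \<partial>\<mu>)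
        \<longlonglongrightarrow> (\<integral>t. real k * (t / (1 - w * t)) ^ Suc k \<partial>\<mu>)"
    proof (rule integral_dominated_convergence[where w="\<lambda>_. real k * (- 1 / (w/2)) ^ Suc k"])
      show "AE t in \<mu>. (\<lambda>i. ((t / (1 - X i * t)) ^ k - (t / (1 - w * t)) ^ k) / (X i - w))
          \<longlonglongrightarrow> real k * (t / (1 - w * t)) ^ Suc k"
      proof (rule AE_I2)
        fix t assume "t \<in> space \<mu>"
        then have "((\<lambda>w. (t / (1 - w * t)) ^ k) has_real_derivative real k * (t / (1 - w * t)) ^ Suc k)
            (at w within {..<w/2})"
          by (intro kernel_deriv w) (simp add: space_eq)
        then show "(\<lambda>i. ((t / (1 - X i * t)) ^ k - (t / (1 - w * t)) ^ k) / (X i - w))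
            \<longlonglongrightarrow> real k * (t / (1 - w * t)) ^ Suc k"
          unfolding has_field_derivative_iff tendsto_at_iff_sequentially o_def using X by blast
      qed
      show "AE t in \<mu>. norm (((t / (1 - X i * t)) ^ k - (t / (1 - w * t)) ^ k) / (X i - w))
          \<le> real k * (- 1 / (w/2)) ^ Suc k" for i
      proof (rule AE_I2)
        fix t assume t: "t \<in> space \<mu>"
        have Xi: "X i < w/2" "X i \<noteq> w" using X(1)[rule_format, of i] by auto
        then have "\<bar>(t / (1 - X i * t)) ^ k - (t / (1 - w * t)) ^ k\<bar> \<le> real k * (- 1 / (w/2)) ^ Suc k * \<bar>X i - w\<bar>"
          using w t by (intro kernel_lipschitz) (auto simp: space_eq)
        then show "norm (((t / (1 - X i * t)) ^ k - (t / (1 - w * t)) ^ k) / (X i - w))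
            \<le> real k * (- 1 / (w/2)) ^ Suc k"
          unfolding real_norm_def abs_divide using Xi by (subst pos_divide_le_eq) auto
      qed
      show "(\<lambda>t. ((t / (1 - X i * t)) ^ k - (t / (1 - w * t)) ^ k) / (X i - w)) \<in> borel_measurable \<mu>" for i
        by (intro borel_measurable_divide borel_measurable_diff kernel_measurable borel_measurable_const)
      show "(\<lambda>t. real k * (t / (1 - w * t)) ^ Suc k) \<in> borel_measurable \<mu>"
        by (intro borel_measurable_times kernel_measurable borel_measurable_const)
    qed simp
    moreover have "(\<integral>t. ((t / (1 - X i * t)) ^ k - (t / (1 - w * t)) ^ k) / (X i - w) \<partial>\<mu>)
        = (rmom k (X i) - rmom k w) / (X i - w)" for i
    proof -
      have "X i < 0" using X(1)[rule_format, of i] w by auto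
      then show ?thesis unfolding rmom_def using kernel_integrable w by simp
    qed
    ultimately show "(\<lambda>i. (rmom k (X i) - rmom k w) / (X i - w)) \<longlonglongrightarrow> real k * rmom (Suc k) w"
      unfolding rmom_def by (simp only: integral_mult_right_zero)
  qed
  then show ?thesis using w by (simp add: at_within_open[of w "{..<w/2}"])
qed

lemma rmom_mono:
  assumes "w \<le> w'" "w' < 0" shows "rmom k w \<le> rmom k w'"
proof (rule DERIV_nonneg_imp_nondecreasing[OF assms(1)])
  fix x assume "w \<le> x" "x \<le> w'"
  then have "x < 0" using assms by simp
  then show "\<exists>y. (rmom k has_real_derivative y) (at x) \<and> 0 \<le> y"
    using rmom_deriv[of x k] rmom_pos[of x "Suc k"] by (auto intro!: exI mult_nonneg_nonneg)
qed

text \<open>One factor \<open>- w t / (1 - w t)\<close> of the integrand is at most \<open>1\<close>. The bound trades a power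
of \<open>w\<close> for one order of the moment.\<close>

lemma rmom_Suc_le:
  assumes w: "w < 0" shows "- w * rmom (Suc k) w \<le> rmom k w"
proof -
  have "- w * rmom (Suc k) w = (\<integral>t. - w * (t / (1 - w * t)) ^ Suc k \<partial>\<mu>)"
    unfolding rmom_def by (rule integral_mult_right_zero[symmetric])
  also have "\<dots> \<le> rmom k w"
    unfolding rmom_def
  proof (rule integral_mono)
    fix t assume "t \<in> space \<mu>"
    then have t: "t \<ge> 0" by (simp add: space_eq)
    have "(- w * (t / (1 - w * t))) \<le> 1" using kernel_denominator[OF t w] by (simp add: field_simps)
    then have "(- w * (t / (1 - w * t))) * (t / (1 - w * t)) ^ k \<le> 1 * (t / (1 - w * t)) ^ k"
      using kernel_nonneg[OF t w] by (intro mult_right_mono) auto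
    then show "- w * (t / (1 - w * t)) ^ Suc k \<le> (t / (1 - w * t)) ^ k" by (simp add: mult_ac)
  qed (use w in \<open>auto simp del: power_Suc intro!: integrable_mult_right kernel_integrable\<close>)
  finally show ?thesis .
qed

text \<open>The integrand of \<open>m\<^sub>1 + w m\<^sub>2\<close> simplifies to \<open>t / (1 - w t)\<^sup>2\<close>.\<close>

lemma dpsi_pos: assumes w: "w < 0" shows "dpsi w > 0"
proof -
  have i: "integrable \<mu> (\<lambda>t. (t / (1 - w * t)) ^ 1)" "integrable \<mu> (\<lambda>t. w * (t / (1 - w * t)) ^ 2)"
    using kernel_integrable[OF w, of 1] kernel_integrable[OF w, of 2] by auto
  have "dpsi w = (\<integral>t. (t / (1 - w * t)) ^ 1 + w * (t / (1 - w * t)) ^ 2 \<partial>\<mu>)"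
    using i by (simp add: dpsi_def rmom_def)
  also have "\<dots> > 0"
  proof (rule integral_pos_halfline)
    have *: "(t / (1 - w * t)) ^ 1 + w * (t / (1 - w * t)) ^ 2 = t / (1 - w * t)^2" if "t \<ge> 0" for t
    proof -
      define D where "D = 1 - w * t"
      have D: "D > 0" "w * t = 1 - D" using kernel_denominator[OF that w] by (auto simp: D_def)
      have "(t / D) ^ 1 + w * (t / D) ^ 2 = (t * D + (w * t) * t) / D^2"
        using D(1) by (simp add: field_simps power2_eq_square)
      also have "t * D + (w * t) * t = t" unfolding D(2) by (simp add: algebra_simps)
      finally show ?thesis by (simp only: D_def)
    qed
    show "(t / (1 - w * t)) ^ 1 + w * (t / (1 - w * t)) ^ 2 \<ge> 0" if "t \<ge> 0" for t
      using *[OF that] that by simp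
    show "(t / (1 - w * t)) ^ 1 + w * (t / (1 - w * t)) ^ 2 > 0" if "t > 0" for t
      using *[of t] that kernel_denominator[of t w] w by simp
  qed (use i in auto)
  finally show ?thesis .
qed

lemma rmom_deriv_inverse:
  assumes x: "x > 0"
  shows "((\<lambda>x. rmom k (- 1 / x)) has_real_derivative real k * rmom (Suc k) (- 1 / x) / x\<^sup>2) (at x)"
proof -
  have "((\<lambda>x. - 1 / x) has_real_derivative 1 / x\<^sup>2) (at x)"
    by (rule derivative_eq_intros refl)+ (use x in \<open>auto simp: power2_eq_square field_simps\<close>)
  moreover have "(rmom k has_real_derivative real k * rmom (Suc k) (- 1 / x)) (at (- 1 / x))"
    by (rule rmom_deriv) (use x in simp)
  ultimately show ?thesis using DERIV_chain2 by fastforce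
qed

lemma rmom_inverse_mono: "0 < x \<Longrightarrow> x \<le> y \<Longrightarrow> rmom k (- 1 / x) \<le> rmom k (- 1 / y)"
  by (rule rmom_mono) (auto simp: frac_le)

lemma rmom_inverse_nonneg: "x > 0 \<Longrightarrow> rmom k (- 1 / x) \<ge> 0"
  by (rule less_imp_le, rule rmom_pos) simp

lemma power_integrable_mono:
  assumes "integrable \<mu> (\<lambda>t. t ^ k)" "i \<le> k" shows "integrable \<mu> (\<lambda>t. t ^ i)"
proof (rule Bochner_Integration.integrable_bound)
  show "integrable \<mu> (\<lambda>t. 1 + t ^ k)" using assms by simp
  show "AE t in \<mu>. norm (t ^ i) \<le> norm (1 + t ^ k)"
  proof (rule AE_I2)
    fix t assume "t \<in> space \<mu>"
    then have t: "t \<ge> 0" by (simp add: space_eq)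
    have "t ^ i \<le> 1 + t ^ k"
    proof (cases "t \<le> 1")
      case True
      then have "t ^ i \<le> 1" using t by (simp add: power_le_one)
      then show ?thesis using t by (simp add: add_increasing2)
    next
      case False
      then have "t ^ i \<le> t ^ k" using assms(2) by (intro power_increasing) auto
      then show ?thesis by simp
    qed
    then show "norm (t ^ i) \<le> norm (1 + t ^ k)" using t by simp
  qed
qed simp

lemma rmom_tendsto:
  assumes "integrable \<mu> (\<lambda>t. t ^ k)"
  shows "((\<lambda>y. rmom k (- 1 / y)) \<longlongrightarrow> (\<integral>t. t ^ k \<partial>\<mu>)) at_top"
  unfolding rmom_def
proof (rule integral_dominated_convergence_at_top[OF _ _ assms])
  show "AE t in \<mu>. ((\<lambda>y. (t / (1 - - 1 / y * t)) ^ k) \<longlongrightarrow> t ^ k) at_top"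
    by (intro AE_I2 kernel_tendsto)
  show "\<forall>\<^sub>F y in at_top. AE t in \<mu>. norm ((t / (1 - - 1 / y * t)) ^ k) \<le> t ^ k"
    using eventually_gt_at_top[of 0]
  proof eventually_elim
    case (elim y)
    show ?case
    proof (rule AE_I2)
      fix t assume "t \<in> space \<mu>"
      then have t: "t \<ge> 0" by (simp add: space_eq)
      have w: "- 1 / y < 0" using elim by simp
      show "norm ((t / (1 - - 1 / y * t)) ^ k) \<le> t ^ k"
        unfolding real_norm_def power_abs abs_of_nonneg[OF kernel_nonneg[OF t w]]
        by (rule power_mono[OF kernel_le_self[OF t w] kernel_nonneg[OF t w]])
    qed
  qed
qed (simp_all only: power_measurable kernel_measurable)

text \<open>Fatou's lemma along \<open>w = -1/n\<close>: the integrands increase to \<open>t ^ k\<close>.\<close>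

lemma rmom_bounded_imp_integrable:
  assumes "\<forall>\<^sub>F y in at_top. rmom k (- 1 / y) \<le> C"
  shows "integrable \<mu> (\<lambda>t. t ^ k)"
proof (rule integrableI_bounded)
  have lim: "(\<lambda>n. ennreal ((t / (1 - - 1 / real (Suc n) * t)) ^ k)) \<longlonglongrightarrow> ennreal (t ^ k)" for t
    by (intro tendsto_ennrealI filterlim_compose[OF kernel_tendsto]
        filterlim_compose[OF filterlim_real_sequentially filterlim_Suc])
  have "(\<integral>\<^sup>+t. ennreal (norm (t ^ k)) \<partial>\<mu>) = (\<integral>\<^sup>+t. liminf (\<lambda>n. ennreal ((t / (1 - - 1 / real (Suc n) * t)) ^ k)) \<partial>\<mu>)"
  proof (rule nn_integral_cong)
    fix t assume "t \<in> space \<mu>"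
    then show "ennreal (norm (t ^ k)) = liminf (\<lambda>n. ennreal ((t / (1 - - 1 / real (Suc n) * t)) ^ k))"
      using lim_imp_Liminf[OF sequentially_bot lim[of t]] by (simp add: space_eq)
  qed
  also have "\<dots> \<le> liminf (\<lambda>n. \<integral>\<^sup>+t. ennreal ((t / (1 - - 1 / real (Suc n) * t)) ^ k) \<partial>\<mu>)"
    by (rule nn_integral_liminf) (simp only: kernel_measurable measurable_compose[OF _ measurable_ennreal])
  also have "\<dots> \<le> liminf (\<lambda>n::nat. ennreal C)"
  proof (rule Liminf_mono)
    have "filterlim (\<lambda>n. real (Suc n)) at_top sequentially"
      by (rule filterlim_compose[OF filterlim_real_sequentially filterlim_Suc])
    from eventually_compose_filterlim[OF assms this]
    show "\<forall>\<^sub>F n in sequentially. (\<integral>\<^sup>+t. ennreal ((t / (1 - - 1 / real (Suc n) * t)) ^ k) \<partial>\<mu>) \<le> ennreal C"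
    proof eventually_elim
      case (elim n)
      have w: "- 1 / real (Suc n) < 0" by simp
      have "(\<integral>\<^sup>+t. ennreal ((t / (1 - - 1 / real (Suc n) * t)) ^ k) \<partial>\<mu>) = ennreal (rmom k (- 1 / real (Suc n)))"
        unfolding rmom_def
        by (rule nn_integral_eq_integral[OF kernel_integrable[OF w]])
           (rule AE_I2, rule zero_le_power, rule kernel_nonneg[OF _ w], simp add: space_eq)
      then show ?case using elim by (simp add: ennreal_leI)
    qed
  qed
  also have "\<dots> < \<infinity>" by (simp add: Liminf_const)
  finally show "(\<integral>\<^sup>+t. ennreal (norm (t ^ k)) \<partial>\<mu>) < \<infinity>" .
qed simp

lemma first_moment_finite_iff: "first_moment \<mu> < \<infinity> \<longleftrightarrow> integrable \<mu> (\<lambda>t. t)"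
proof -
  have "first_moment \<mu> = (\<integral>\<^sup>+t. ennreal (norm t) \<partial>\<mu>)"
    unfolding first_moment_def by (rule nn_integral_cong) (simp add: space_eq)
  then show ?thesis using id_measurable by (simp add: integrable_iff_bounded)
qed

lemma first_moment_eq: "integrable \<mu> (\<lambda>t. t) \<Longrightarrow> enn2real (first_moment \<mu>) = mean"
  unfolding first_moment_def mean_def
  by (subst integral_eq_nn_integral) (auto intro!: AE_I2 simp: space_eq id_measurable)

lemma mean_pos: "integrable \<mu> (\<lambda>t. t) \<Longrightarrow> mean > 0"
  unfolding mean_def by (rule integral_pos_halfline)

lemma rmom_1_tendsto: "integrable \<mu> (\<lambda>t. t) \<Longrightarrow> ((\<lambda>y. rmom 1 (- 1 / y)) \<longlongrightarrow> mean) at_top"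
  using rmom_tendsto[of 1] by (simp add: mean_def)

lemma dpsi_tendsto:
  assumes i: "integrable \<mu> (\<lambda>t. t)"
  shows "((\<lambda>y. dpsi (- 1 / y)) \<longlongrightarrow> mean) at_top"
proof -
  have "((\<lambda>y. \<integral>t. - 1 / y * (t / (1 - - 1 / y * t)) ^ 2 \<partial>\<mu>) \<longlongrightarrow> (\<integral>t. 0 \<partial>\<mu>)) at_top"
  proof (rule integral_dominated_convergence_at_top[OF _ _ i])
    show "AE t in \<mu>. ((\<lambda>y. - 1 / y * (t / (1 - - 1 / y * t)) ^ 2) \<longlongrightarrow> 0) at_top"
    proof (rule AE_I2)
      fix t :: real
      have z: "((\<lambda>y::real. - 1 / y) \<longlongrightarrow> 0) at_top" by real_asymp
      have "((\<lambda>y. - 1 / y * (t / (1 - - 1 / y * t)) ^ 2) \<longlongrightarrow> 0 * t ^ 2) at_top"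
        by (intro tendsto_mult z kernel_tendsto)
      then show "((\<lambda>y. - 1 / y * (t / (1 - - 1 / y * t)) ^ 2) \<longlongrightarrow> 0) at_top" by simp
    qed
    show "\<forall>\<^sub>F y in at_top. AE t in \<mu>. norm (- 1 / y * (t / (1 - - 1 / y * t)) ^ 2) \<le> t"
      using eventually_gt_at_top[of 0]
    proof eventually_elim
      case (elim y)
      show ?case
      proof (rule AE_I2)
        fix t assume "t \<in> space \<mu>"
        then have t: "t \<ge> 0" by (simp add: space_eq)
        have w: "- 1 / y < 0" using elim by simp
        define k where "k = t / (1 - - 1 / y * t)"
        have k: "0 \<le> k" "k \<le> t" "k \<le> y"
          using kernel_nonneg[OF t w] kernel_le_self[OF t w] kernel_le[OF t w] by (auto simp: k_def)
        have "k\<^sup>2 / y = k * (k / y)" by (simp add: power2_eq_square)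
        also have "\<dots> \<le> k * 1" using k elim by (intro mult_left_mono) auto
        finally have "1 / y * k\<^sup>2 \<le> t" using k by simp
        then show "norm (- 1 / y * (t / (1 - - 1 / y * t)) ^ 2) \<le> t"
          unfolding k_def[symmetric] using elim by (simp add: abs_mult)
      qed
    qed
    show "(\<lambda>t. - 1 / y * (t / (1 - - 1 / y * t)) ^ 2) \<in> borel_measurable \<mu>" for y
      by (rule borel_measurable_times[OF borel_measurable_const kernel_measurable])
  qed simp
  then have "((\<lambda>y. - 1 / y * rmom 2 (- 1 / y)) \<longlongrightarrow> 0) at_top"
    unfolding rmom_def by (simp only: integral_mult_right_zero Bochner_Integration.integral_zero)
  from tendsto_add[OF rmom_1_tendsto[OF i] this] show ?thesis
    unfolding dpsi_def by (simp only: add_0_right)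
qed

section \<open>The derivatives of the S-transform\<close>

lemma psi_eq: "psi_transform \<mu> w = w * rmom 1 w"
  unfolding psi_transform_def rmom_def by (subst integral_mult_right_zero[symmetric]) simp

lemma psi_deriv: assumes w: "w < 0" shows "(psi_transform \<mu> has_real_derivative dpsi w) (at w)"
proof -
  have "((\<lambda>w. w * rmom 1 w) has_real_derivative dpsi w) (at w)"
    by (rule derivative_eq_intros rmom_deriv[OF w] refl)+ (simp add: dpsi_def numeral_2_eq_2)
  then show ?thesis by (simp add: psi_eq[abs_def])
qed

lemma psi_less: "w < w' \<Longrightarrow> w' < 0 \<Longrightarrow> psi_transform \<mu> w < psi_transform \<mu> w'"
  by (rule DERIV_pos_imp_increasing[of w w'], assumption)
     (rule exI, rule conjI, rule psi_deriv, simp, rule dpsi_pos, simp)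

lemma chi_psi: assumes "w < 0" shows "chi_transform \<mu> (psi_transform \<mu> w) = w"
  unfolding chi_transform_def
proof (rule the_inv_into_f_f)
  show "inj_on (psi_transform \<mu>) {..<0}"
    by (rule linorder_inj_onI) (use psi_less in \<open>force+\<close>)
qed (use assms in auto)

text \<open>The identity that makes the \<open>S\<close>-transform explicit in the variable \<open>w\<close>.\<close>

lemma S_psi: assumes w: "w < 0" shows "S_transform \<mu> (psi_transform \<mu> w) = 1 / rmom 1 w + w"
  unfolding S_transform_def chi_psi[OF w] unfolding psi_eq
  using w rmom_pos[OF w, of 1] by (simp add: field_simps)

lemma psi_surj:
  assumes "a < b" "b < 0" "psi_transform \<mu> a < z" "z < psi_transform \<mu> b"
  obtains w where "a < w" "w < b" "psi_transform \<mu> w = z"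
proof -
  have "\<exists>w\<ge>a. w \<le> b \<and> psi_transform \<mu> w = z"
    by (rule IVT') (use assms psi_deriv in \<open>auto intro!: DERIV_continuous_on[where D=dpsi] intro: has_field_derivative_at_within\<close>)
  then obtain w where "a \<le> w" "w \<le> b" "psi_transform \<mu> w = z" by blast
  then show ?thesis using that[of w] assms by (cases "w = a"; cases "w = b") auto
qed

text \<open>Derivatives of \<open>F\<close> are computed in the variable \<open>w\<close>: differentiation with respect to
\<open>z = \<psi> w\<close> is differentiation with respect to \<open>w\<close> followed by division by the derivative of \<open>\<psi>\<close>.\<close>

lemma chain_psi:
  assumes F: "\<And>w. w < 0 \<Longrightarrow> F (psi_transform \<mu> w) = Y w"
    and Y: "(Y has_real_derivative d) (at w)" and w: "w < 0"
  shows "(F has_real_derivative d / dpsi w) (at (psi_transform \<mu> w))"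
proof -
  let ?p = "psi_transform \<mu>" and ?c = "chi_transform \<mu>"
  define a b where "a = w - 1" and "b = w / 2"
  have ab: "a < w" "w < b" "b < 0" using w by (auto simp: a_def b_def)
  have inv: "?p (?c z) = z \<and> ?c z < 0" if "?p a < z" "z < ?p b" for z
    using psi_surj[OF _ ab(3) that] ab chi_psi by (metis less_trans)
  have cont: "isCont ?c (?p w)"
    by (rule isCont_inverse_function2[OF ab(1,2)])
       (use ab chi_psi DERIV_isCont[OF psi_deriv] in auto)
  have "(?c has_real_derivative inverse (dpsi w)) (at (?p w))"
  proof (rule DERIV_inverse_function[of ?p _ _ _ "?p a" "?p b"])
    show "(?p has_real_derivative dpsi w) (at (?c (?p w)))" using psi_deriv chi_psi w by simp
    show "dpsi w \<noteq> 0" using dpsi_pos[OF w] by simp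
  qed (use psi_less ab inv cont in auto)
  then have "((\<lambda>z. Y (?c z)) has_real_derivative d * inverse (dpsi w)) (at (?p w))"
    by (rule DERIV_chain2[rotated]) (use Y chi_psi w in simp)
  then have "(F has_real_derivative d * inverse (dpsi w)) (at (?p w))"
  proof (rule has_field_derivative_transform_within_open[of _ _ _ "{?p a<..<?p b}"])
    show "Y (?c z) = F z" if "z \<in> {?p a<..<?p b}" for z
      using inv[of z] F[of "?c z"] that by simp
  qed (use psi_less ab in auto)
  then show ?thesis by (simp add: divide_inverse)
qed

text \<open>The ring of functions in which the coefficients of the repeated derivatives live. The
level \<open>j\<close> bounds the order of the resolvent moments among the generators: for \<open>j \<ge> 1\<close> all members
converge at \<open>0\<close> as soon as the \<open>j\<close>th moment is finite.\<close>

inductive jet :: "nat \<Rightarrow> (real \<Rightarrow> real) \<Rightarrow> bool" for j where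
  jet_const: "jet j (\<lambda>_. c)"
| jet_id: "jet j (\<lambda>w. w)"
| jet_inv_rmom: "jet j (\<lambda>w. 1 / rmom 1 w)"
| jet_inv_dpsi: "jet j (\<lambda>w. 1 / dpsi w)"
| jet_rmom: "i \<le> j \<Longrightarrow> jet j (rmom i)"
| jet_add: "jet j f \<Longrightarrow> jet j g \<Longrightarrow> jet j (\<lambda>w. f w + g w)"
| jet_mult: "jet j f \<Longrightarrow> jet j g \<Longrightarrow> jet j (\<lambda>w. f w * g w)"

lemma jet_rmom': "i \<le> j \<Longrightarrow> jet j (\<lambda>w. rmom i w)"
  using jet_rmom[of i j] by simp

lemma jet_power: "jet j f \<Longrightarrow> jet j (\<lambda>w. f w ^ n)"
  by (induction n) (auto intro: jet_const jet_mult)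

lemma jet_uminus: "jet j f \<Longrightarrow> jet j (\<lambda>w. - f w)"
  using jet_mult[OF jet_const[of j "-1"]] by simp

lemma jet_mono: "jet j f \<Longrightarrow> j \<le> j' \<Longrightarrow> jet j' f"
  by (induction rule: jet.induct) (blast intro: jet.intros order_trans)+

lemmas jet_intros = jet_const jet_id jet_inv_rmom jet_inv_dpsi jet_rmom' jet_add jet_mult jet_power jet_uminus

lemma dpsi_deriv:
  assumes w: "w < 0"
  shows "(dpsi has_real_derivative 2 * rmom 2 w + 2 * w * rmom 3 w) (at w)"
proof -
  have 1: "(rmom 1 has_real_derivative rmom 2 w) (at w)"
    using rmom_deriv[OF w, of 1] by (simp add: numeral_2_eq_2)
  have 2: "(rmom 2 has_real_derivative 2 * rmom 3 w) (at w)"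
    using rmom_deriv[OF w, of 2] by (simp add: numeral_2_eq_2 numeral_3_eq_3)
  show ?thesis unfolding dpsi_def[abs_def]
    by (rule derivative_eq_intros 1 2 refl)+ simp
qed

lemma inv_rmom_deriv:
  assumes w: "w < 0"
  shows "((\<lambda>w. 1 / rmom 1 w) has_real_derivative - (rmom 2 w * (1 / rmom 1 w)^2)) (at w)"
  by (rule derivative_eq_intros rmom_deriv[OF w] refl)+
     (use rmom_pos[OF w, of 1] in \<open>auto simp: numeral_2_eq_2 power2_eq_square field_simps\<close>)

text \<open>Differentiation raises the level by one, except that the derivative of \<open>1 / \<psi>'\<close> contains
\<open>w m\<^sub>3\<close>, one level too high when \<open>j = 1\<close>. The additional factor \<open>w\<close> makes this term harmless, and so
it is kept apart.\<close>

lemma jet_deriv: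
  assumes "jet j f" "j \<ge> 1"
  shows "\<exists>g h. jet (Suc j) g \<and> jet (Suc j) h \<and>
    (\<forall>w<0. (f has_real_derivative g w + w * rmom (Suc (Suc j)) w * h w) (at w))"
  using assms
proof (induction rule: jet.induct)
  case (jet_const c)
  show ?case
    by (rule exI[of _ "\<lambda>_. 0"], rule exI[of _ "\<lambda>_. 0"]) (auto intro: jet_intros)
next
  case jet_id
  show ?case
    by (rule exI[of _ "\<lambda>_. 1"], rule exI[of _ "\<lambda>_. 0"]) (auto intro: jet_intros)
next
  case jet_inv_rmom
  show ?case using jet_inv_rmom inv_rmom_deriv
    by (intro exI[of _ "\<lambda>w. - (rmom 2 w * (1 / rmom 1 w)^2)"] exI[of _ "\<lambda>_. 0"])
       (auto intro!: jet_intros simp del: One_nat_def)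
next
  case jet_inv_dpsi
  have d: "((\<lambda>w. 1 / dpsi w) has_real_derivative - (2 * rmom 2 w + 2 * w * rmom 3 w) * (1 / dpsi w)^2) (at w)" if "w < 0" for w
    by (rule derivative_eq_intros dpsi_deriv[OF that] refl)+
       (use dpsi_pos[OF that] in \<open>auto simp: power2_eq_square field_simps\<close>)
  show ?case
  proof (cases "j = 1")
    case True
    have "jet (Suc j) (\<lambda>w. - (2 * rmom 2 w * (1 / dpsi w)^2))" "jet (Suc j) (\<lambda>w. 2 * - ((1 / dpsi w)^2))"
      by (intro jet_intros; simp add: True)+
    moreover have "((\<lambda>w. 1 / dpsi w) has_real_derivative - (2 * rmom 2 w * (1 / dpsi w)^2)
        + w * rmom (Suc (Suc j)) w * (2 * - ((1 / dpsi w)^2))) (at w)" if "w < 0" for w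
    proof -
      have "- (2 * rmom 2 w + 2 * w * rmom 3 w) * (1 / dpsi w)^2 = - (2 * rmom 2 w * (1 / dpsi w)^2)
        + w * rmom (Suc (Suc j)) w * (2 * - ((1 / dpsi w)^2))"
      proof -
        have S: "Suc (Suc j) = 3" by (simp add: True)
        show ?thesis unfolding S by (simp add: algebra_simps)
      qed
      then show ?thesis using d[OF that] by simp
    qed
    ultimately show ?thesis by blast
  next
    case False
    then have "j \<ge> 2" using jet_inv_dpsi by simp
    then show ?thesis
      by (intro exI[of _ "\<lambda>w. - (2 * rmom 2 w + 2 * w * rmom 3 w) * (1 / dpsi w)^2"] exI[of _ "\<lambda>w. 0"])
         (use d in \<open>auto intro!: jet_intros simp del: minus_add_distrib\<close>)
  qed
next
  case (jet_rmom i)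
  then show ?case
    by (intro exI[of _ "\<lambda>w. real i * rmom (Suc i) w"] exI[of _ "\<lambda>_. 0"])
       (auto intro!: jet_intros simp: rmom_deriv)
next
  case (jet_add f g)
  then obtain f1 f2 g1 g2 where *: "jet (Suc j) f1" "jet (Suc j) f2" "jet (Suc j) g1" "jet (Suc j) g2"
    "\<And>w. w < 0 \<Longrightarrow> (f has_real_derivative f1 w + w * rmom (Suc (Suc j)) w * f2 w) (at w)"
    "\<And>w. w < 0 \<Longrightarrow> (g has_real_derivative g1 w + w * rmom (Suc (Suc j)) w * g2 w) (at w)" by blast
  have "((\<lambda>w. f w + g w) has_real_derivative (f1 w + g1 w) + w * rmom (Suc (Suc j)) w * (f2 w + g2 w)) (at w)" if "w < 0" for w
    by (rule derivative_eq_intros *(5,6)[OF that] refl)+ (simp add: algebra_simps)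
  then show ?case using *
    by (intro exI[of _ "\<lambda>w. f1 w + g1 w"] exI[of _ "\<lambda>w. f2 w + g2 w"]) (auto intro!: jet_intros)
next
  case (jet_mult f g)
  then obtain f1 f2 g1 g2 where *: "jet (Suc j) f1" "jet (Suc j) f2" "jet (Suc j) g1" "jet (Suc j) g2"
    "\<And>w. w < 0 \<Longrightarrow> (f has_real_derivative f1 w + w * rmom (Suc (Suc j)) w * f2 w) (at w)"
    "\<And>w. w < 0 \<Longrightarrow> (g has_real_derivative g1 w + w * rmom (Suc (Suc j)) w * g2 w) (at w)" by blast
  have fg: "jet (Suc j) f" "jet (Suc j) g" using jet_mult jet_mono[of j _ "Suc j"] by auto
  have "((\<lambda>w. f w * g w) has_real_derivative (f1 w * g w + f w * g1 w)
      + w * rmom (Suc (Suc j)) w * (f2 w * g w + f w * g2 w)) (at w)" if "w < 0" for w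
    by (rule derivative_eq_intros *(5,6)[OF that] refl)+ (simp add: algebra_simps)
  then show ?case using * fg
    by (intro exI[of _ "\<lambda>w. f1 w * g w + f w * g1 w"] exI[of _ "\<lambda>w. f2 w * g w + f w * g2 w"])
       (auto intro!: jet_intros)
qed

text \<open>The coefficient of \<open>m\<^sub>j\<^sub>+\<^sub>1\<close> in the \<open>j\<close>th derivative of \<open>S\<close>; the unspecified \<open>b\<close> is suppressed
by the factor \<open>w\<close> in the limit.\<close>

definition lead_factor :: "nat \<Rightarrow> (real \<Rightarrow> real) \<Rightarrow> real \<Rightarrow> real"
  where "lead_factor j b w = fact j * ((1 / rmom 1 w)^2 * (1 / dpsi w)^j + w * b w)"

text \<open>The expansion is stated as a derivative of the preceding order rather than as a value, so that
it also provides differentiability, which \<open>deriv\<close> alone does not.\<close>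

lemma S_derivs:
  assumes "j \<ge> 1"
  shows "\<exists>b r. jet j b \<and> jet j r \<and> (\<forall>w<0.
    ((deriv ^^ (j - 1)) (S_transform \<mu>) has_real_derivative r w - lead_factor j b w * rmom (Suc j) w)
      (at (psi_transform \<mu> w)))"
  using assms
proof (induction j rule: dec_induct)
  case base
  have "((deriv ^^ (1 - 1)) (S_transform \<mu>) has_real_derivative
      1 / dpsi w - lead_factor 1 (\<lambda>_. 0) w * rmom (Suc 1) w) (at (psi_transform \<mu> w))" if w: "w < 0" for w
  proof -
    have "((\<lambda>w. 1 / rmom 1 w + w) has_real_derivative 1 - rmom 2 w * (1 / rmom 1 w)^2) (at w)"
      using DERIV_add[OF inv_rmom_deriv[OF w] DERIV_ident] by simp
    from chain_psi[OF S_psi this w] show ?thesis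
      by (simp add: lead_factor_def diff_divide_distrib numeral_2_eq_2 mult_ac)
  qed
  then show ?case
    by (intro exI[of _ "\<lambda>w. 0"] exI[of _ "\<lambda>w. 1 / dpsi w"]) (auto intro!: jet_intros)
next
  case (step j)
  then obtain b r where br: "jet j b" "jet j r" and
    D: "\<And>w. w < 0 \<Longrightarrow> ((deriv ^^ (j - 1)) (S_transform \<mu>) has_real_derivative
        r w - lead_factor j b w * rmom (Suc j) w) (at (psi_transform \<mu> w))" by blast
  have "(deriv ^^ j) (S_transform \<mu>) = deriv ((deriv ^^ (j - 1)) (S_transform \<mu>))"
    using step by (cases j) auto
  then have F: "(deriv ^^ j) (S_transform \<mu>) (psi_transform \<mu> w) = r w - lead_factor j b w * rmom (Suc j) w"
    if "w < 0" for w using DERIV_imp_deriv[OF D[OF that]] by simp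
  have jl: "jet j (lead_factor j b)"
    unfolding lead_factor_def[abs_def] by (intro jet_intros br)
  obtain g h where gh: "jet (Suc j) g" "jet (Suc j) h"
    "\<And>w. w < 0 \<Longrightarrow> (lead_factor j b has_real_derivative g w + w * rmom (Suc (Suc j)) w * h w) (at w)"
    using jet_deriv[OF jl] step by blast
  obtain g' h' where gh': "jet (Suc j) g'" "jet (Suc j) h'"
    "\<And>w. w < 0 \<Longrightarrow> (r has_real_derivative g' w + w * rmom (Suc (Suc j)) w * h' w) (at w)"
    using jet_deriv[OF br(2)] step by blast
  \<comment> \<open>All terms of the derivative that contain \<open>m\<^sub>j\<^sub>+\<^sub>2\<close> with an extra factor \<open>w\<close> are collected in \<open>b1\<close>.\<close>
  define b1 where "b1 w = (b w + 1 / fact (Suc j) * (rmom (Suc j) w * h w) + - 1 / fact (Suc j) * h' w) * (1 / dpsi w)" for w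
  define r1 where "r1 w = (g' w + - (rmom (Suc j) w * g w)) * (1 / dpsi w)" for w
  have "jet (Suc j) b" using br jet_mono by auto
  then have "jet (Suc j) b1" "jet (Suc j) r1"
    unfolding b1_def[abs_def] r1_def[abs_def] using gh gh' by (intro jet_intros; simp)+
  moreover have "((deriv ^^ (Suc j - 1)) (S_transform \<mu>) has_real_derivative
      r1 w - lead_factor (Suc j) b1 w * rmom (Suc (Suc j)) w) (at (psi_transform \<mu> w))" if w: "w < 0" for w
  proof -
    define d where "d = (g' w + w * rmom (Suc (Suc j)) w * h' w)
      - ((g w + w * rmom (Suc (Suc j)) w * h w) * rmom (Suc j) w + lead_factor j b w * (real (Suc j) * rmom (Suc (Suc j)) w))"
    have "((\<lambda>w. r w - lead_factor j b w * rmom (Suc j) w) has_real_derivative d) (at w)"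
      by (rule derivative_eq_intros gh(3)[OF w] gh'(3)[OF w] rmom_deriv[OF w] refl)+ (simp add: d_def)
    from chain_psi[OF F this w]
    have "((deriv ^^ j) (S_transform \<mu>) has_real_derivative d / dpsi w) (at (psi_transform \<mu> w))" .
    moreover have "d / dpsi w = r1 w - lead_factor (Suc j) b1 w * rmom (Suc (Suc j)) w"
    proof -
      have f: "fact (Suc j) * (1 / fact (Suc j)) = (1::real)" by (simp del: fact_Suc)
      define q where "q = 1 / dpsi w"
      define m where "m = (1 / rmom 1 w)\<^sup>2"
      define R where "R = rmom (Suc (Suc j)) w"
      define v where "v = (1 / fact (Suc j) :: real)"
      have fv: "fact (Suc j) * v = (1::real)" by (simp add: v_def del: fact_Suc)
      have fs: "fact (Suc j) = real (Suc j) * (fact j :: real)" by simp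
      have "lead_factor (Suc j) b1 w = fact (Suc j) * (m * q ^ Suc j + w * ((b w + v * (rmom (Suc j) w * h w) + - v * h' w) * q))"
        by (simp only: lead_factor_def b1_def q_def m_def v_def minus_divide_left)
      also have "\<dots> = q * (fact (Suc j) * (m * q ^ j + w * b w) + w * ((fact (Suc j) * v) * (rmom (Suc j) w * h w) - (fact (Suc j) * v) * h' w))"
        by (simp add: algebra_simps del: fact_Suc)
      also have "\<dots> = q * (real (Suc j) * lead_factor j b w + w * (rmom (Suc j) w * h w - h' w))"
        unfolding fv by (simp add: fs lead_factor_def q_def m_def del: of_nat_Suc)
      finally have l: "lead_factor (Suc j) b1 w = \<dots>" .
      have "d / dpsi w = d * q" by (simp add: q_def)
      then show ?thesis unfolding l r1_def d_def
        by (simp add: q_def[symmetric] R_def[symmetric] algebra_simps)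
    qed
    ultimately show ?thesis by simp
  qed
  ultimately show ?case by blast
qed

lemma jet_tendsto:
  assumes "jet j f" "integrable \<mu> (\<lambda>t. t ^ j)" "j \<ge> 1"
  shows "\<exists>l. ((\<lambda>y. f (- 1 / y)) \<longlongrightarrow> l) at_top"
  using assms
proof (induction rule: jet.induct)
  case jet_id
  have "((\<lambda>y::real. - 1 / y) \<longlongrightarrow> 0) at_top" by real_asymp
  then show ?case by blast
next
  case jet_inv_rmom
  then have i: "integrable \<mu> (\<lambda>t. t)" using power_integrable_mono[of j 1] by simp
  have "((\<lambda>y. 1 / rmom 1 (- 1 / y)) \<longlongrightarrow> 1 / mean) at_top"
    using mean_pos[OF i] by (intro tendsto_intros rmom_1_tendsto i) auto
  then show ?case by blast
next
  case jet_inv_dpsi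
  then have i: "integrable \<mu> (\<lambda>t. t)" using power_integrable_mono[of j 1] by simp
  have "((\<lambda>y. 1 / dpsi (- 1 / y)) \<longlongrightarrow> 1 / mean) at_top"
    using mean_pos[OF i] by (intro tendsto_intros dpsi_tendsto i) auto
  then show ?case by blast
next
  case (jet_rmom i)
  then show ?case using rmom_tendsto power_integrable_mono by blast
qed (auto intro: tendsto_const tendsto_add tendsto_mult)

lemma lead_factor_tendsto:
  assumes "jet j b" "integrable \<mu> (\<lambda>t. t ^ j)" "j \<ge> 1"
  shows "((\<lambda>y. lead_factor j b (- 1 / y)) \<longlongrightarrow> fact j / mean ^ (j + 2)) at_top"
proof -
  have i: "integrable \<mu> (\<lambda>t. t)" using power_integrable_mono[of j 1] assms by simp
  obtain l where l: "((\<lambda>y. b (- 1 / y)) \<longlongrightarrow> l) at_top" using jet_tendsto[OF assms] by blast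
  have z: "((\<lambda>y::real. - 1 / y) \<longlongrightarrow> 0) at_top" by real_asymp
  have "((\<lambda>y. lead_factor j b (- 1 / y)) \<longlongrightarrow> fact j * ((1 / mean)^2 * (1 / mean)^j + 0 * l)) at_top"
    unfolding lead_factor_def using mean_pos[OF i]
    by (intro tendsto_intros rmom_1_tendsto dpsi_tendsto i l z) auto
  also have "fact j * ((1 / mean)^2 * (1 / mean)^j + 0 * l) = fact j / mean ^ (j + 2)"
    by (simp add: power_one_over power_add power2_eq_square)
  finally show ?thesis .
qed

section \<open>Abelian and Tauberian theorems for resolvent moments\<close>

definition tail :: "real \<Rightarrow> real" where "tail y = measure \<mu> {t\<in>space \<mu>. y < t}"

text \<open>The moments of the image of \<open>\<mu>\<close> under \<open>t \<mapsto> t / (x + t)\<close>, a measure on the unit interval.\<close>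

definition umom :: "nat \<Rightarrow> real \<Rightarrow> real" where "umom k x = (\<integral>t. (t / (x + t)) ^ k \<partial>\<mu>)"

lemma tail_eq: "x \<ge> 0 \<Longrightarrow> tail x = measure \<mu> {x<..}"
  unfolding tail_def by (rule arg_cong[where f="measure \<mu>"]) (auto simp: space_eq)

lemma tail_sets: "{t\<in>space \<mu>. y < t} \<in> sets \<mu>"
  using id_measurable by measurable

lemma tail_antimono: "x \<le> y \<Longrightarrow> tail y \<le> tail x"
  unfolding tail_def by (rule finite_measure_mono) (auto simp: tail_sets)

lemma tail_nonneg: "tail x \<ge> 0" and tail_le_1: "tail x \<le> 1"
  by (simp_all add: tail_def)

lemma tail_measurable [measurable]: "tail \<in> borel_measurable borel"
proof -
  have "(\<lambda>x. - tail x) \<in> borel_measurable borel"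
    by (rule borel_measurable_mono) (auto simp: mono_def tail_antimono)
  then show ?thesis using borel_measurable_uminus_eq by auto
qed

text \<open>With \<open>w = -1/x\<close> the kernel is \<open>x\<close> times a variable in the unit interval.\<close>

lemma rmom_eq_umom: "x > 0 \<Longrightarrow> rmom k (- 1 / x) = x ^ k * umom k x"
  unfolding rmom_def umom_def integral_mult_right_zero[symmetric]
proof (rule Bochner_Integration.integral_cong)
  fix t assume x: "x > 0" and "t \<in> space \<mu>"
  then have t: "t \<ge> 0" by (simp add: space_eq)
  have "t / (1 - - 1 / x * t) = x * (t / (x + t))"
    using x t by (simp add: field_simps)
  then show "(t / (1 - - 1 / x * t)) ^ k = x ^ k * (t / (x + t)) ^ k"
    by (simp only: power_mult_distrib)
qed simp

lemma umom_integrand_measurable [simp]: "(\<lambda>t. (t / (x + t)) ^ k) \<in> borel_measurable \<mu>"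
  by (rule borel_measurable_halfline) measurable

lemma umom_integrable: "x > 0 \<Longrightarrow> integrable \<mu> (\<lambda>t. (t / (x + t)) ^ k)"
  by (rule integrable_const_bound[of _ 1]) (auto intro!: AE_I2 power_le_one simp: space_eq power_abs)

text \<open>Fubini's theorem, writing \<open>g t ^ k\<close> as the integral of \<open>k r ^ (k - 1)\<close> over \<open>0 < r < g t\<close>.\<close>

lemma layer_cake:
  assumes g [measurable]: "g \<in> borel_measurable \<mu>" and g0: "\<And>t. t \<ge> 0 \<Longrightarrow> g t \<ge> 0" and k: "k \<ge> 1"
  shows "(\<integral>\<^sup>+t. ennreal (g t ^ k) \<partial>\<mu>) =
    (\<integral>\<^sup>+r. ennreal (real k * r ^ (k - 1)) * indicator {0<..} r * emeasure \<mu> {t\<in>space \<mu>. r < g t} \<partial>lborel)"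
proof -
  interpret P: pair_sigma_finite \<mu> lborel ..
  define f where "f t r = ennreal (real k * r ^ (k - 1)) * indicator {0<..} r * (if r < g t then 1 else 0)" for t r
  have [measurable]: "case_prod f \<in> borel_measurable (\<mu> \<Otimes>\<^sub>M lborel)"
    unfolding f_def by measurable
  have "ennreal (g t ^ k) = (\<integral>\<^sup>+r. f t r \<partial>lborel)" if t: "t \<in> space \<mu>" for t
  proof -
    have g0: "g t \<ge> 0" using g0 t by (simp add: space_eq)
    have "(\<integral>\<^sup>+r. ennreal (real k * r ^ (k - 1)) * indicator {0..g t} r \<partial>lborel) = g t ^ k - 0 ^ k"
      by (rule nn_integral_FTC_Icc) (use g0 in \<open>auto intro!: derivative_eq_intros\<close>)
    moreover have "(\<integral>\<^sup>+r. ennreal (real k * r ^ (k - 1)) * indicator {0..g t} r \<partial>lborel) = (\<integral>\<^sup>+r. f t r \<partial>lborel)"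
    proof (rule nn_integral_cong_AE)
      show "AE r in lborel. ennreal (real k * r ^ (k - 1)) * indicator {0..g t} r = f t r"
        using AE_lborel_singleton[of 0] AE_lborel_singleton[of "g t"]
        by eventually_elim (auto simp: f_def indicator_def)
    qed
    ultimately show ?thesis using k by (simp add: zero_power)
  qed
  then have "(\<integral>\<^sup>+t. ennreal (g t ^ k) \<partial>\<mu>) = (\<integral>\<^sup>+t. (\<integral>\<^sup>+r. f t r \<partial>lborel) \<partial>\<mu>)"
    by (rule nn_integral_cong)
  also have "\<dots> = (\<integral>\<^sup>+r. (\<integral>\<^sup>+t. f t r \<partial>\<mu>) \<partial>lborel)"
    by (rule P.Fubini'[symmetric]) measurable
  also have "\<dots> = (\<integral>\<^sup>+r. ennreal (real k * r ^ (k - 1)) * indicator {0<..} r * emeasure \<mu> {t\<in>space \<mu>. r < g t} \<partial>lborel)"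
  proof (rule nn_integral_cong)
    fix r :: real
    have "(\<integral>\<^sup>+t. f t r \<partial>\<mu>) = (\<integral>\<^sup>+t. (ennreal (real k * r ^ (k - 1)) * indicator {0<..} r) * indicator {t\<in>space \<mu>. r < g t} t \<partial>\<mu>)"
      by (rule nn_integral_cong) (simp add: f_def indicator_def)
    also have "\<dots> = ennreal (real k * r ^ (k - 1)) * indicator {0<..} r * emeasure \<mu> {t\<in>space \<mu>. r < g t}"
      by (rule nn_integral_cmult_indicator) measurable
    finally show "(\<integral>\<^sup>+t. f t r \<partial>\<mu>) = ennreal (real k * r ^ (k - 1)) * indicator {0<..} r * emeasure \<mu> {t\<in>space \<mu>. r < g t}" .
  qed
  finally show ?thesis .
qed

text \<open>For \<open>0 < r < 1\<close> the event \<open>r < t / (x + t)\<close> is \<open>t > x r / (1 - r)\<close>, hence the tail enters.\<close>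

lemma umom_tail:
  assumes x: "x > 0" and k: "k \<ge> 1"
  shows "umom k x = (\<integral>r. indicator {0<..<1} r * (real k * r ^ (k - 1) * tail (x * (r / (1 - r)))) \<partial>lborel)"
proof -
  have eq: "{t\<in>space \<mu>. r < t / (x + t)} = {t\<in>space \<mu>. x * (r / (1 - r)) < t}" if "0 < r" "r < 1" for r
    using that x by (auto simp: space_eq field_simps)
  have e: "{t\<in>space \<mu>. r < t / (x + t)} = {}" if "r \<ge> 1" for r
  proof -
    have "t / (x + t) < r" if t: "t \<ge> 0" for t
    proof -
      have "t / (x + t) < 1" using t x by (simp add: field_simps)
      then show ?thesis using \<open>r \<ge> 1\<close> by simp
    qed
    then show ?thesis by (auto simp: space_eq not_less less_imp_le)
  qed
  have "(\<integral>\<^sup>+t. ennreal ((t / (x + t)) ^ k) \<partial>\<mu>) =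
    (\<integral>\<^sup>+r. ennreal (real k * r ^ (k - 1)) * indicator {0<..} r * emeasure \<mu> {t\<in>space \<mu>. r < t / (x + t)} \<partial>lborel)"
    by (rule layer_cake) (use x k in \<open>auto intro!: borel_measurable_halfline\<close>)
  also have "\<dots> = (\<integral>\<^sup>+r. ennreal (indicator {0<..<1} r * (real k * r ^ (k - 1) * tail (x * (r / (1 - r))))) \<partial>lborel)"
  proof (rule nn_integral_cong)
    fix r :: real
    show "ennreal (real k * r ^ (k - 1)) * indicator {0<..} r * emeasure \<mu> {t\<in>space \<mu>. r < t / (x + t)}
      = ennreal (indicator {0<..<1} r * (real k * r ^ (k - 1) * tail (x * (r / (1 - r)))))"
    proof (cases "0 < r \<and> r < 1")
      case True
      then show ?thesis unfolding eq[OF conjunct1[OF True] conjunct2[OF True]]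
        by (simp add: tail_def emeasure_eq_measure ennreal_mult)
    next
      case False
      then show ?thesis using e[of r] by (cases "r \<ge> 1") (simp_all only: emeasure_empty, auto)
    qed
  qed
  finally have "enn2real (\<integral>\<^sup>+t. ennreal ((t / (x + t)) ^ k) \<partial>\<mu>) =
    enn2real (\<integral>\<^sup>+r. ennreal (indicator {0<..<1} r * (real k * r ^ (k - 1) * tail (x * (r / (1 - r))))) \<partial>lborel)"
    by simp
  moreover have "umom k x = enn2real (\<integral>\<^sup>+t. ennreal ((t / (x + t)) ^ k) \<partial>\<mu>)"
    unfolding umom_def by (rule integral_eq_nn_integral) (use x in \<open>auto intro!: AE_I2 simp: space_eq\<close>)
  moreover have "(\<integral>r. indicator {0<..<1} r * (real k * r ^ (k - 1) * tail (x * (r / (1 - r)))) \<partial>lborel) =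
    enn2real (\<integral>\<^sup>+r. ennreal (indicator {0<..<1} r * (real k * r ^ (k - 1) * tail (x * (r / (1 - r))))) \<partial>lborel)"
    by (rule integral_eq_nn_integral) (auto intro!: AE_I2 simp: tail_nonneg indicator_def)
  ultimately show ?thesis by simp
qed

text \<open>A Potter bound for the tail that is valid for all \<open>y > 0\<close>. For small \<open>y\<close>, where the asymptotics
of the tail say nothing, the trivial bound \<open>1\<close> suffices because \<open>\<beta> > \<alpha>\<close>.\<close>

lemma tail_potter:
  assumes L: "slowly_varying L" and \<beta>: "\<alpha> < \<beta>" "\<alpha> > 0"
    and V: "((\<lambda>x. tail x / (x powr - \<alpha> * L x)) \<longlongrightarrow> 1) at_top"
  shows "\<exists>A>0. \<exists>X>0. \<forall>x\<ge>X. \<forall>y>0. tail y / (x powr - \<alpha> * L x) \<le> A * max 1 ((y / x) powr - \<beta>)"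
proof -
  define f where "f x = x powr - \<alpha> * L x" for x
  obtain X1 where X1: "X1 > 0" "\<And>x. x \<ge> X1 \<Longrightarrow> L x > 0"
    "\<And>x y. X1 \<le> x \<Longrightarrow> x \<le> y \<Longrightarrow> L y \<le> 2 * (y / x) powr (\<beta> - \<alpha>) * L x"
    "\<And>x y. X1 \<le> x \<Longrightarrow> x \<le> y \<Longrightarrow> L x \<le> 2 * (y / x) powr (\<beta> - \<alpha>) * L y"
    using slowly_varying_potter[OF L, of "\<beta> - \<alpha>"] \<beta> by auto
  obtain X2 where X2: "\<And>x. x \<ge> X2 \<Longrightarrow> tail x / f x < 2"
    using order_tendstoD(2)[OF V, of 2] by (auto simp: eventually_at_top_linorder f_def)
  define X where "X = max X1 X2"
  have X: "X > 0" using X1 by (simp add: X_def)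
  have fpos: "f x > 0" if "x \<ge> X" for x
    using X1(2)[of x] that X1(1) by (auto simp: f_def X_def)
  have V2: "tail x \<le> 2 * f x" if "x \<ge> X" for x
    using X2[of x] fpos[of x] that by (auto simp: X_def field_simps)
  have fL: "f x \<le> 2 * (x / y) powr - \<beta> * f y" if "X \<le> x" "x \<le> y" for x y
  proof -
    have xy: "x > 0" "y > 0" using that X by auto
    have "f x \<le> x powr - \<alpha> * (2 * (y / x) powr (\<beta> - \<alpha>) * L y)"
      unfolding f_def using X1(4)[of x y] that by (intro mult_left_mono) (auto simp: X_def)
    also have "\<dots> = 2 * (x / y) powr - \<beta> * f y"
      unfolding f_def using xy by (simp add: powr_divide powr_minus powr_diff field_simps)
    finally show ?thesis .
  qed
  \<comment> \<open>The constant \<open>4\<close> serves \<open>y \<ge> X\<close>; the other one makes the bound at least \<open>1\<close> for \<open>y < X\<close>.\<close>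
  define A where "A = max 4 (2 / f X)"
  have main: "tail y \<le> A * max 1 ((y / x) powr - \<beta>) * f x" if x: "x \<ge> X" and y: "y > 0" for x y
  proof -
    consider "y \<ge> x" | "X \<le> y" "y < x" | "y < X" by linarith
    then show ?thesis
    proof cases
      case 1
      have "tail y \<le> 2 * f x" using tail_antimono[OF 1] V2[OF x] by linarith
      also have "\<dots> \<le> A * max 1 ((y / x) powr - \<beta>) * f x"
        using mult_mono[of 2 A 1 "max 1 ((y / x) powr - \<beta>)"] fpos[OF x]
        by (intro mult_right_mono) (auto simp: A_def)
      finally show ?thesis .
    next
      case 2
      have "tail y \<le> 2 * f y" using V2 2 by simp
      also have "\<dots> \<le> 2 * (2 * (y / x) powr - \<beta> * f x)" using fL[of y x] 2 by (simp add: mult_ac)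
      also have "\<dots> = 4 * (y / x) powr - \<beta> * f x" by simp
      also have "\<dots> \<le> A * max 1 ((y / x) powr - \<beta>) * f x"
        using fpos[OF x] by (intro mult_right_mono mult_mono) (auto simp: A_def)
      finally show ?thesis .
    next
      case 3
      have "f X \<le> 2 * (X / x) powr - \<beta> * f x" using fL[of X x] x by simp
      also have "\<dots> \<le> 2 * (y / x) powr - \<beta> * f x"
        using fpos[OF x] X x y 3 \<beta>
        by (intro mult_right_mono mult_left_mono powr_mono2') (auto simp: divide_right_mono)
      finally have "1 \<le> 2 / f X * (y / x) powr - \<beta> * f x"
        using fpos[of X] by (simp add: field_simps)
      also have "\<dots> \<le> A * max 1 ((y / x) powr - \<beta>) * f x"
        using fpos[OF x] fpos[of X] by (intro mult_right_mono mult_mono) (auto simp: A_def)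
      finally show ?thesis using tail_le_1[of y] by linarith
    qed
  qed
  have "tail y / (x powr - \<alpha> * L x) \<le> A * max 1 ((y / x) powr - \<beta>)" if "x \<ge> X" "y > 0" for x y
    using main[OF that] fpos[OF that(1)] by (simp add: f_def pos_divide_le_eq)
  moreover have "A > 0" by (simp add: A_def)
  ultimately show ?thesis using X by blast
qed

text \<open>The Abelian half: dominated convergence in the layer cake formula, in the variable
\<open>r = u / (1 + u)\<close>.\<close>

lemma tail_imp_umom:
  assumes L: "slowly_varying L" and \<alpha>: "\<alpha> > 0" "\<alpha> < real n"
    and V: "((\<lambda>x. tail x / (x powr - \<alpha> * L x)) \<longlongrightarrow> 1) at_top"
  shows "((\<lambda>x. umom n x / (x powr - \<alpha> * L x)) \<longlongrightarrow> \<alpha> * Beta (real n - \<alpha>) \<alpha>) at_top"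
proof -
  have n: "n \<ge> 1" using \<alpha> by (cases n) auto
  define f where "f x = x powr - \<alpha> * L x" for x
  \<comment> \<open>The Potter exponent must exceed \<open>\<alpha>\<close>, but leave \<open>r powr (n - \<beta> - 1)\<close> integrable at \<open>0\<close>.\<close>
  obtain \<beta> where \<beta>: "\<alpha> < \<beta>" "\<beta> < real n" using dense[OF \<alpha>(2)] by blast
  obtain A X where AX: "X > 0" "A > 0"
    "\<And>x y. x \<ge> X \<Longrightarrow> y > 0 \<Longrightarrow> tail y / f x \<le> A * max 1 ((y / x) powr - \<beta>)"
    using tail_potter[OF L \<beta>(1) \<alpha>(1) V] unfolding f_def by metis
  define s where "s x r = indicator {0<..<1} r * (real n * r ^ (n - 1) * tail (x * (r / (1 - r)))) / f x" for x r :: real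
  define g where "g r = indicator {0..1} r * (real n * (r powr (real n - \<alpha> - 1) * (1 - r) powr ((\<alpha> + 1) - 1)))" for r :: real
  define w where "w r = A * real n * (indicator {0..1} r *\<^sub>R (r powr ((real n - \<beta>) - 1) * (1 - r) powr (1 - 1)))" for r :: real
  have fpos: "\<forall>\<^sub>F x in at_top. f x > 0"
    using slowly_varying_pos[OF L] eventually_gt_at_top[of 0] by eventually_elim (simp add: f_def)
  have rpow: "r ^ (n - 1) = r powr (real n - 1)" if "r > 0" for r :: real
    using n that by (simp add: powr_realpow[symmetric] of_nat_diff)
  have si: "set_integrable lborel {0..1} (\<lambda>r. r powr (real n - \<alpha> - 1) * (1 - r) powr ((\<alpha> + 1) - 1))"
    by (rule integrable_Beta) (use \<alpha> in auto)
  have lim: "((\<lambda>x. integral\<^sup>L lborel (s x)) \<longlongrightarrow> integral\<^sup>L lborel g) at_top"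
  proof (rule integral_dominated_convergence_at_top)
    have "(\<lambda>r. real n * (indicator {0..1} r *\<^sub>R (r powr (real n - \<alpha> - 1) * (1 - r) powr ((\<alpha> + 1) - 1)))) \<in> borel_measurable lborel"
      by (rule borel_measurable_times[OF borel_measurable_const borel_measurable_integrable[OF si[unfolded set_integrable_def]]])
    then show "g \<in> borel_measurable lborel"
      unfolding g_def by (simp add: mult.left_commute[of _ "real n"])
    show "s x \<in> borel_measurable lborel" for x unfolding s_def by measurable
    have "set_integrable lborel {0..1} (\<lambda>r. r powr ((real n - \<beta>) - 1) * (1 - r) powr (1 - 1))"
      by (rule integrable_Beta) (use \<beta> in auto)
    then show "integrable lborel w"
      unfolding w_def set_integrable_def by (rule integrable_mult_right)
    show "AE r in lborel. ((\<lambda>x. s x r) \<longlongrightarrow> g r) at_top"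
      using AE_lborel_singleton[of 0] AE_lborel_singleton[of 1]
    proof eventually_elim
      case (elim r)
      show ?case
      proof (cases "r \<in> {0<..<1}")
        case False
        then show ?thesis using elim by (auto simp: s_def g_def indicator_def)
      next
        case True
        define u where "u = r / (1 - r)"
        have u: "u > 0" using True by (simp add: u_def)
        have ut: "filterlim (\<lambda>x. u * x) at_top at_top" using u by real_asymp
        have "((\<lambda>x. tail (u * x) / f (u * x)) \<longlongrightarrow> 1) at_top"
          using filterlim_compose[OF V ut] by (simp add: f_def)
        moreover have "((\<lambda>x. f (u * x) / f x) \<longlongrightarrow> u powr - \<alpha>) at_top"
          unfolding f_def
          by (rule regularly_varying_ratio[OF L u _ filterlim_ident], rule tendsto_eventually,
              rule eventually_mono[OF eventually_gt_at_top[of 0]]) simp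
        ultimately have "((\<lambda>x. real n * r ^ (n - 1) * (tail (u * x) / f (u * x) * (f (u * x) / f x)))
            \<longlongrightarrow> real n * r ^ (n - 1) * (1 * u powr - \<alpha>)) at_top"
          by (intro tendsto_intros)
        moreover have "\<forall>\<^sub>F x in at_top. real n * r ^ (n - 1) * (tail (u * x) / f (u * x) * (f (u * x) / f x)) = s x r"
          using eventually_compose_filterlim[OF fpos ut]
          by eventually_elim (use True in \<open>simp add: s_def u_def mult.commute\<close>)
        moreover have "real n * r ^ (n - 1) * (1 * u powr - \<alpha>) = g r"
        proof -
          have r: "r > 0" "1 - r > 0" using True by auto
          have "u powr - \<alpha> = r powr - \<alpha> * (1 - r) powr \<alpha>"
            using r by (simp add: u_def powr_divide powr_minus field_simps)
          moreover have "r powr (real n - 1) * r powr - \<alpha> = r powr (real n - \<alpha> - 1)"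
            by (simp add: powr_add[symmetric] algebra_simps)
          ultimately show ?thesis
            using True unfolding rpow[OF r(1)] by (simp add: g_def mult.assoc[symmetric])
        qed
        ultimately show ?thesis by (simp add: tendsto_cong)
      qed
    qed
    show "\<forall>\<^sub>F x in at_top. AE r in lborel. norm (s x r) \<le> w r"
      using fpos eventually_ge_at_top[of X]
    proof eventually_elim
      case (elim x)
      have "norm (s x r) \<le> w r" if r: "r \<noteq> 1" for r
      proof (cases "r \<in> {0<..<1}")
        case False
        then show ?thesis using AX by (simp add: s_def w_def)
      next
        case True
        define u where "u = r / (1 - r)"
        have u: "u > 0" "u \<ge> r" using True by (auto simp: u_def field_simps)
        have x: "x > 0" using elim AX by simp
        have "tail (x * u) / f x \<le> A * max 1 (u powr - \<beta>)"
          using AX(3)[of x "x * u"] elim x u by simp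
        also have "\<dots> \<le> A * r powr - \<beta>"
        proof (rule mult_left_mono)
          have "1 \<le> r powr - \<beta>"
            using powr_mono2'[of "-\<beta>" r 1] True \<beta> \<alpha> by simp
          moreover have "u powr - \<beta> \<le> r powr - \<beta>"
            using powr_mono2'[of "-\<beta>" r u] True \<beta> \<alpha> u by simp
          ultimately show "max 1 (u powr - \<beta>) \<le> r powr - \<beta>" by simp
        qed (use AX in simp)
        finally have "real n * r ^ (n - 1) * (tail (x * u) / f x) \<le> real n * r ^ (n - 1) * (A * r powr - \<beta>)"
          using True by (intro mult_left_mono) auto
        also have "\<dots> = w r"
        proof -
          have r: "r > 0" "1 - r > 0" using True by auto
          have "r powr (real n - 1) * r powr - \<beta> = r powr (real n - \<beta> - 1)"
            by (simp add: powr_add[symmetric] algebra_simps)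
          then show ?thesis
            using True unfolding rpow[OF r(1)] by (simp add: w_def mult_ac)
        qed
        finally show ?thesis
          using True elim by (simp add: s_def u_def tail_nonneg)
      qed
      then show ?case using AE_lborel_singleton[of 1] by (auto elim: eventually_mono)
    qed
  qed
  have "((\<lambda>x. umom n x / f x) \<longlongrightarrow> integral\<^sup>L lborel g) at_top"
    by (rule Lim_transform_eventually[OF lim], rule eventually_mono[OF eventually_gt_at_top[of 0]])
       (simp add: umom_tail[OF _ n] s_def[abs_def])
  moreover have "integral\<^sup>L lborel g = \<alpha> * Beta (real n - \<alpha>) \<alpha>"
  proof -
    have "(LINT r:{0..1}|lborel. r powr (real n - \<alpha> - 1) * (1 - r) powr ((\<alpha> + 1) - 1)) = Beta (real n - \<alpha>) (\<alpha> + 1)"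
      unfolding set_borel_integral_eq_integral(2)[OF si]
      by (rule integral_unique, rule has_integral_Beta_real) (use \<alpha> in auto)
    then have "integral\<^sup>L lborel g = real n * Beta (real n - \<alpha>) (\<alpha> + 1)"
      unfolding g_def[abs_def] set_lebesgue_integral_def
      by (simp add: mult.left_commute[of _ "real n"])
    also have "\<dots> = \<alpha> * Beta (real n - \<alpha>) \<alpha>"
      using Beta_plus1_right[of \<alpha> "real n - \<alpha>"] \<alpha> by (auto simp: nonpos_Ints_def)
    finally show ?thesis .
  qed
  ultimately show ?thesis by (simp add: f_def)
qed

text \<open>Monotone densities: \<open>m\<^sub>k\<^sub>+\<^sub>1 (-1/x)\<close> is, up to \<open>k / x\<^sup>2\<close>, the derivative of \<open>m\<^sub>k (-1/x)\<close>, and it is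
increasing.\<close>

lemma umom_Suc:
  assumes L: "slowly_varying L" and k: "\<alpha> < real k" "k \<ge> 1"
    and lim: "((\<lambda>x. umom k x / (x powr - \<alpha> * L x)) \<longlongrightarrow> C) at_top"
  shows "((\<lambda>x. umom (Suc k) x / (x powr - \<alpha> * L x)) \<longlongrightarrow> C * (real k - \<alpha>) / real k) at_top"
proof -
  define \<kappa> where "\<kappa> = real k - \<alpha>"
  define \<phi> where "\<phi> x = x powr \<kappa> * L x" for x
  have \<phi>: "\<phi> x = x ^ k * (x powr - \<alpha> * L x)" if "x > 0" for x
    using that by (simp add: \<phi>_def \<kappa>_def powr_realpow[symmetric] powr_add[symmetric])
  have pos: "\<forall>\<^sub>F x in at_top. \<phi> x > 0"
    using slowly_varying_pos[OF L] eventually_gt_at_top[of 0] by eventually_elim (simp add: \<phi>_def)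
  have Glim: "((\<lambda>x. rmom k (- 1 / x) / \<phi> x) \<longlongrightarrow> C) at_top"
  proof (rule Lim_transform_eventually[OF lim])
    show "\<forall>\<^sub>F x in at_top. umom k x / (x powr - \<alpha> * L x) = rmom k (- 1 / x) / \<phi> x"
      using eventually_gt_at_top[of 0]
    proof eventually_elim
      case (elim x)
      then show ?case unfolding rmom_eq_umom[OF elim] \<phi>[OF elim] by simp
    qed
  qed
  have \<phi>lim: "((\<lambda>x. \<phi> (c * x) / \<phi> x) \<longlongrightarrow> c powr \<kappa>) at_top" if c: "c > 1" for c
    unfolding \<phi>_def using c
    by (intro regularly_varying_ratio[OF L _ _ filterlim_ident] tendsto_eventually
        eventually_mono[OF eventually_gt_at_top[of 0]]) auto
  have "((\<lambda>x. real k * rmom (Suc k) (- 1 / x) / (x * \<phi> x)) \<longlongrightarrow> C * \<kappa>) at_top"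
  proof (rule monotone_density[where G="\<lambda>x. rmom k (- 1 / x)" and q="\<lambda>c. C * c powr \<kappa> - C", OF pos])
    show "((\<lambda>x. (rmom k (- 1 / (c * x)) - rmom k (- 1 / x)) / \<phi> x) \<longlongrightarrow> C * c powr \<kappa> - C) at_top"
      if c: "c > 1" for c
    proof -
      have ct: "filterlim (\<lambda>x. c * x) at_top at_top" using c by real_asymp
      have "((\<lambda>x. rmom k (- 1 / (c * x)) / \<phi> (c * x) * (\<phi> (c * x) / \<phi> x) - rmom k (- 1 / x) / \<phi> x)
          \<longlongrightarrow> C * c powr \<kappa> - C) at_top"
        by (intro tendsto_intros \<phi>lim c Glim filterlim_compose[OF Glim ct])
      moreover have "\<forall>\<^sub>F x in at_top. rmom k (- 1 / (c * x)) / \<phi> (c * x) * (\<phi> (c * x) / \<phi> x) - rmom k (- 1 / x) / \<phi> x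
          = (rmom k (- 1 / (c * x)) - rmom k (- 1 / x)) / \<phi> x"
        using pos eventually_compose_filterlim[OF pos ct]
        by eventually_elim (simp add: diff_divide_distrib)
      ultimately show ?thesis by (simp add: tendsto_cong)
    qed
    have "((\<lambda>c. c powr \<kappa>) has_real_derivative \<kappa> * 1 powr (\<kappa> - 1)) (at 1)"
      by (rule has_real_derivative_powr) simp
    then have "((\<lambda>c. (c powr \<kappa> - 1 powr \<kappa>) / (c - 1)) \<longlongrightarrow> \<kappa>) (at_right 1)"
      by (auto simp: has_field_derivative_iff intro: tendsto_within_subset)
    then have "((\<lambda>c. C * ((c powr \<kappa> - 1 powr \<kappa>) / (c - 1))) \<longlongrightarrow> C * \<kappa>) (at_right 1)"
      by (intro tendsto_intros)
    then show "((\<lambda>c. (C * c powr \<kappa> - C) / (c - 1)) \<longlongrightarrow> C * \<kappa>) (at_right 1)"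
      by (simp add: right_diff_distrib)
  qed (use rmom_deriv_inverse \<phi>lim rmom_inverse_nonneg rmom_inverse_mono in \<open>auto intro!: mult_left_mono\<close>)
  then have "((\<lambda>x. real k * rmom (Suc k) (- 1 / x) / (x * \<phi> x) / real k) \<longlongrightarrow> C * \<kappa> / real k) at_top"
    using k by (intro tendsto_intros) auto
  moreover have "\<forall>\<^sub>F x in at_top. real k * rmom (Suc k) (- 1 / x) / (x * \<phi> x) / real k = umom (Suc k) x / (x powr - \<alpha> * L x)"
    using eventually_gt_at_top[of 0] pos
  proof eventually_elim
    case (elim x)
    then show ?case using k unfolding rmom_eq_umom[OF elim(1)] \<phi>[OF elim(1)] by simp
  qed
  ultimately show ?thesis by (simp add: \<kappa>_def tendsto_cong)
qed

lemma umom_all: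
  assumes L: "slowly_varying L" and \<alpha>: "\<alpha> > 0" "\<alpha> < real n"
    and lim: "((\<lambda>x. umom n x / (x powr - \<alpha> * L x)) \<longlongrightarrow> beta_const \<alpha> n) at_top"
  shows "((\<lambda>x. umom (n + i) x / (x powr - \<alpha> * L x)) \<longlongrightarrow> beta_const \<alpha> (n + i)) at_top"
proof (induction i)
  case (Suc i)
  let ?k = "n + i"
  have k: "\<alpha> < real ?k" "?k \<ge> 1" using \<alpha> by auto
  have "real ?k - \<alpha> \<notin> \<int>\<^sub>\<le>\<^sub>0" using k by (auto simp: nonpos_Ints_def)
  from Beta_plus1_left[OF this, of \<alpha>]
  have B: "real ?k * Beta (real (Suc ?k) - \<alpha>) \<alpha> = (real ?k - \<alpha>) * Beta (real ?k - \<alpha>) \<alpha>"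
    by (simp add: algebra_simps)
  have "beta_const \<alpha> ?k * (real ?k - \<alpha>) / real ?k = \<alpha> * ((real ?k - \<alpha>) * Beta (real ?k - \<alpha>) \<alpha>) / real ?k"
    by (simp only: beta_const_def mult_ac)
  also have "\<dots> = beta_const \<alpha> (Suc ?k)"
    using k unfolding B[symmetric] by (simp add: beta_const_def del: of_nat_add of_nat_Suc)
  finally have "beta_const \<alpha> ?k * (real ?k - \<alpha>) / real ?k = beta_const \<alpha> (Suc ?k)" .
  then show ?case using umom_Suc[OF L k Suc] by simp
qed (use lim in simp)

text \<open>The Tauberian half. After division by \<open>x powr - \<alpha> * L x\<close>, the integrals of \<open>P s * s ^ n\<close> with
\<open>s = t / (x + t)\<close> converge for every polynomial \<open>P\<close>; the tail at \<open>x\<close> is such an integral with a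
step function in place of \<open>P\<close>.\<close>

lemma umom_imp_tail:
  assumes L: "slowly_varying L" and \<alpha>: "0 < \<alpha>" "\<alpha> < real n"
    and lim: "((\<lambda>x. umom n x / (x powr - \<alpha> * L x)) \<longlongrightarrow> beta_const \<alpha> n) at_top"
  shows "((\<lambda>x. tail x / (x powr - \<alpha> * L x)) \<longlongrightarrow> 1) at_top"
proof -
  define f where "f x = x powr - \<alpha> * L x" for x
  define C where "C = beta_const \<alpha> n"
  define \<omega> where "\<omega> s = \<alpha> * (s powr (real n - \<alpha> - 1) * (1 - s) powr (\<alpha> - 1))" for s
  define S where "S v s = (if v < s then 1 / s ^ n else 0)" for v s :: real
  define A where "A \<phi> x = (\<integral>t. \<phi> (t / (x + t)) * (t / (x + t)) ^ n \<partial>\<mu>)" for \<phi> x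
  have \<omega>0: "\<omega> s \<ge> 0" for s using \<alpha> by (simp add: \<omega>_def)
  have fpos: "\<forall>\<^sub>F x in at_top. f x > 0"
    using slowly_varying_pos[OF L] eventually_gt_at_top[of 0] by eventually_elim (simp add: f_def)
  have poly: "\<exists>E. ((\<lambda>x. A P x / f x) \<longlongrightarrow> E) at_top \<and> ((\<lambda>s. P s * \<omega> s) has_integral E) {0..1} \<and>
      (\<forall>x>0. integrable \<mu> (\<lambda>t. P (t / (x + t)) * (t / (x + t)) ^ n))" if P: "real_polynomial_function P" for P
  proof -
    obtain a d where P: "P = (\<lambda>s. \<Sum>i\<le>d. a i * s ^ i)"
      using P unfolding real_polynomial_function_iff_sum by blast
    have Ps: "P s * s ^ n = (\<Sum>i\<le>d. a i * s ^ (n + i))" for s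
      by (simp add: P sum_distrib_left sum_distrib_right power_add mult_ac)
    have "((\<lambda>x. \<Sum>i\<le>d. a i * (umom (n + i) x / f x)) \<longlongrightarrow> (\<Sum>i\<le>d. a i * beta_const \<alpha> (n + i))) at_top"
      unfolding f_def by (intro tendsto_intros umom_all L \<alpha> lim)
    moreover have "\<forall>\<^sub>F x in at_top. (\<Sum>i\<le>d. a i * (umom (n + i) x / f x)) = A P x / f x"
      using eventually_gt_at_top[of 0]
    proof eventually_elim
      case (elim x)
      have "A P x = (\<Sum>i\<le>d. a i * umom (n + i) x)"
        unfolding A_def Ps umom_def using umom_integrable[OF elim]
        by (subst Bochner_Integration.integral_sum) (auto intro!: integrable_mult_right)
      then show ?case by (simp add: sum_divide_distrib)
    qed
    ultimately have "((\<lambda>x. A P x / f x) \<longlongrightarrow> (\<Sum>i\<le>d. a i * beta_const \<alpha> (n + i))) at_top"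
      by (rule Lim_transform_eventually)
    moreover have "((\<lambda>s. P s * \<omega> s) has_integral (\<Sum>i\<le>d. a i * beta_const \<alpha> (n + i))) {0..1}"
      unfolding P \<omega>_def by (rule polynomial_density_integral[OF \<alpha>])
    moreover have "integrable \<mu> (\<lambda>t. P (t / (x + t)) * (t / (x + t)) ^ n)" if "x > 0" for x
      unfolding Ps using umom_integrable[OF that]
      by (intro Bochner_Integration.integrable_sum integrable_mult_right) auto
    ultimately show ?thesis by blast
  qed
  have \<omega>C: "(\<omega> has_integral C) {0..1}"
    using polynomial_density_integral[OF \<alpha>, where d=0 and a="\<lambda>_. 1"] by (simp add: C_def \<omega>_def[abs_def])
  have C0: "C \<ge> 0" using has_integral_nonneg[OF \<omega>C] \<omega>0 by auto
  have S_int: "((\<lambda>s. S u s * \<omega> s) has_integral ((1 - u) / u) powr \<alpha>) {0..1}" if "0 < u" "u < 1" for u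
    unfolding S_def \<omega>_def by (rule tail_density_integral[OF \<alpha>(1) that])
  have tail_S: "tail x = A (S (1/2)) x"
    "integrable \<mu> (\<lambda>t. S (1/2) (t / (x + t)) * (t / (x + t)) ^ n)" if x: "x > 0" for x
  proof -
    have eq: "S (1/2) (t / (x + t)) * (t / (x + t)) ^ n = indicator {t\<in>space \<mu>. x < t} t" if "t \<in> space \<mu>" for t
      using that x by (auto simp: S_def space_eq field_simps indicator_def)
    show "tail x = A (S (1/2)) x"
      unfolding A_def using tail_sets
      by (subst Bochner_Integration.integral_cong[OF refl eq]) (auto simp: tail_def)
    show "integrable \<mu> (\<lambda>t. S (1/2) (t / (x + t)) * (t / (x + t)) ^ n)"
      using tail_sets
      by (subst Bochner_Integration.integrable_cong[OF refl eq])
         (auto intro!: integrable_real_indicator simp: less_top[symmetric])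
  qed
  have A_mono: "A \<phi> x \<le> A \<psi> x"
    if "x > 0" "\<And>s. s \<in> {0..1} \<Longrightarrow> \<phi> s \<le> \<psi> s" "integrable \<mu> (\<lambda>t. \<phi> (t / (x + t)) * (t / (x + t)) ^ n)"
      "integrable \<mu> (\<lambda>t. \<psi> (t / (x + t)) * (t / (x + t)) ^ n)" for \<phi> \<psi> x
    unfolding A_def
  proof (rule integral_mono[OF that(3,4)])
    fix t assume "t \<in> space \<mu>"
    then have "t / (x + t) \<in> {0..1}" using that(1) by (auto simp: space_eq field_simps)
    then show "\<phi> (t / (x + t)) * (t / (x + t)) ^ n \<le> \<psi> (t / (x + t)) * (t / (x + t)) ^ n"
      using that(2) by (intro mult_right_mono) auto
  qed
  have cont: "((\<lambda>u::real. ((1 - u) / u) powr \<alpha>) \<longlongrightarrow> ((1 - 1/2) / (1/2)) powr \<alpha>) (at (1/2) within Z)" for Z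
    by (intro tendsto_intros) auto
  show ?thesis
    unfolding f_def[symmetric]
  proof (rule order_tendstoI)
    fix y :: real assume y: "1 < y"
    \<comment> \<open>Starting the step a little below \<open>1/2\<close> leaves room for the ramp; its limit value tends to \<open>1\<close>.\<close>
    have "\<forall>\<^sub>F u::real in at_left (1/2). ((1 - u) / u) powr \<alpha> < y \<and> 0 < u \<and> u < 1/2"
      using y by (intro eventually_conj order_tendstoD(2)[OF cont] order_tendstoD(1)[OF tendsto_ident_at])
        (auto simp: eventually_at_filter)
    then obtain u where u: "((1 - u) / u) powr \<alpha> < y" "0 < u" "u < 1/2"
      using eventually_happens'[OF trivial_limit_at_left_real] by blast
    \<comment> \<open>The limit measure has mass \<open>C\<close>, so an approximation error \<open>e\<close> costs \<open>e * C\<close>.\<close>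
    define e where "e = (y - ((1 - u) / u) powr \<alpha>) / (C + 1)"
    have e: "e > 0" "e * (C + 1) = y - ((1 - u) / u) powr \<alpha>" using u C0 by (simp_all add: e_def)
    obtain P where P: "real_polynomial_function P" "\<And>s. s \<in> {0..1} \<Longrightarrow> S (1/2) s \<le> P s"
      "\<And>s. s \<in> {0..1} \<Longrightarrow> P s \<le> S u s + e"
      using polynomial_between_steps[OF u(2,3) e(1), of n] unfolding S_def by blast
    obtain E where E: "((\<lambda>x. A P x / f x) \<longlongrightarrow> E) at_top" "((\<lambda>s. P s * \<omega> s) has_integral E) {0..1}"
      "\<And>x. x > 0 \<Longrightarrow> integrable \<mu> (\<lambda>t. P (t / (x + t)) * (t / (x + t)) ^ n)" using poly[OF P(1)] by blast
    have "E \<le> ((1 - u) / u) powr \<alpha> + e * C"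
    proof (rule has_integral_le[OF E(2)])
      show "((\<lambda>s. S u s * \<omega> s + e * \<omega> s) has_integral ((1 - u) / u) powr \<alpha> + e * C) {0..1}"
        using S_int[of u] u by (intro has_integral_add has_integral_mult_right \<omega>C) auto
      fix s :: real assume "s \<in> {0..1}"
      from mult_right_mono[OF P(3)[OF this] \<omega>0[of s]]
      show "P s * \<omega> s \<le> S u s * \<omega> s + e * \<omega> s" by (simp add: distrib_right)
    qed
    then have "E < y" using e by (simp add: distrib_left)
    from order_tendstoD(2)[OF E(1) this] show "\<forall>\<^sub>F x in at_top. tail x / f x < y"
      using fpos eventually_gt_at_top[of 0]
    proof eventually_elim
      case (elim x)
      have "tail x \<le> A P x"
        unfolding tail_S(1)[OF elim(3)] by (rule A_mono[OF elim(3) P(2) tail_S(2) E(3)]) (use elim in auto)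
      then show ?case using elim divide_right_mono[of "tail x" "A P x" "f x"] by simp
    qed
  next
    fix y :: real assume y: "y < 1"
    \<comment> \<open>Symmetrically, the ramp from \<open>1/2\<close> to \<open>u\<close> lies below the step at \<open>1/2\<close>.\<close>
    have "\<forall>\<^sub>F u::real in at_right (1/2). ((1 - u) / u) powr \<alpha> > y \<and> 1/2 < u \<and> u < 1"
      using y by (intro eventually_conj order_tendstoD(1)[OF cont] order_tendstoD(2)[OF tendsto_ident_at])
        (auto simp: eventually_at_filter)
    then obtain u where u: "((1 - u) / u) powr \<alpha> > y" "1/2 < u" "u < 1"
      using eventually_happens'[OF trivial_limit_at_right_real] by blast
    define e where "e = (((1 - u) / u) powr \<alpha> - y) / (C + 1)"
    have e: "e > 0" "e * (C + 1) = ((1 - u) / u) powr \<alpha> - y" using u C0 by (simp_all add: e_def)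
    obtain P where P: "real_polynomial_function P" "\<And>s. s \<in> {0..1} \<Longrightarrow> S u s \<le> P s"
      "\<And>s. s \<in> {0..1} \<Longrightarrow> P s \<le> S (1/2) s + e"
      using polynomial_between_steps[OF _ u(2) e(1), of n] unfolding S_def by auto
    define Q where "Q s = P s - e" for s
    have "real_polynomial_function Q"
      unfolding Q_def[abs_def] using P(1) by (intro real_polynomial_function_diff real_polynomial_function.intros(2))
    then obtain E where E: "((\<lambda>x. A Q x / f x) \<longlongrightarrow> E) at_top" "((\<lambda>s. Q s * \<omega> s) has_integral E) {0..1}"
      "\<And>x. x > 0 \<Longrightarrow> integrable \<mu> (\<lambda>t. Q (t / (x + t)) * (t / (x + t)) ^ n)" using poly by blast
    have "((1 - u) / u) powr \<alpha> - e * C \<le> E"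
    proof (rule has_integral_le[OF _ E(2)])
      show "((\<lambda>s. S u s * \<omega> s - e * \<omega> s) has_integral ((1 - u) / u) powr \<alpha> - e * C) {0..1}"
        using S_int[of u] u by (intro has_integral_diff has_integral_mult_right \<omega>C) auto
      fix s :: real assume "s \<in> {0..1}"
      from mult_right_mono[OF P(2)[OF this] \<omega>0[of s]]
      show "S u s * \<omega> s - e * \<omega> s \<le> Q s * \<omega> s" by (simp add: Q_def left_diff_distrib)
    qed
    then have "y < E" using e by (simp add: distrib_left)
    from order_tendstoD(1)[OF E(1) this] show "\<forall>\<^sub>F x in at_top. y < tail x / f x"
      using fpos eventually_gt_at_top[of 0]
    proof eventually_elim
      case (elim x)
      have "A Q x \<le> tail x"
        unfolding tail_S(1)[OF elim(3)]
        by (rule A_mono[OF elim(3) _ E(3) tail_S(2)]) (use P(3) elim in \<open>auto simp: Q_def diff_le_eq\<close>)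
      then show ?case using elim divide_right_mono[of "A Q x" "tail x" "f x"] by simp
    qed
  qed
qed

lemma tail_iff_rmom:
  assumes L: "slowly_varying L" and \<alpha>: "0 < \<alpha>" "\<alpha> < real n"
  shows "((\<lambda>x. tail x / (x powr - \<alpha> * L x)) \<longlongrightarrow> 1) at_top \<longleftrightarrow>
    ((\<lambda>x. rmom n (- 1 / x) / (x powr (real n - \<alpha>) * L x)) \<longlongrightarrow> beta_const \<alpha> n) at_top"
proof -
  have "((\<lambda>x. rmom n (- 1 / x) / (x powr (real n - \<alpha>) * L x)) \<longlongrightarrow> beta_const \<alpha> n) at_top \<longleftrightarrow>
    ((\<lambda>x. umom n x / (x powr - \<alpha> * L x)) \<longlongrightarrow> beta_const \<alpha> n) at_top"
  proof (rule tendsto_cong)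
    show "\<forall>\<^sub>F x in at_top. rmom n (- 1 / x) / (x powr (real n - \<alpha>) * L x) = umom n x / (x powr - \<alpha> * L x)"
      using eventually_gt_at_top[of 0]
    proof eventually_elim
      case (elim x)
      have "x powr (real n - \<alpha>) = x ^ n * x powr - \<alpha>"
        using elim by (simp add: powr_realpow[symmetric] powr_add[symmetric])
      then show ?case unfolding rmom_eq_umom[OF elim] using elim by simp
    qed
  qed
  then show ?thesis
    using umom_imp_tail[OF L \<alpha>] tail_imp_umom[OF L \<alpha>] unfolding beta_const_def by blast
qed

lemma beta_const_eq:
  assumes "\<alpha> > 0" "\<alpha> < real p + 1"
  shows "beta_const \<alpha> (Suc p) * fact p = Gamma (\<alpha> + 1) * Gamma (real p + 1 - \<alpha>)"
proof -
  have "Gamma (real (Suc p) - \<alpha>) * Gamma \<alpha> = Beta (real (Suc p) - \<alpha>) \<alpha> * Gamma (real (Suc p) - \<alpha> + \<alpha>)"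
    by (rule Gamma_Gamma_Beta) (use assms in \<open>auto simp: nonpos_Ints_def\<close>)
  moreover have "Gamma (real (Suc p) - \<alpha> + \<alpha>) = fact p"
    using Gamma_fact[of p, where ?'a = real] by (simp add: add.commute)
  moreover have "Gamma (\<alpha> + 1) = \<alpha> * Gamma \<alpha>"
    by (rule Gamma_plus1) (use assms in \<open>auto simp: nonpos_Ints_def\<close>)
  ultimately show ?thesis by (simp add: beta_const_def algebra_simps)
qed

text \<open>At \<open>\<alpha> = p + 1\<close> the Tauberian theorem is available for \<open>m\<^sub>p\<^sub>+\<^sub>2\<close> only, where the constant equals
\<open>1\<close>. That \<open>m\<^sub>p\<^sub>+\<^sub>2 (-1/x) \<sim> x L x\<close> is then passed on to its primitive \<open>m\<^sub>p\<^sub>+\<^sub>1 (-1/x)\<close>, and back.\<close>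

lemma tail_iff_rmom_de_Haan:
  assumes L: "slowly_varying L"
  shows "((\<lambda>x. tail x / (x powr - (real p + 1) * L x)) \<longlongrightarrow> 1) at_top \<longleftrightarrow>
    (\<lambda>x. rmom (Suc p) (- 1 / x)) \<in> de_Haan_class L (real (Suc p))"
proof -
  define h where "h x = real (Suc p) * rmom (Suc (Suc p)) (- 1 / x)" for x
  have d: "((\<lambda>x. rmom (Suc p) (- 1 / x)) has_real_derivative h x / x\<^sup>2) (at x)" if "x > 0" for x
    unfolding h_def by (rule rmom_deriv_inverse[OF that])
  have b: "beta_const (real p + 1) (Suc (Suc p)) = 1"
    using beta_const_eq[of "real p + 1" "Suc p"] Gamma_fact[of "Suc p", where ?'a = real]
    by (simp add: add.commute)
  have n: "real (Suc (Suc p)) - (real p + 1) = 1" by simp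
  have "((\<lambda>x. tail x / (x powr - (real p + 1) * L x)) \<longlongrightarrow> 1) at_top \<longleftrightarrow>
    ((\<lambda>x. rmom (Suc (Suc p)) (- 1 / x) / (x powr 1 * L x)) \<longlongrightarrow> 1) at_top"
    using tail_iff_rmom[OF L, of "real p + 1" "Suc (Suc p)"] unfolding b n by simp
  also have "\<dots> \<longleftrightarrow> ((\<lambda>x. real (Suc p) * (rmom (Suc (Suc p)) (- 1 / x) / (x powr 1 * L x))) \<longlongrightarrow> real (Suc p) * 1) at_top"
    by (rule tendsto_mult_left_iff[symmetric]) simp
  also have "\<dots> \<longleftrightarrow> ((\<lambda>x. h x / (x * L x)) \<longlongrightarrow> real (Suc p)) at_top"
    unfolding mult_1_right
    by (rule tendsto_cong, rule eventually_mono[OF eventually_gt_at_top[of 0]]) (simp add: h_def)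
  also have "\<dots> \<longleftrightarrow> (\<lambda>x. rmom (Suc p) (- 1 / x)) \<in> de_Haan_class L (real (Suc p))"
  proof
    assume H: "((\<lambda>x. h x / (x * L x)) \<longlongrightarrow> real (Suc p)) at_top"
    show "(\<lambda>x. rmom (Suc p) (- 1 / x)) \<in> de_Haan_class L (real (Suc p))"
      by (rule derivative_imp_de_Haan[OF L _ H]) (rule d)
  next
    assume G: "(\<lambda>x. rmom (Suc p) (- 1 / x)) \<in> de_Haan_class L (real (Suc p))"
    show "((\<lambda>x. h x / (x * L x)) \<longlongrightarrow> real (Suc p)) at_top"
    proof (rule monotone_density[OF slowly_varying_pos[OF L] d, where \<rho>=0 and q="\<lambda>k. real (Suc p) * ln k"])
      have "(ln has_real_derivative 1) (at (1::real))"
        by (rule derivative_eq_intros refl | simp)+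
      then have "((\<lambda>k. (ln k - ln 1) / (k - 1)) \<longlongrightarrow> 1) (at_right (1::real))"
        by (auto simp: has_field_derivative_iff intro: tendsto_within_subset)
      from tendsto_mult_left[OF this, of "real (Suc p)"]
      show "((\<lambda>k. real (Suc p) * ln k / (k - 1)) \<longlongrightarrow> real (Suc p)) (at_right 1)"
        by (simp del: of_nat_Suc)
      show "((\<lambda>x. L (k * x) / L x) \<longlongrightarrow> k powr 0) at_top" if "k > 1" for k
        using L that unfolding slowly_varying_def by auto
      show "((\<lambda>x. (rmom (Suc p) (- 1 / (k * x)) - rmom (Suc p) (- 1 / x)) / L x) \<longlongrightarrow> real (Suc p) * ln k) at_top"
        if "k > 1" for k using G that unfolding de_Haan_class_def by auto
    qed (use rmom_inverse_nonneg rmom_inverse_mono in \<open>auto simp: h_def intro!: mult_left_mono simp del: of_nat_Suc\<close>)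
  qed
  finally show ?thesis .
qed

section \<open>The change of variable at infinity\<close>

text \<open>The maps \<open>y \<mapsto> x\<close> and \<open>x \<mapsto> y\<close> for \<open>\<psi> (-1/y) = -1/x\<close>; they move the analysis from \<open>0-\<close> to
infinity.\<close>

definition recip_psi :: "real \<Rightarrow> real" where "recip_psi y = - 1 / psi_transform \<mu> (- 1 / y)"

definition recip_chi :: "real \<Rightarrow> real" where "recip_chi x = - 1 / chi_transform \<mu> (- 1 / x)"

lemma psi_recip: "psi_transform \<mu> (- 1 / y) = - 1 / recip_psi y"
  by (simp add: recip_psi_def)

lemma recip_psi_eq: "recip_psi y = y / rmom 1 (- 1 / y)"
  by (simp add: recip_psi_def psi_eq)

lemma recip_psi_pos: "y > 0 \<Longrightarrow> recip_psi y > 0"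
  unfolding recip_psi_eq using rmom_pos[of "- 1 / y" 1] by simp

lemma recip_chi_X: "y > 0 \<Longrightarrow> recip_chi (recip_psi y) = y"
  unfolding recip_chi_def psi_recip[symmetric] by (subst chi_psi) auto

lemma recip_psi_asymp:
  assumes i: "integrable \<mu> (\<lambda>t. t)" shows "((\<lambda>y. recip_psi y / y) \<longlongrightarrow> 1 / mean) at_top"
proof -
  have "((\<lambda>y. 1 / rmom 1 (- 1 / y)) \<longlongrightarrow> 1 / mean) at_top"
    using mean_pos[OF i] by (intro tendsto_intros rmom_1_tendsto i) auto
  moreover have "\<forall>\<^sub>F y in at_top. 1 / rmom 1 (- 1 / y) = recip_psi y / y"
    using eventually_gt_at_top[of 0] by eventually_elim (simp add: recip_psi_eq)
  ultimately show ?thesis by (rule Lim_transform_eventually)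
qed

lemma recip_psi_at_top:
  assumes i: "integrable \<mu> (\<lambda>t. t)" shows "filterlim recip_psi at_top at_top"
proof -
  have "filterlim (\<lambda>y. recip_psi y / y * y) at_top at_top"
    by (rule filterlim_tendsto_pos_mult_at_top[OF recip_psi_asymp[OF i] _ filterlim_ident])
       (use mean_pos[OF i] in simp)
  moreover have "\<forall>\<^sub>F y in at_top. recip_psi y / y * y = recip_psi y"
    using eventually_gt_at_top[of 0] by eventually_elim simp
  ultimately show ?thesis by (simp add: filterlim_cong)
qed

lemma recip_psi_surj:
  assumes i: "integrable \<mu> (\<lambda>t. t)" and y: "y > 0" and x: "x \<ge> recip_psi y"
  obtains y' where "y' \<ge> y" "recip_psi y' = x"
proof (cases "x = recip_psi y")
  case True then show ?thesis using that[of y] by simp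
next
  case False
  have x0: "x > 0" using recip_psi_pos[OF y] x by simp
  have "\<forall>\<^sub>F v in at_top. recip_psi v > x \<and> v > y"
    using recip_psi_at_top[OF i] eventually_gt_at_top[of y]
    by (auto simp: filterlim_at_top_dense intro: eventually_conj)
  then obtain v where v: "recip_psi v > x" "v > y"
    by (auto simp: eventually_at_top_linorder)
  have "- 1 / y < - 1 / v" "- 1 / v < 0" using v y by (auto simp: field_simps)
  moreover have "psi_transform \<mu> (- 1 / y) < - 1 / x" "- 1 / x < psi_transform \<mu> (- 1 / v)"
    unfolding psi_recip using x False x0 v recip_psi_pos[OF y] by (auto simp: field_simps)
  ultimately obtain w where w: "- 1 / y < w" "w < - 1 / v" "psi_transform \<mu> w = - 1 / x"
    by (rule psi_surj)
  have w0: "w < 0" using w v y by (meson \<open>- 1 / v < 0\<close> less_trans)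
  have "- 1 / w \<ge> y" using w(1) w0 y by (simp add: field_simps)
  moreover have "recip_psi (- 1 / w) = x" using w(3) by (simp add: recip_psi_def)
  ultimately show ?thesis by (rule that)
qed

text \<open>Limits in \<open>x\<close> may therefore be computed in the variable \<open>y\<close>, with no inverse function left in
the formulas.\<close>

lemma filtermap_recip_psi:
  assumes i: "integrable \<mu> (\<lambda>t. t)" shows "filtermap recip_psi at_top = at_top"
proof (rule filtermap_fun_inverse[of recip_chi, OF _ recip_psi_at_top[OF i]])
  show "filterlim recip_chi at_top at_top"
    unfolding filterlim_at_top_dense
  proof
    fix Z :: real
    define y where "y = max 1 (Z + 1)"
    have "Z < recip_chi x" if x: "x \<ge> recip_psi y" for x
    proof -
      have y0: "y > 0" by (simp add: y_def)
      obtain y' where "y' \<ge> y" "recip_psi y' = x" using recip_psi_surj[OF i y0 x] by blast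
      then show ?thesis using recip_chi_X[of y'] by (auto simp: y_def)
    qed
    then show "\<forall>\<^sub>F x in at_top. Z < recip_chi x" by (rule eventually_at_top_linorderI)
  qed
  have "recip_psi (recip_chi x) = x" if x: "x \<ge> recip_psi 1" for x
  proof -
    obtain y' where "y' \<ge> 1" "recip_psi y' = x" using recip_psi_surj[OF i _ x] by auto
    then show ?thesis using recip_chi_X[of y'] by auto
  qed
  then show "\<forall>\<^sub>F x in at_top. recip_psi (recip_chi x) = x" by (rule eventually_at_top_linorderI)
qed

lemma eventually_recip_psi:
  "integrable \<mu> (\<lambda>t. t) \<Longrightarrow> eventually P at_top \<longleftrightarrow> (\<forall>\<^sub>F y in at_top. P (recip_psi y))"
  using filtermap_recip_psi eventually_filtermap[of P recip_psi at_top] by simp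

lemma tendsto_recip_psi:
  "integrable \<mu> (\<lambda>t. t) \<Longrightarrow> (f \<longlongrightarrow> l) at_top \<longleftrightarrow> ((\<lambda>y. f (recip_psi y)) \<longlongrightarrow> l) at_top"
  using filtermap_recip_psi by (metis filterlim_filtermap)

lemma recip_chi_asymp:
  assumes i: "integrable \<mu> (\<lambda>t. t)" shows "((\<lambda>x. recip_chi x / x) \<longlongrightarrow> mean) at_top"
proof (rule iffD2[OF tendsto_recip_psi[OF i]])
  have "((\<lambda>y. 1 / (recip_psi y / y)) \<longlongrightarrow> 1 / (1 / mean)) at_top"
    using mean_pos[OF i] by (intro tendsto_intros recip_psi_asymp i) auto
  moreover have "\<forall>\<^sub>F y in at_top. 1 / (recip_psi y / y) = recip_chi (recip_psi y) / recip_psi y"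
    using eventually_gt_at_top[of 0] by eventually_elim (simp add: recip_chi_X)
  ultimately have "((\<lambda>y. recip_chi (recip_psi y) / recip_psi y) \<longlongrightarrow> 1 / (1 / mean)) at_top"
    by (rule Lim_transform_eventually)
  then show "((\<lambda>y. recip_chi (recip_psi y) / recip_psi y) \<longlongrightarrow> mean) at_top" by simp
qed

lemma recip_chi_mono:
  assumes i: "integrable \<mu> (\<lambda>t. t)" and x: "recip_psi 1 \<le> x" "x \<le> x'"
  shows "1 \<le> recip_chi x" "recip_chi x \<le> recip_chi x'"
proof -
  obtain y where y: "y \<ge> 1" "recip_psi y = x" using recip_psi_surj[OF i _ x(1)] by auto
  have "recip_psi y \<le> x'" using x y by simp
  then obtain y' where y': "y' \<ge> y" "recip_psi y' = x'" using recip_psi_surj[OF i, of y x'] y(1) by auto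
  have "recip_chi x = y" "recip_chi x' = y'" using recip_chi_X[of y] recip_chi_X[of y'] y y' by auto
  then show "1 \<le> recip_chi x" "recip_chi x \<le> recip_chi x'" using y y' by auto
qed

definition S_der :: "nat \<Rightarrow> real \<Rightarrow> real"
  where "S_der j x = (deriv ^^ j) (S_transform \<mu>) (- 1 / x)"

lemma S_der_expansion:
  assumes "j \<ge> 1"
  obtains b r where "jet j b" "jet j r"
    "\<And>y. y > 0 \<Longrightarrow> S_der j (recip_psi y) = r (- 1 / y) - lead_factor j b (- 1 / y) * rmom (Suc j) (- 1 / y)"
proof -
  obtain b r where br: "jet j b" "jet j r" and D: "\<And>w. w < 0 \<Longrightarrow>
    ((deriv ^^ (j - 1)) (S_transform \<mu>) has_real_derivative r w - lead_factor j b w * rmom (Suc j) w)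
      (at (psi_transform \<mu> w))" using S_derivs[OF assms] by blast
  have "S_der j (recip_psi y) = r (- 1 / y) - lead_factor j b (- 1 / y) * rmom (Suc j) (- 1 / y)" if "y > 0" for y
  proof -
    have "(deriv ^^ j) (S_transform \<mu>) = deriv ((deriv ^^ (j - 1)) (S_transform \<mu>))"
      using assms by (cases j) auto
    moreover have "- 1 / y < 0" using that by simp
    ultimately show ?thesis
      unfolding S_der_def psi_recip[symmetric] using DERIV_imp_deriv[OF D] by metis
  qed
  then show ?thesis using that br by blast
qed

lemma S_der_deriv:
  assumes i: "integrable \<mu> (\<lambda>t. t)" and x: "x \<ge> recip_psi 1"
  shows "(S_der j has_real_derivative S_der (Suc j) x / x\<^sup>2) (at x)"
proof -
  obtain y where y: "y \<ge> 1" "recip_psi y = x" using recip_psi_surj[OF i _ x] by auto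
  have x0: "x > 0" using recip_psi_pos[of 1] x by simp
  have "\<exists>d. ((deriv ^^ j) (S_transform \<mu>) has_real_derivative d) (at (psi_transform \<mu> w))" if "w < 0" for w
    using S_derivs[of "Suc j"] that by auto
  from this[of "- 1 / y"] obtain d where
    d: "((deriv ^^ j) (S_transform \<mu>) has_real_derivative d) (at (- 1 / x))"
    unfolding psi_recip y(2) using y(1) by auto
  then have "d = S_der (Suc j) x" by (simp add: S_der_def DERIV_imp_deriv)
  moreover have "((\<lambda>x. - 1 / x) has_real_derivative 1 / x\<^sup>2) (at x)"
    by (rule derivative_eq_intros refl)+ (use x0 in \<open>auto simp: power2_eq_square field_simps\<close>)
  from DERIV_chain2[OF d this] have "(S_der j has_real_derivative d * (1 / x\<^sup>2)) (at x)"
    by (simp add: S_der_def[abs_def])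
  ultimately show ?thesis by simp
qed

section \<open>Finiteness of the moments\<close>

text \<open>The primitive of \<open>m\<^sub>p\<^sub>+\<^sub>1 (-1/x) / x\<^sup>2\<close> is \<open>m\<^sub>p (-1/x) / p\<close>.\<close>

lemma rmom_imp_moment:
  assumes p: "p \<ge> 1" and d: "inv_square_dominated (\<lambda>x. rmom (Suc p) (- 1 / x))"
  shows "integrable \<mu> (\<lambda>t. t ^ p)"
proof -
  have "((\<lambda>x. rmom p (- 1 / x) / real p) has_real_derivative rmom (Suc p) (- 1 / x) / x\<^sup>2) (at x)"
    if "x \<ge> 1" for x
    using DERIV_cdivide[OF rmom_deriv_inverse[of x p], of "real p"] that p by simp
  then obtain B where "\<forall>\<^sub>F x in at_top. \<bar>rmom p (- 1 / x) / real p\<bar> \<le> B"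
    using inv_square_dominated_primitive[OF _ d] by blast
  then have "\<forall>\<^sub>F x in at_top. rmom p (- 1 / x) \<le> B * real p"
    by eventually_elim (use p in \<open>auto simp: abs_le_iff pos_divide_le_eq\<close>)
  then show ?thesis by (rule rmom_bounded_imp_integrable)
qed

text \<open>Integrability of the \<open>p\<close>th derivative of \<open>S\<close> makes the lower derivatives bounded, by descending
induction. In turn, once the \<open>j\<close>th moment is finite, the expansion of the \<open>j\<close>th derivative
expresses \<open>m\<^sub>j\<^sub>+\<^sub>1\<close> by bounded quantities, because its coefficient stays away from \<open>0\<close>.\<close>

lemma S_der_imp_moment:
  assumes i: "integrable \<mu> (\<lambda>t. t)" and p: "p \<ge> 1" and d: "inv_square_dominated (S_der p)"
  shows "integrable \<mu> (\<lambda>t. t ^ p)"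
proof -
  have bounded: "\<exists>B. \<forall>\<^sub>F x in at_top. \<bar>S_der j x\<bar> \<le> B" if "j \<le> p - 1" for j
    using that
  proof (induction rule: inc_induct)
    case base
    show ?case
      by (rule inv_square_dominated_primitive[OF S_der_deriv[OF i]]) (use d p in simp_all)
  next
    case (step n)
    then obtain B where "\<forall>\<^sub>F x in at_top. \<bar>S_der (Suc n) x\<bar> \<le> B" by blast
    then have "S_der (Suc n) \<in> O(\<lambda>_. 1)" by (intro bigoI[of _ B]) (auto elim: eventually_mono)
    also have "(\<lambda>_. 1) \<in> O(\<lambda>x::real. x powr (1/2))"
      by (rule tendsto_imp_bigo_powr[OF tendsto_const]) simp
    finally show ?case
      by (intro inv_square_dominated_primitive[OF S_der_deriv[OF i]] inv_square_dominated_bigo)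
  qed
  from p show ?thesis
  proof (induction rule: dec_induct)
    case base
    then show ?case using i by simp
  next
    case (step j)
    obtain b r where br: "jet j b" "jet j r" and
      S: "\<And>y. y > 0 \<Longrightarrow> S_der j (recip_psi y) = r (- 1 / y) - lead_factor j b (- 1 / y) * rmom (Suc j) (- 1 / y)"
      using S_der_expansion[OF step(1)] by metis
    obtain l where l: "((\<lambda>y. r (- 1 / y)) \<longlongrightarrow> l) at_top"
      using jet_tendsto[OF br(2) step.IH step(1)] by blast
    define a where "a = fact j / mean ^ (j + 2)"
    have a: "a > 0" using mean_pos[OF i] by (simp add: a_def)
    have "j \<le> p - 1" using step(2) by linarith
    then obtain B where "\<forall>\<^sub>F x in at_top. \<bar>S_der j x\<bar> \<le> B" using bounded by blast
    then have B: "\<forall>\<^sub>F y in at_top. \<bar>S_der j (recip_psi y)\<bar> \<le> B"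
      using eventually_recip_psi[OF i, of "\<lambda>x. \<bar>S_der j x\<bar> \<le> B"] by simp
    \<comment> \<open>Near \<open>0\<close> the coefficient of \<open>m\<^sub>j\<^sub>+\<^sub>1\<close> exceeds half of its limit.\<close>
    have e1: "\<forall>\<^sub>F y in at_top. lead_factor j b (- 1 / y) > a / 2"
      using order_tendstoD(1)[OF lead_factor_tendsto[OF br(1) step.IH step(1)], of "a / 2"] a by (simp add: a_def)
    have e2: "\<forall>\<^sub>F y in at_top. r (- 1 / y) < l + 1"
      by (rule order_tendstoD(2)[OF l]) simp
    have "\<forall>\<^sub>F y in at_top. rmom (Suc j) (- 1 / y) \<le> (l + 1 + B) / (a / 2)"
      using B e1 e2 eventually_gt_at_top[of 0]
    proof eventually_elim
      case (elim y)
      have "a / 2 * rmom (Suc j) (- 1 / y) \<le> lead_factor j b (- 1 / y) * rmom (Suc j) (- 1 / y)"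
        using elim rmom_inverse_nonneg[of y "Suc j"] by (intro mult_right_mono) auto
      also have "\<dots> \<le> l + 1 + B" using S[of y] elim by auto
      finally show ?case using a by (simp add: field_simps)
    qed
    then show ?case by (rule rmom_bounded_imp_integrable)
  qed
qed

section \<open>The regularly varying case\<close>

text \<open>Since \<open>x powr \<rho> * L x\<close> tends to infinity, the convergent part \<open>r\<close> of the expansion is negligible.
The factor \<open>mean powr \<rho>\<close> stems from the change of variable.\<close>

lemma rmom_iff_S_der:
  assumes L: "slowly_varying L" and r: "\<rho> > 0" and p: "p \<ge> 1" and ip: "integrable \<mu> (\<lambda>t. t ^ p)"
  shows "((\<lambda>x. rmom (Suc p) (- 1 / x) / (x powr \<rho> * L x)) \<longlongrightarrow> C) at_top \<longleftrightarrow>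
    ((\<lambda>x. S_der p x / (x powr \<rho> * L x)) \<longlongrightarrow> - (C * (fact p / mean ^ (p + 2)) * mean powr \<rho>)) at_top"
proof -
  have i: "integrable \<mu> (\<lambda>t. t)" using power_integrable_mono[OF ip, of 1] p by simp
  note m = mean_pos[OF i]
  define E where "E x = x powr \<rho> * L x" for x
  define a where "a = fact p / mean ^ (p + 2)"
  have a: "a \<noteq> 0" using m by (simp add: a_def)
  obtain b r where br: "jet p b" "jet p r" and
    S: "\<And>y. y > 0 \<Longrightarrow> S_der p (recip_psi y) = r (- 1 / y) - lead_factor p b (- 1 / y) * rmom (Suc p) (- 1 / y)"
    using S_der_expansion[OF p] by metis
  obtain l where l: "((\<lambda>y. r (- 1 / y)) \<longlongrightarrow> l) at_top" using jet_tendsto[OF br(2) ip p] by blast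
  have le: "((\<lambda>y. lead_factor p b (- 1 / y)) \<longlongrightarrow> a) at_top"
    unfolding a_def by (rule lead_factor_tendsto[OF br(1) ip p])
  have Epos: "\<forall>\<^sub>F x in at_top. E x > 0"
    using slowly_varying_pos[OF L] eventually_gt_at_top[of 0] by eventually_elim (simp add: E_def)
  then have EXpos: "\<forall>\<^sub>F y in at_top. E (recip_psi y) > 0"
    by (rule eventually_compose_filterlim[OF _ recip_psi_at_top[OF i]])
  have rE: "((\<lambda>y. r (- 1 / y) / E y) \<longlongrightarrow> 0) at_top"
    using tendsto_mult[OF l slowly_varying_power_inverse_tendsto[OF L r]] by (simp add: E_def)
  have EX: "((\<lambda>y. E (recip_psi y) / E y) \<longlongrightarrow> (1 / mean) powr \<rho>) at_top"
    unfolding E_def using m by (intro regularly_varying_ratio[OF L _ recip_psi_asymp[OF i] filterlim_ident]) simp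
  have mr: "(1 / mean) powr \<rho> * mean powr \<rho> = 1"
    using m by (simp add: powr_mult[symmetric])
  have mr0: "(1 / mean) powr \<rho> \<noteq> 0" using m by simp
  have "((\<lambda>y. rmom (Suc p) (- 1 / y) / E y) \<longlongrightarrow> C) at_top \<longleftrightarrow>
    ((\<lambda>y. S_der p (recip_psi y) / E (recip_psi y)) \<longlongrightarrow> - (C * a * mean powr \<rho>)) at_top"
  proof
    assume R: "((\<lambda>y. rmom (Suc p) (- 1 / y) / E y) \<longlongrightarrow> C) at_top"
    have "((\<lambda>y. (r (- 1 / y) / E y - lead_factor p b (- 1 / y) * (rmom (Suc p) (- 1 / y) / E y)) / (E (recip_psi y) / E y))
        \<longlongrightarrow> (0 - a * C) / (1 / mean) powr \<rho>) at_top"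
      by (intro tendsto_intros rE le R EX mr0)
    moreover have "(0 - a * C) / (1 / mean) powr \<rho> = - (C * a * mean powr \<rho>)"
      using mr mr0 by (simp add: field_simps)
    moreover have "\<forall>\<^sub>F y in at_top. (r (- 1 / y) / E y - lead_factor p b (- 1 / y) * (rmom (Suc p) (- 1 / y) / E y)) / (E (recip_psi y) / E y)
        = S_der p (recip_psi y) / E (recip_psi y)"
      using eventually_gt_at_top[of 0] Epos EXpos
    proof eventually_elim
      case (elim y)
      show ?case unfolding S[OF elim(1)] using elim by (simp add: field_simps)
    qed
    ultimately show "((\<lambda>y. S_der p (recip_psi y) / E (recip_psi y)) \<longlongrightarrow> - (C * a * mean powr \<rho>)) at_top"
      using Lim_transform_eventually by force
  next
    assume R: "((\<lambda>y. S_der p (recip_psi y) / E (recip_psi y)) \<longlongrightarrow> - (C * a * mean powr \<rho>)) at_top"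
    have "((\<lambda>y. (r (- 1 / y) / E y - S_der p (recip_psi y) / E (recip_psi y) * (E (recip_psi y) / E y)) / lead_factor p b (- 1 / y))
        \<longlongrightarrow> (0 - - (C * a * mean powr \<rho>) * (1 / mean) powr \<rho>) / a) at_top"
      by (intro tendsto_intros rE le R EX a)
    moreover have "(0 - - (C * a * mean powr \<rho>) * (1 / mean) powr \<rho>) / a = C * ((1 / mean) powr \<rho> * mean powr \<rho>)"
      using a by (simp add: field_simps)
    moreover have "\<forall>\<^sub>F y in at_top. lead_factor p b (- 1 / y) \<noteq> 0"
      using tendsto_imp_eventually_ne[OF le a] .
    then have "\<forall>\<^sub>F y in at_top. (r (- 1 / y) / E y - S_der p (recip_psi y) / E (recip_psi y) * (E (recip_psi y) / E y)) / lead_factor p b (- 1 / y)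
        = rmom (Suc p) (- 1 / y) / E y"
      using eventually_gt_at_top[of 0] Epos EXpos
    proof eventually_elim
      case (elim y)
      show ?case unfolding S[OF elim(2)] using elim by (simp add: field_simps)
    qed
    ultimately show "((\<lambda>y. rmom (Suc p) (- 1 / y) / E y) \<longlongrightarrow> C) at_top"
      unfolding mr using Lim_transform_eventually by force
  qed
  also have "((\<lambda>y. S_der p (recip_psi y) / E (recip_psi y)) \<longlongrightarrow> - (C * a * mean powr \<rho>)) at_top \<longleftrightarrow>
    ((\<lambda>x. S_der p x / E x) \<longlongrightarrow> - (C * a * mean powr \<rho>)) at_top"
    by (rule tendsto_recip_psi[OF i, symmetric])
  finally show ?thesis unfolding E_def a_def .
qed

lemma tail_iff_S_der:
  assumes L: "slowly_varying L" and p: "p \<ge> 1" and \<alpha>: "\<alpha> < real p + 1"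
    and a: "\<alpha> > real p \<or> (\<alpha> = real p \<and> log_integral_converges L)"
  shows "((\<lambda>x. tail x / (x powr - \<alpha> * L x)) \<longlongrightarrow> 1) at_top \<longleftrightarrow>
    integrable \<mu> (\<lambda>t. t) \<and>
    ((\<lambda>x. S_der p x / (x powr (real p + 1 - \<alpha>) * L x)) \<longlongrightarrow>
      - (Gamma (\<alpha> + 1) * Gamma (real p + 1 - \<alpha>) / mean powr (\<alpha> + 1))) at_top"
proof -
  define \<rho> where "\<rho> = real p + 1 - \<alpha>"
  have \<rho>: "\<rho> > 0" using \<alpha> by (simp add: \<rho>_def)
  have \<alpha>0: "0 < \<alpha>" using a p by auto
  have n: "real (Suc p) - \<alpha> = \<rho>" by (simp add: \<rho>_def)
  define K where "K = Gamma (\<alpha> + 1) * Gamma (real p + 1 - \<alpha>) / mean powr (\<alpha> + 1)"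
  have K: "beta_const \<alpha> (Suc p) * (fact p / mean ^ (p + 2)) * mean powr \<rho> = K" if "mean > 0"
  proof -
    have "mean powr \<rho> * mean powr (\<alpha> + 1) = mean powr (real p + 2)"
      by (simp add: \<rho>_def powr_add[symmetric])
    also have "\<dots> = mean ^ (p + 2)" by (metis of_nat_add of_nat_numeral powr_realpow that)
    finally have "mean powr \<rho> * mean powr (\<alpha> + 1) = mean ^ (p + 2)" .
    then have "mean powr \<rho> / mean ^ (p + 2) = 1 / mean powr (\<alpha> + 1)"
      using that by (simp add: field_simps)
    then have "beta_const \<alpha> (Suc p) * fact p * (mean powr \<rho> / mean ^ (p + 2)) = K"
      unfolding K_def beta_const_eq[OF \<alpha>0 \<alpha>] by simp
    then show ?thesis by (simp add: mult_ac)
  qed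
  have T: "((\<lambda>x. tail x / (x powr - \<alpha> * L x)) \<longlongrightarrow> 1) at_top \<longleftrightarrow>
      ((\<lambda>x. rmom (Suc p) (- 1 / x) / (x powr \<rho> * L x)) \<longlongrightarrow> beta_const \<alpha> (Suc p)) at_top"
    using tail_iff_rmom[OF L \<alpha>0, of "Suc p"] \<alpha> unfolding n by simp
  have \<rho>1: "\<rho> < 1 \<or> (\<rho> = 1 \<and> log_integral_converges L)" using a by (auto simp: \<rho>_def)
  have i1: "integrable \<mu> (\<lambda>t. t)" if "integrable \<mu> (\<lambda>t. t ^ p)"
    using power_integrable_mono[OF that, of 1] p by simp
  have R: "((\<lambda>x. rmom (Suc p) (- 1 / x) / (x powr \<rho> * L x)) \<longlongrightarrow> beta_const \<alpha> (Suc p)) at_top \<longleftrightarrow>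
      ((\<lambda>x. S_der p x / (x powr \<rho> * L x)) \<longlongrightarrow> - K) at_top" if ip: "integrable \<mu> (\<lambda>t. t ^ p)"
    using rmom_iff_S_der[OF L \<rho> p ip, of "beta_const \<alpha> (Suc p)"]
    unfolding K[OF mean_pos[OF i1[OF ip]]] .
  show ?thesis
    unfolding K_def[symmetric] unfolding \<rho>_def[symmetric] T
  proof
    assume t: "((\<lambda>x. rmom (Suc p) (- 1 / x) / (x powr \<rho> * L x)) \<longlongrightarrow> beta_const \<alpha> (Suc p)) at_top"
    then have ip: "integrable \<mu> (\<lambda>t. t ^ p)"
      by (intro rmom_imp_moment p inv_square_dominated_regular[OF L \<rho>1])
    then show "integrable \<mu> (\<lambda>t. t) \<and> ((\<lambda>x. S_der p x / (x powr \<rho> * L x)) \<longlongrightarrow> - K) at_top"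
      using i1 R t by simp
  next
    assume "integrable \<mu> (\<lambda>t. t) \<and> ((\<lambda>x. S_der p x / (x powr \<rho> * L x)) \<longlongrightarrow> - K) at_top"
    then show "((\<lambda>x. rmom (Suc p) (- 1 / x) / (x powr \<rho> * L x)) \<longlongrightarrow> beta_const \<alpha> (Suc p)) at_top"
      using R S_der_imp_moment[OF _ p inv_square_dominated_regular[OF L \<rho>1]] by blast
  qed
qed

section \<open>The critical exponent\<close>

text \<open>In the critical case \<open>m\<^sub>p\<^sub>+\<^sub>1\<close> may diverge, but more slowly than every power. This property is stable
under the ring operations, as an arbitrary exponent can be split among the factors.\<close>

lemma jet_growth:
  assumes "jet (Suc p) f" and ip: "integrable \<mu> (\<lambda>t. t ^ p)" and p: "p \<ge> 1"
    and G: "\<And>e. e > 0 \<Longrightarrow> (\<lambda>y. rmom (Suc p) (- 1 / y)) \<in> O(\<lambda>y. y powr e)"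
  shows "e > 0 \<Longrightarrow> (\<lambda>y. f (- 1 / y)) \<in> O(\<lambda>y. y powr e)"
  using assms(1)
proof (induction arbitrary: e rule: jet.induct)
  case (jet_const c)
  then show ?case by (intro tendsto_imp_bigo_powr[OF tendsto_const]) simp
next
  case jet_id
  have "((\<lambda>y::real. - 1 / y) \<longlongrightarrow> 0) at_top" by real_asymp
  then show ?case using jet_id by (intro tendsto_imp_bigo_powr) auto
next
  case jet_inv_rmom
  obtain l where "((\<lambda>y. 1 / rmom 1 (- 1 / y)) \<longlongrightarrow> l) at_top"
    using jet_tendsto[OF jet.jet_inv_rmom ip p] by blast
  then show ?case using jet_inv_rmom by (intro tendsto_imp_bigo_powr) auto
next
  case jet_inv_dpsi
  obtain l where "((\<lambda>y. 1 / dpsi (- 1 / y)) \<longlongrightarrow> l) at_top"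
    using jet_tendsto[OF jet.jet_inv_dpsi ip p] by blast
  then show ?case using jet_inv_dpsi by (intro tendsto_imp_bigo_powr) auto
next
  case (jet_rmom i)
  show ?case
  proof (cases "i = Suc p")
    case True then show ?thesis using G jet_rmom by simp
  next
    case False
    then have "i \<le> p" using jet_rmom by simp
    then obtain l where "((\<lambda>y. rmom i (- 1 / y)) \<longlongrightarrow> l) at_top"
      using jet_tendsto[OF jet.jet_rmom ip p] by blast
    then show ?thesis using jet_rmom by (intro tendsto_imp_bigo_powr) auto
  qed
next
  case (jet_add f g)
  then show ?case by (intro sum_in_bigo) auto
next
  case (jet_mult f g)
  then have "(\<lambda>y. f (- 1 / y)) \<in> O(\<lambda>y. y powr (e / 2))" "(\<lambda>y. g (- 1 / y)) \<in> O(\<lambda>y. y powr (e / 2))" by auto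
  from bigo_powr_mult[OF this] show ?case by simp
qed

text \<open>A rate of convergence for the coefficients: the derivative in \<open>y\<close> of \<open>f (-1/y)\<close> carries the
factor \<open>1 / y\<^sup>2\<close>, and everything else grows more slowly than every power.\<close>

lemma jet_remainder:
  assumes f: "jet p f" and ip: "integrable \<mu> (\<lambda>t. t ^ p)" and p: "p \<ge> 1"
    and G: "\<And>e. e > 0 \<Longrightarrow> (\<lambda>y. rmom (Suc p) (- 1 / y)) \<in> O(\<lambda>y. y powr e)"
    and l: "((\<lambda>y. f (- 1 / y)) \<longlongrightarrow> l) at_top"
  shows "(\<lambda>y. f (- 1 / y) - l) \<in> O(\<lambda>y. y powr - (1/2))"
proof -
  obtain g h where gh: "jet (Suc p) g" "jet (Suc p) h"
    and D: "\<And>w. w < 0 \<Longrightarrow> (f has_real_derivative g w + w * rmom (Suc (Suc p)) w * h w) (at w)"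
    using jet_deriv[OF f p] by blast
  define F' where "F' y = (g (- 1 / y) + - 1 / y * rmom (Suc (Suc p)) (- 1 / y) * h (- 1 / y)) * y powr - 2" for y
  show ?thesis
  proof (rule tail_of_derivative[OF _ _ l])
    fix y :: real assume y: "y > 0"
    have "((\<lambda>x. - 1 / x) has_real_derivative y powr - 2) (at y)"
      by (rule derivative_eq_intros refl)+ (use y in \<open>auto simp: power2_eq_square powr_minus_divide powr_numeral\<close>)
    moreover have "(f has_real_derivative g (- 1 / y) + - 1 / y * rmom (Suc (Suc p)) (- 1 / y) * h (- 1 / y)) (at (- 1 / y))"
      by (rule D) (use y in simp)
    ultimately show "((\<lambda>y. f (- 1 / y)) has_real_derivative F' y) (at y)"
      unfolding F'_def by (rule DERIV_chain2[rotated])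
  next
    have m: "(\<lambda>y. - 1 / y * rmom (Suc (Suc p)) (- 1 / y)) \<in> O(\<lambda>y. y powr (1/4))"
    proof (rule landau_o.big_trans[OF _ G])
      show "(\<lambda>y. - 1 / y * rmom (Suc (Suc p)) (- 1 / y)) \<in> O(\<lambda>y. rmom (Suc p) (- 1 / y))"
      proof (rule bigoI[of _ 1])
        show "\<forall>\<^sub>F y in at_top. norm (- 1 / y * rmom (Suc (Suc p)) (- 1 / y)) \<le> 1 * norm (rmom (Suc p) (- 1 / y))"
          using eventually_gt_at_top[of 0]
        proof eventually_elim
          case (elim y)
          have w: "- 1 / y < 0" using elim by simp
          show ?case using rmom_Suc_le[OF w, of "Suc p"] rmom_pos[OF w, of "Suc p"] rmom_pos[OF w, of "Suc (Suc p)"] elim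
            by (simp add: abs_mult)
        qed
      qed
    qed simp
    have h: "(\<lambda>y. h (- 1 / y)) \<in> O(\<lambda>y. y powr (1/4))"
      by (rule jet_growth[OF gh(2) ip p G]) auto
    have g: "(\<lambda>y. g (- 1 / y)) \<in> O(\<lambda>y. y powr (1/2))"
      by (rule jet_growth[OF gh(1) ip p G]) auto
    have "(\<lambda>y. - 1 / y * rmom (Suc (Suc p)) (- 1 / y) * h (- 1 / y)) \<in> O(\<lambda>y. y powr (1/2))"
      using bigo_powr_mult[OF m h] by simp
    with g have "(\<lambda>y. g (- 1 / y) + - 1 / y * rmom (Suc (Suc p)) (- 1 / y) * h (- 1 / y)) \<in> O(\<lambda>y. y powr (1/2))"
      by (rule sum_in_bigo)
    moreover have "(\<lambda>y::real. y powr - 2) \<in> O(\<lambda>y. y powr - 2)" by simp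
    ultimately have "F' \<in> O(\<lambda>y. y powr (1/2 + - 2))"
      unfolding F'_def by (rule bigo_powr_mult)
    then
    show "F' \<in> O(\<lambda>y. y powr - (3/2))" by simp
  qed
qed

text \<open>Up to a constant and an error \<open>o(L)\<close>, the derivative of \<open>S\<close> is a multiple of the monotone function
\<open>m\<^sub>p\<^sub>+\<^sub>1\<close> in the variable \<open>y\<close>.\<close>

lemma S_der_remainder:
  assumes L: "slowly_varying L" and ip: "integrable \<mu> (\<lambda>t. t ^ p)" and p: "p \<ge> 1"
    and G: "\<And>e. e > 0 \<Longrightarrow> (\<lambda>y. rmom (Suc p) (- 1 / y)) \<in> O(\<lambda>y. y powr e)"
  shows "\<exists>l. ((\<lambda>x. (S_der p x + fact p / mean ^ (p + 2) * rmom (Suc p) (- 1 / recip_chi x) - l) / L x) \<longlongrightarrow> 0) at_top"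
proof -
  have i: "integrable \<mu> (\<lambda>t. t)" using power_integrable_mono[OF ip, of 1] p by simp
  define a where "a = fact p / mean ^ (p + 2)"
  obtain b r where br: "jet p b" "jet p r" and
    S: "\<And>y. y > 0 \<Longrightarrow> S_der p (recip_psi y) = r (- 1 / y) - lead_factor p b (- 1 / y) * rmom (Suc p) (- 1 / y)"
    using S_der_expansion[OF p] by metis
  obtain l where l: "((\<lambda>y. r (- 1 / y)) \<longlongrightarrow> l) at_top" using jet_tendsto[OF br(2) ip p] by blast
  have le: "((\<lambda>y. lead_factor p b (- 1 / y)) \<longlongrightarrow> a) at_top"
    unfolding a_def by (rule lead_factor_tendsto[OF br(1) ip p])
  have jl: "jet p (lead_factor p b)" unfolding lead_factor_def[abs_def] by (intro jet_intros br)
  have 1: "(\<lambda>y. r (- 1 / y) - l) \<in> O(\<lambda>y. y powr - (1/4))"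
    by (rule landau_o.big_trans[OF jet_remainder[OF br(2) ip p G l] bigo_powr_mono]) auto
  have "(\<lambda>y. (lead_factor p b (- 1 / y) - a) * rmom (Suc p) (- 1 / y)) \<in> O(\<lambda>y. y powr (- (1/2) + 1/4))"
    by (rule bigo_powr_mult[OF jet_remainder[OF jl ip p G le] G]) auto
  then have 2: "(\<lambda>y. (lead_factor p b (- 1 / y) - a) * rmom (Suc p) (- 1 / y)) \<in> O(\<lambda>y. y powr - (1/4))" by simp
  have "(\<lambda>y. (r (- 1 / y) - l) - (lead_factor p b (- 1 / y) - a) * rmom (Suc p) (- 1 / y)) \<in> O(\<lambda>y. y powr - (1/4))"
    by (rule sum_in_bigo[OF 1 2])
  also have "(\<lambda>y. y powr - (1/4)) \<in> o(L)"
  proof (rule smalloI_tendsto)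
    have "\<forall>\<^sub>F y in at_top. 1 / (y powr (1/4) * L y) = y powr - (1/4) / L y"
      using eventually_gt_at_top[of 0] by eventually_elim (simp add: powr_minus_divide)
    then show "((\<lambda>y. y powr - (1/4) / L y) \<longlongrightarrow> 0) at_top"
      using slowly_varying_power_inverse_tendsto[OF L, of "1/4"] Lim_transform_eventually by force
    show "\<forall>\<^sub>F y in at_top. L y \<noteq> 0" using slowly_varying_pos[OF L] by (auto elim: eventually_mono)
  qed
  finally have D: "((\<lambda>y. ((r (- 1 / y) - l) - (lead_factor p b (- 1 / y) - a) * rmom (Suc p) (- 1 / y)) / L y) \<longlongrightarrow> 0) at_top"
    by (rule smalloD_tendsto)
  have m: "1 / mean > 0" using mean_pos[OF i] by simp
  have X: "((\<lambda>y. L (recip_psi y) / L y) \<longlongrightarrow> 1) at_top"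
    by (rule slowly_varying_asymp[OF L m recip_psi_asymp[OF i] filterlim_ident])
  have "((\<lambda>y. ((r (- 1 / y) - l) - (lead_factor p b (- 1 / y) - a) * rmom (Suc p) (- 1 / y)) / L y / (L (recip_psi y) / L y)) \<longlongrightarrow> 0 / 1) at_top"
    by (intro tendsto_divide D X) simp
  moreover have "\<forall>\<^sub>F y in at_top. ((r (- 1 / y) - l) - (lead_factor p b (- 1 / y) - a) * rmom (Suc p) (- 1 / y)) / L y / (L (recip_psi y) / L y)
      = (S_der p (recip_psi y) + a * rmom (Suc p) (- 1 / recip_chi (recip_psi y)) - l) / L (recip_psi y)"
    using eventually_gt_at_top[of 0] slowly_varying_pos[OF L]
      eventually_compose_filterlim[OF slowly_varying_pos[OF L] recip_psi_at_top[OF i]]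
  proof eventually_elim
    case (elim y)
    define N where "N = (r (- 1 / y) - l) - (lead_factor p b (- 1 / y) - a) * rmom (Suc p) (- 1 / y)"
    have "N / L y / (L (recip_psi y) / L y) = N / L (recip_psi y)" using elim by simp
    moreover have "N = S_der p (recip_psi y) + a * rmom (Suc p) (- 1 / recip_chi (recip_psi y)) - l"
      unfolding S[OF elim(1)] recip_chi_X[OF elim(1)] N_def by (simp add: left_diff_distrib)
    ultimately show ?case unfolding N_def by (simp only:)
  qed
  ultimately have "((\<lambda>y. (S_der p (recip_psi y) + a * rmom (Suc p) (- 1 / recip_chi (recip_psi y)) - l) / L (recip_psi y)) \<longlongrightarrow> 0 / 1) at_top"
    by (rule Lim_transform_eventually)
  then have "((\<lambda>x. (S_der p x + a * rmom (Suc p) (- 1 / recip_chi x) - l) / L x) \<longlongrightarrow> 0 / 1) at_top"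
    by (rule iffD2[OF tendsto_recip_psi[OF i]])
  then have "((\<lambda>x. (S_der p x + a * rmom (Suc p) (- 1 / recip_chi x) - l) / L x) \<longlongrightarrow> 0) at_top"
    by simp
  then show ?thesis unfolding a_def by blast
qed

text \<open>The remainder lemma makes both memberships in the de Haan class equivalent up to the change of
variable, and the latter is harmless for monotone functions. The growth of \<open>m\<^sub>p\<^sub>+\<^sub>1\<close> that the
remainder lemma needs follows from either membership.\<close>

lemma tail_iff_S_der_de_Haan:
  assumes L: "slowly_varying L" and p: "p \<ge> 1"
  shows "((\<lambda>x. tail x / (x powr - (real p + 1) * L x)) \<longlongrightarrow> 1) at_top \<longleftrightarrow>
    integrable \<mu> (\<lambda>t. t) \<and> S_der p \<in> de_Haan_class L (- (fact (p + 1) / mean ^ (p + 2)))"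
proof -
  define G where "G x = rmom (Suc p) (- 1 / x)" for x
  define a where "a = fact p / mean ^ (p + 2)"
  have Gmono: "G x \<le> G y" if "1 \<le> x" "x \<le> y" for x y
    unfolding G_def by (rule rmom_inverse_mono) (use that in auto)
  have ac: "- a * real (Suc p) = - (fact (p + 1) / mean ^ (p + 2))"
    by (simp add: a_def mult.commute)
  show ?thesis
  proof
    assume T: "((\<lambda>x. tail x / (x powr - (real p + 1) * L x)) \<longlongrightarrow> 1) at_top"
    have GH: "G \<in> de_Haan_class L (real (Suc p))"
      using T tail_iff_rmom_de_Haan[OF L] unfolding G_def by blast
    have growth: "G \<in> O(\<lambda>y. y powr e)" if "e > 0" for e
    proof (rule de_Haan_growth[OF GH L _ that])
      fix X :: real assume X: "X \<ge> 1"
      show "bounded (G ` {X..2 * X})"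
        unfolding bounded_iff
      proof (rule exI[of _ "G (2 * X)"], intro ballI)
        fix z assume "z \<in> G ` {X..2 * X}"
        then obtain x where x: "x \<in> {X..2*X}" "z = G x" by blast
        then show "norm z \<le> G (2 * X)"
          using Gmono[of x "2 * X"] X rmom_inverse_nonneg[of x "Suc p"] by (simp add: G_def)
      qed
    qed
    have ip: "integrable \<mu> (\<lambda>t. t ^ p)"
      using rmom_imp_moment[OF p] inv_square_dominated_bigo[OF growth[of "1/2"]] by (simp add: G_def[abs_def])
    then have i: "integrable \<mu> (\<lambda>t. t)" using power_integrable_mono[OF ip, of 1] p by simp
    obtain l where l: "((\<lambda>x. (S_der p x + a * G (recip_chi x) - l) / L x) \<longlongrightarrow> 0) at_top"
      using S_der_remainder[OF L ip p growth[unfolded G_def]] unfolding a_def G_def by blast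
    have "(\<lambda>x. G (recip_chi x)) \<in> de_Haan_class L (real (Suc p))"
      by (rule de_Haan_compose[OF Gmono GH L mean_pos[OF i] recip_chi_asymp[OF i]])
    from de_Haan_affine[OF this L l, of "- a" l]
    have "(\<lambda>x. - a * G (recip_chi x) + l + (S_der p x + a * G (recip_chi x) - l)) \<in> de_Haan_class L (- a * real (Suc p))" .
    then have "S_der p \<in> de_Haan_class L (- a * real (Suc p))" by simp
    then show "integrable \<mu> (\<lambda>t. t) \<and> S_der p \<in> de_Haan_class L (- (fact (p + 1) / mean ^ (p + 2)))"
      using i unfolding ac by blast
  next
    assume "integrable \<mu> (\<lambda>t. t) \<and> S_der p \<in> de_Haan_class L (- (fact (p + 1) / mean ^ (p + 2)))"
    then have i: "integrable \<mu> (\<lambda>t. t)" and Q: "S_der p \<in> de_Haan_class L (- a * real (Suc p))"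
      unfolding ac by auto
    have a: "a > 0" using mean_pos[OF i] by (simp add: a_def)
    have Qgrowth: "S_der p \<in> O(\<lambda>y. y powr e)" if "e > 0" for e
    proof (rule de_Haan_growth[OF Q L _ that])
      fix X :: real assume X: "X \<ge> recip_psi 1"
      have "continuous_on {X..2 * X} (S_der p)"
        using X S_der_deriv[OF i]
        by (intro DERIV_continuous_on[where D="\<lambda>x. S_der (Suc p) x / x\<^sup>2"])
           (auto intro: has_field_derivative_at_within)
      then show "bounded (S_der p ` {X..2 * X})"
        by (intro compact_imp_bounded compact_continuous_image) auto
    qed
    have ip: "integrable \<mu> (\<lambda>t. t ^ p)"
      by (rule S_der_imp_moment[OF i p inv_square_dominated_bigo[OF Qgrowth]]) simp
    have growth: "G \<in> O(\<lambda>y. y powr e)" if e: "e > 0" for e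
    proof -
      obtain b r where br: "jet p b" "jet p r" and
        S: "\<And>y. y > 0 \<Longrightarrow> S_der p (recip_psi y) = r (- 1 / y) - lead_factor p b (- 1 / y) * rmom (Suc p) (- 1 / y)"
        using S_der_expansion[OF p] by metis
      obtain l where l: "((\<lambda>y. r (- 1 / y)) \<longlongrightarrow> l) at_top" using jet_tendsto[OF br(2) ip p] by blast
      have le: "((\<lambda>y. lead_factor p b (- 1 / y)) \<longlongrightarrow> a) at_top"
        unfolding a_def by (rule lead_factor_tendsto[OF br(1) ip p])
      have SX: "(\<lambda>y. S_der p (recip_psi y)) \<in> O(\<lambda>y. y powr e)"
      proof -
        have "(\<lambda>y. S_der p (recip_psi y)) \<in> O(\<lambda>y. recip_psi y powr e)"
          by (rule landau_o.big.compose[OF Qgrowth[OF e] recip_psi_at_top[OF i]])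
        also have "(\<lambda>y. recip_psi y powr e) \<in> O(\<lambda>y. y powr e)"
        proof (rule bigoI_tendsto)
          have "((\<lambda>y. (recip_psi y / y) powr e) \<longlongrightarrow> (1 / mean) powr e) at_top"
            using mean_pos[OF i] by (intro tendsto_intros recip_psi_asymp i) auto
          moreover have "\<forall>\<^sub>F y in at_top. (recip_psi y / y) powr e = recip_psi y powr e / y powr e"
            using eventually_gt_at_top[of 0] by eventually_elim (simp add: powr_divide recip_psi_pos less_imp_le)
          ultimately show "((\<lambda>y. recip_psi y powr e / y powr e) \<longlongrightarrow> (1 / mean) powr e) at_top"
            by (rule Lim_transform_eventually)
        qed (use eventually_gt_at_top[of 0] in eventually_elim, simp)
        finally show ?thesis .
      qed
      have "(\<lambda>y. r (- 1 / y) - S_der p (recip_psi y)) \<in> O(\<lambda>y. y powr e)"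
        by (rule sum_in_bigo[OF tendsto_imp_bigo_powr[OF l] SX]) (use e in simp)
      moreover have "(\<lambda>y. 1 / lead_factor p b (- 1 / y)) \<in> O(\<lambda>y. y powr 0)"
        by (rule tendsto_imp_bigo_powr[OF tendsto_divide[OF tendsto_const le]]) (use a in auto)
      ultimately have "(\<lambda>y. (r (- 1 / y) - S_der p (recip_psi y)) * (1 / lead_factor p b (- 1 / y))) \<in> O(\<lambda>y. y powr (e + 0))"
        by (rule bigo_powr_mult)
      moreover have "\<forall>\<^sub>F y in at_top. (r (- 1 / y) - S_der p (recip_psi y)) * (1 / lead_factor p b (- 1 / y)) = G y"
        using order_tendstoD(1)[OF le a] eventually_gt_at_top[of 0]
      proof eventually_elim
        case (elim y)
        then show ?case unfolding S[OF elim(2)] by (simp add: G_def)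
      qed
      ultimately show ?thesis by (simp add: landau_o.big.in_cong)
    qed
    obtain l where l: "((\<lambda>x. (S_der p x + a * G (recip_chi x) - l) / L x) \<longlongrightarrow> 0) at_top"
      using S_der_remainder[OF L ip p growth[unfolded G_def]] unfolding a_def G_def by blast
    from tendsto_mult_left[OF l, of "1 / a"]
    have "((\<lambda>x. (1 / a * (S_der p x + a * G (recip_chi x) - l)) / L x) \<longlongrightarrow> 0) at_top" by simp
    from de_Haan_affine[OF Q L this, of "- 1 / a" "l / a"]
    have "(\<lambda>x. - 1 / a * S_der p x + l / a + 1 / a * (S_der p x + a * G (recip_chi x) - l))
      \<in> de_Haan_class L (- 1 / a * (- a * real (Suc p)))" .
    moreover have "(\<lambda>x. - 1 / a * S_der p x + l / a + 1 / a * (S_der p x + a * G (recip_chi x) - l)) = (\<lambda>x. G (recip_chi x))"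
      using a by (simp add: field_simps)
    moreover have "- 1 / a * (- a * real (Suc p)) = real (Suc p)" using a by simp
    ultimately have GY: "(\<lambda>x. G (recip_chi x)) \<in> de_Haan_class L (real (Suc p))" by simp
    have "(\<lambda>y. G (recip_chi (recip_psi y))) \<in> de_Haan_class L (real (Suc p))"
    proof (rule de_Haan_compose[OF _ GY L _ recip_psi_asymp[OF i]])
      show "G (recip_chi x) \<le> G (recip_chi y)" if "recip_psi 1 \<le> x" "x \<le> y" for x y
        by (rule Gmono) (use recip_chi_mono[OF i that] in auto)
      show "1 / mean > 0" using mean_pos[OF i] by simp
    qed
    then have "G \<in> de_Haan_class L (real (Suc p))"
      by (rule de_Haan_cong[rotated])
         (use eventually_gt_at_top[of 0] in eventually_elim, simp add: recip_chi_X)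
    then show "((\<lambda>x. tail x / (x powr - (real p + 1) * L x)) \<longlongrightarrow> 1) at_top"
      using tail_iff_rmom_de_Haan[OF L] unfolding G_def by blast
  qed
qed

end

section \<open>Tails of a measure and derivatives of its S-transform\<close>

theorem theorem4p9:
  fixes \<mu> :: "real measure" and p :: nat and \<alpha> :: real and L :: "real \<Rightarrow> real"
  assumes "\<mu> \<in> prob_measures_nonneg" and "\<mu> \<noteq> dirac_zero"
    and "p \<ge> 1" and "\<alpha> \<in> {real p..real p + 1}" and "slowly_varying L"
  shows
    "(\<alpha> \<in> {real p<..<real p + 1} \<or> (\<alpha> = real p \<and> log_integral_converges L) \<longrightarrow>
       ((\<lambda>x. measure \<mu> {x<..}) \<sim>[at_top] (\<lambda>x. x powr (- \<alpha>) * L x) \<longleftrightarrow>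
        first_moment \<mu> < \<infinity> \<and>
        (\<lambda>x. (deriv ^^ p) (S_transform \<mu>) (- 1 / x)) \<sim>[at_top]
          (\<lambda>x. - (Gamma (\<alpha> + 1) * Gamma (real p + 1 - \<alpha>) / enn2real (first_moment \<mu>) powr (\<alpha> + 1))
                 * x powr (real p + 1 - \<alpha>) * L x)))
     \<and>
     (\<alpha> = real p + 1 \<and> log_integral_diverges L \<longrightarrow>
       ((\<lambda>x. measure \<mu> {x<..}) \<sim>[at_top] (\<lambda>x. x powr (- \<alpha>) * L x) \<longleftrightarrow>
        first_moment \<mu> < \<infinity> \<and>
        (\<lambda>x. (deriv ^^ p) (S_transform \<mu>) (- 1 / x)) \<in>
          de_Haan_class L (- (fact (p + 1) / enn2real (first_moment \<mu>) ^ (p + 2)))))"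
proof -
  let ?T = "(\<lambda>x. measure \<mu> {x<..}) \<sim>[at_top] (\<lambda>x. x powr (- \<alpha>) * L x)"
  let ?S = "(\<lambda>x. (deriv ^^ p) (S_transform \<mu>) (- 1 / x)) \<sim>[at_top]
        (\<lambda>x. - (Gamma (\<alpha> + 1) * Gamma (real p + 1 - \<alpha>) / enn2real (first_moment \<mu>) powr (\<alpha> + 1))
                 * x powr (real p + 1 - \<alpha>) * L x)"
  interpret halfline_prob \<mu>
    using assms(1,2) by (simp add: halfline_prob_def halfline_prob_axioms_def prob_measures_nonneg_def)
  note p = assms(3) and L = assms(5)
  have tail: "?T \<longleftrightarrow> ((\<lambda>x. tail x / (x powr - \<alpha> * L x)) \<longlongrightarrow> 1) at_top"
  proof -
    have "\<forall>\<^sub>F x in at_top. x powr (- \<alpha>) * L x \<noteq> 0"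
      using slowly_varying_pos[OF L] eventually_gt_at_top[of 0] by eventually_elim simp
    then have "?T \<longleftrightarrow> ((\<lambda>x. measure \<mu> {x<..} / (x powr - \<alpha> * L x)) \<longlongrightarrow> 1) at_top"
      by (rule asymp_equiv_iff_ratio)
    also have "\<dots> \<longleftrightarrow> ((\<lambda>x. tail x / (x powr - \<alpha> * L x)) \<longlongrightarrow> 1) at_top"
      by (rule tendsto_cong, rule eventually_mono[OF eventually_ge_at_top[of 0]]) (simp add: tail_eq)
    finally show ?thesis .
  qed
  show ?thesis
  proof (intro conjI impI)
    assume "\<alpha> \<in> {real p<..<real p + 1} \<or> (\<alpha> = real p \<and> log_integral_converges L)"
    then have \<alpha>: "\<alpha> < real p + 1" "\<alpha> > real p \<or> (\<alpha> = real p \<and> log_integral_converges L)" by auto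
    have S: "?S \<longleftrightarrow>
      ((\<lambda>x. S_der p x / (x powr (real p + 1 - \<alpha>) * L x)) \<longlongrightarrow>
        - (Gamma (\<alpha> + 1) * Gamma (real p + 1 - \<alpha>) / mean powr (\<alpha> + 1))) at_top"
      if i: "integrable \<mu> (\<lambda>t. t)"
    proof -
      define K where "K = - (Gamma (\<alpha> + 1) * Gamma (real p + 1 - \<alpha>) / mean powr (\<alpha> + 1))"
      have K: "K \<noteq> 0"
      proof -
        have "Gamma (\<alpha> + 1) > 0" "Gamma (real p + 1 - \<alpha>) > 0"
          by (rule Gamma_real_pos; use \<alpha> in auto)+
        then show ?thesis using mean_pos[OF i] by (simp add: K_def)
      qed
      have "\<forall>\<^sub>F x in at_top. K * x powr (real p + 1 - \<alpha>) * L x \<noteq> 0"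
        using slowly_varying_pos[OF L] eventually_gt_at_top[of 0] by eventually_elim (simp add: K)
      then have "S_der p \<sim>[at_top] (\<lambda>x. K * x powr (real p + 1 - \<alpha>) * L x) \<longleftrightarrow>
        ((\<lambda>x. S_der p x / (K * x powr (real p + 1 - \<alpha>) * L x)) \<longlongrightarrow> 1) at_top"
        by (rule asymp_equiv_iff_ratio)
      also have "\<dots> \<longleftrightarrow> ((\<lambda>x. K * (S_der p x / (K * x powr (real p + 1 - \<alpha>) * L x))) \<longlongrightarrow> K * 1) at_top"
        by (rule tendsto_mult_left_iff[OF K, symmetric])
      also have "\<dots> \<longleftrightarrow> ((\<lambda>x. S_der p x / (x powr (real p + 1 - \<alpha>) * L x)) \<longlongrightarrow> K) at_top"
        using K by (simp add: mult.assoc)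
      finally show ?thesis unfolding first_moment_eq[OF i] K_def S_der_def[abs_def] .
    qed
    show "?T \<longleftrightarrow> first_moment \<mu> < \<infinity> \<and> ?S"
      unfolding tail tail_iff_S_der[OF L p \<alpha>] first_moment_finite_iff using S by blast
  next
    assume "\<alpha> = real p + 1 \<and> log_integral_diverges L"
    then have \<alpha>: "\<alpha> = real p + 1" by simp
    show "?T \<longleftrightarrow>
        first_moment \<mu> < \<infinity> \<and>
        (\<lambda>x. (deriv ^^ p) (S_transform \<mu>) (- 1 / x)) \<in>
          de_Haan_class L (- (fact (p + 1) / enn2real (first_moment \<mu>) ^ (p + 2)))"
      unfolding tail unfolding \<alpha> tail_iff_S_der_de_Haan[OF L p] first_moment_finite_iff S_der_def[abs_def]
      using first_moment_eq by auto
  qed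
qed

end
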